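(* Let $F$ be any field and let $p$ be a prime number. Then the absolute Galois group $G_F$ of $F$ has the vanishing triple Massey product property with respect to $\mathbb{F}_p$.
   Context: For a field $F$ with separable closure $F_s$, $G_F=\mathrm{Gal}(F_s/F)$ is the absolute Galois group, a profinite group. Let $G$ be a profinite group and $p$ a prime; $\mathbb{F}_p$ is a trivial discrete $G$-module. $C^\bullet(G,\mathbb{F}_p)$ is the differential graded algebra of inhomogeneous continuous cochains, with differential $\partial$ and cup product $\cup$; in degree 1, $(\partial f)(\sigma,\tau)=f(\sigma)+f(\tau)-f(\sigma\tau)$ and $(f\cup g)(\sigma,\tau)=f(\sigma)g(\tau)$. $H^i(G,\mathbb{F}_p)$ are its cohomology groups, and $H^1(G,\mathbb{F}_p)=\mathrm{Hom}(G,\mathbb{F}_p)$ (continuous homomorphisms). Let $\chi_1,\chi_2,\chi_3\in H^1(G,\mathbb{F}_p)$. The triple Massey product $\langle\chi_1,\chi_2,\chi_3\rangle$ is said to be defined if $\chi_1\cup\chi_2=\chi_2\cup\chi_3=0$ in $H^2(G,\mathbb{F}_p)$. In that case a defining system $D$ consists of cochains $D_{12},D_{23}\in C^1(G,\mathbb{F}_p)$ with $\partial D_{12}=\chi_1\cup\chi_2$ and $\partial D_{23}=\chi_2\cup\chi_3$ in $C^2(G,\mathbb{F}_p)$. Then $\chi_1\cup D_{23}+D_{12}\cup\chi_3$ is a 2-cocycle, and its class in $H^2(G,\mathbb{F}_p)$ is the value $\langle\chi_1,\chi_2,\chi_3\rangle_D$. The triple Massey product $\langle\chi_1,\chi_2,\chi_3\rangle\subseteq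 H^2(G,\mathbb{F}_p)$ is the set of all values over all defining systems $D$. It vanishes if it contains $0$. $G$ has the vanishing triple Massey product property with respect to $\mathbb{F}_p$ if every triple Massey product $\langle\chi_1,\chi_2,\chi_3\rangle$ with $\chi_1,\chi_2,\chi_3\in H^1(G,\mathbb{F}_p)$ vanishes whenever it is defined. *)

theory Defs
  imports
    "HOL-Analysis.Analysis"
    "HOL-Algebra.Algebraic_Closure_Type"
    "HOL-Number_Theory.Residues"
begin

section \<open>The absolute Galois group\<close>

text \<open>
  \<^typ>\<open>'a alg_closure\<close> is an algebraic closure of the field \<^typ>\<open>'a\<close>, with embedding
  \<^term>\<open>to_ac\<close>. An element is separable over \<^typ>\<open>'a\<close> if its minimal polynomial, that is,
  the irreducible polynomial over \<^typ>\<open>'a\<close> (unique up to a unit) vanishing at it, has only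
  simple roots in the algebraic closure. Since HOL-Algebra also declares constants called
  \<open>irreducible\<close> and \<open>prime\<close>, the type class notions are written with qualified names.
\<close>

definition separable_element :: "'a::field alg_closure \<Rightarrow> bool" where
  "separable_element x \<longleftrightarrow>
     (\<exists>f :: 'a Polynomial.poly. Factorial_Ring.irreducible f \<and>
        Polynomial.poly (map_poly to_ac f) x = 0 \<and> rsquarefree (map_poly to_ac f))"

definition separable_closure :: "'a::field itself \<Rightarrow> 'a alg_closure set" where
  "separable_closure _ = {x. separable_element x}"

text \<open>
  The elements are field automorphisms of the separable closure over the base field, as functions
  that are \<^term>\<open>undefined\<close> outside of it, so that equality of automorphisms is equality in HOL.
\<close>

definition absolute_galois_group ::
  "'a::field itself \<Rightarrow> ('a alg_closure \<Rightarrow> 'a alg_closure) monoid" where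
  "absolute_galois_group F =
     (let Fs = separable_closure F in
      \<lparr>carrier = {\<sigma> \<in> extensional Fs. bij_betw \<sigma> Fs Fs \<and>
          (\<forall>x\<in>Fs. \<forall>y\<in>Fs. \<sigma> (x + y) = \<sigma> x + \<sigma> y \<and> \<sigma> (x * y) = \<sigma> x * \<sigma> y) \<and>
          (\<forall>a. \<sigma> (to_ac a) = to_ac a)},
       monoid.mult = compose Fs,
       one = (\<lambda>x\<in>Fs. x)\<rparr>)"

text \<open>
  The Krull topology, as the topology of pointwise convergence for the discrete topology on the
  separable closure. Lemma \<open>openin_krull_topology\<close> below gives the usual description: the
  automorphisms agreeing with \<open>\<sigma>\<close> on a finite set (equivalently, on the finite
  subextension that it generates) form a basis of neighbourhoods of \<open>\<sigma>\<close>.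
\<close>

definition krull_topology ::
  "'a::field itself \<Rightarrow> ('a alg_closure \<Rightarrow> 'a alg_closure) topology" where
  "krull_topology F =
     subtopology
       (product_topology (\<lambda>_. discrete_topology (separable_closure F)) (separable_closure F))
       (carrier (absolute_galois_group F))"

lemma carrier_absolute_galois_group_subset:
  "carrier (absolute_galois_group F) \<subseteq> separable_closure F \<rightarrow>\<^sub>E separable_closure F"
  by (auto simp: absolute_galois_group_def Let_def bij_betw_def PiE_iff extensional_def)

lemma topspace_krull_topology [simp]:
  "topspace (krull_topology F) = carrier (absolute_galois_group F)"
  using carrier_absolute_galois_group_subset[of F]
  by (auto simp: krull_topology_def)

lemma openin_krull_topology:
  "openin (krull_topology F) U \<longleftrightarrow>
     U \<subseteq> carrier (absolute_galois_group F) \<and>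
     (\<forall>\<sigma>\<in>U. \<exists>S. finite S \<and> S \<subseteq> separable_closure F \<and>
        {\<tau> \<in> carrier (absolute_galois_group F). \<forall>x\<in>S. \<tau> x = \<sigma> x} \<subseteq> U)"
  (is "_ \<longleftrightarrow> U \<subseteq> ?G \<and> ?R")
proof
  let ?Fs = "separable_closure F"
  let ?P = "product_topology (\<lambda>_. discrete_topology ?Fs) ?Fs"
  assume "openin (krull_topology F) U"
  then obtain V where V: "openin ?P V" "U = V \<inter> ?G"
    by (auto simp: krull_topology_def openin_subtopology)
  have ?R
  proof
    fix \<sigma> assume "\<sigma> \<in> U"
    with V obtain W where W: "finite {i \<in> ?Fs. W i \<noteq> ?Fs}" "\<sigma> \<in> Pi\<^sub>E ?Fs W" "Pi\<^sub>E ?Fs W \<subseteq> V"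
      by (force simp: openin_product_topology_alt)
    have "{\<tau> \<in> ?G. \<forall>x\<in>{i \<in> ?Fs. W i \<noteq> ?Fs}. \<tau> x = \<sigma> x} \<subseteq> U"
    proof
      fix \<tau> assume \<tau>: "\<tau> \<in> {\<tau> \<in> ?G. \<forall>x\<in>{i \<in> ?Fs. W i \<noteq> ?Fs}. \<tau> x = \<sigma> x}"
      have "\<tau> \<in> ?Fs \<rightarrow>\<^sub>E ?Fs"
        using \<tau> carrier_absolute_galois_group_subset[of F] by blast
      moreover have "\<tau> i \<in> W i" if "i \<in> ?Fs" for i
      proof (cases "W i = ?Fs")
        case True
        then show ?thesis using \<open>\<tau> \<in> ?Fs \<rightarrow>\<^sub>E ?Fs\<close> that by (auto simp: PiE_iff)
      next
        case False
        then show ?thesis using \<tau> W(2) that by (auto simp: PiE_iff)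
      qed
      ultimately have "\<tau> \<in> Pi\<^sub>E ?Fs W"
        by (auto simp: PiE_iff)
      then show "\<tau> \<in> U"
        using W(3) V(2) \<tau> by blast
    qed
    then show "\<exists>S. finite S \<and> S \<subseteq> ?Fs \<and> {\<tau> \<in> ?G. \<forall>x\<in>S. \<tau> x = \<sigma> x} \<subseteq> U"
      using W(1) by (intro exI[of _ "{i \<in> ?Fs. W i \<noteq> ?Fs}"]) auto
  qed
  with V show "U \<subseteq> ?G \<and> ?R" by auto
next
  let ?Fs = "separable_closure F"
  let ?P = "product_topology (\<lambda>_. discrete_topology ?Fs) ?Fs"
  assume asm: "U \<subseteq> ?G \<and> ?R"
  show "openin (krull_topology F) U"
  proof (subst openin_subopen, intro ballI)
    fix \<sigma> assume "\<sigma> \<in> U"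
    with asm obtain S where S: "finite S" "S \<subseteq> ?Fs" "{\<tau> \<in> ?G. \<forall>x\<in>S. \<tau> x = \<sigma> x} \<subseteq> U"
      by blast
    define W where "W = (\<lambda>i. if i \<in> S then {\<sigma> i} else ?Fs)"
    have \<sigma>: "\<sigma> \<in> ?Fs \<rightarrow>\<^sub>E ?Fs" "\<sigma> \<in> ?G"
      using \<open>\<sigma> \<in> U\<close> asm carrier_absolute_galois_group_subset[of F] by auto
    have "openin ?P (Pi\<^sub>E ?Fs W)"
    proof (rule product_topology_basis)
      show "openin (discrete_topology ?Fs) (W i)" for i
        using \<sigma>(1) S(2) by (auto simp: W_def PiE_iff)
      show "finite {i. W i \<noteq> topspace (discrete_topology ?Fs)}"
        by (rule finite_subset[OF _ S(1)]) (auto simp: W_def)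
    qed
    then have "openin (krull_topology F) (Pi\<^sub>E ?Fs W \<inter> ?G)"
      by (auto simp: krull_topology_def openin_subtopology)
    moreover have "\<sigma> \<in> Pi\<^sub>E ?Fs W \<inter> ?G"
      using \<sigma> by (auto simp: W_def PiE_iff)
    moreover have "Pi\<^sub>E ?Fs W \<inter> ?G \<subseteq> U"
    proof
      fix \<tau> assume "\<tau> \<in> Pi\<^sub>E ?Fs W \<inter> ?G"
      moreover from this have "\<tau> x = \<sigma> x" if "x \<in> S" for x
        using that S(2) by (auto simp: W_def PiE_iff split: if_splits)
      ultimately show "\<tau> \<in> U" using S(3) by blast
    qed
    ultimately show "\<exists>V. openin (krull_topology F) V \<and> \<sigma> \<in> V \<and> V \<subseteq> U" by blast
  qed
qed


section \<open>Continuous cochains in low degrees\<close>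

text \<open>
  \<open>G\<close> is a group, \<open>T\<close> its topology (with underlying set \<^term>\<open>carrier G\<close>), and \<open>R\<close> a
  coefficient ring, regarded as a discrete \<open>G\<close>-module with trivial action. Only the part of the
  cochain algebra that enters into triple Massey products of degree 1 classes is needed: degrees 1
  to 3, the differentials between them, and the cup product of two 1-cochains.
  Cochains are \<^term>\<open>undefined\<close> outside their domain.
\<close>

definition cochains1 ::
  "('g, 'm) monoid_scheme \<Rightarrow> 'g topology \<Rightarrow> ('r, 'n) ring_scheme \<Rightarrow> ('g \<Rightarrow> 'r) set" where
  "cochains1 G T R =
     {f \<in> carrier G \<rightarrow>\<^sub>E carrier R. continuous_map T (discrete_topology (carrier R)) f}"

definition cochains2 ::
  "('g, 'm) monoid_scheme \<Rightarrow> 'g topology \<Rightarrow> ('r, 'n) ring_scheme \<Rightarrow> ('g \<times> 'g \<Rightarrow> 'r) set" where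
  "cochains2 G T R =
     {f \<in> carrier G \<times> carrier G \<rightarrow>\<^sub>E carrier R.
        continuous_map (prod_topology T T) (discrete_topology (carrier R)) f}"

definition coboundary1 ::
  "('g, 'm) monoid_scheme \<Rightarrow> ('r, 'n) ring_scheme \<Rightarrow> ('g \<Rightarrow> 'r) \<Rightarrow> ('g \<times> 'g \<Rightarrow> 'r)" where
  "coboundary1 G R f =
     (\<lambda>(\<sigma>, \<tau>)\<in>carrier G \<times> carrier G. (f \<sigma> \<oplus>\<^bsub>R\<^esub> f \<tau>) \<ominus>\<^bsub>R\<^esub> f (\<sigma> \<otimes>\<^bsub>G\<^esub> \<tau>))"

definition coboundary2 ::
  "('g, 'm) monoid_scheme \<Rightarrow> ('r, 'n) ring_scheme \<Rightarrow> ('g \<times> 'g \<Rightarrow> 'r) \<Rightarrow> ('g \<times> 'g \<times> 'g \<Rightarrow> 'r)"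
  where
  "coboundary2 G R f =
     (\<lambda>(\<sigma>, \<tau>, \<rho>)\<in>carrier G \<times> carrier G \<times> carrier G.
        ((f (\<tau>, \<rho>) \<ominus>\<^bsub>R\<^esub> f (\<sigma> \<otimes>\<^bsub>G\<^esub> \<tau>, \<rho>)) \<oplus>\<^bsub>R\<^esub> f (\<sigma>, \<tau> \<otimes>\<^bsub>G\<^esub> \<rho>)) \<ominus>\<^bsub>R\<^esub> f (\<sigma>, \<tau>))"

definition cup ::
  "('g, 'm) monoid_scheme \<Rightarrow> ('r, 'n) ring_scheme \<Rightarrow> ('g \<Rightarrow> 'r) \<Rightarrow> ('g \<Rightarrow> 'r) \<Rightarrow> ('g \<times> 'g \<Rightarrow> 'r)"
  where
  "cup G R f g = (\<lambda>(\<sigma>, \<tau>)\<in>carrier G \<times> carrier G. f \<sigma> \<otimes>\<^bsub>R\<^esub> g \<tau>)"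

definition add_cochain2 ::
  "('g, 'm) monoid_scheme \<Rightarrow> ('r, 'n) ring_scheme \<Rightarrow>
     ('g \<times> 'g \<Rightarrow> 'r) \<Rightarrow> ('g \<times> 'g \<Rightarrow> 'r) \<Rightarrow> ('g \<times> 'g \<Rightarrow> 'r)" where
  "add_cochain2 G R f g = (\<lambda>x\<in>carrier G \<times> carrier G. f x \<oplus>\<^bsub>R\<^esub> g x)"


section \<open>Cohomology\<close>

text \<open>
  With trivial action the differential from degree 0 to degree 1 is zero, so \<open>H\<^sup>1\<close> consists of the
  1-cocycles themselves, which are the continuous homomorphisms.
\<close>

definition H1 ::
  "('g, 'm) monoid_scheme \<Rightarrow> 'g topology \<Rightarrow> ('r, 'n) ring_scheme \<Rightarrow> ('g \<Rightarrow> 'r) set" where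
  "H1 G T R = cochains1 G T R \<inter> hom G (add_monoid R)"

text \<open>The (additive) group of 2-cocycles, as a group in the sense of HOL-Algebra.\<close>

definition cocycles2 ::
  "('g, 'm) monoid_scheme \<Rightarrow> 'g topology \<Rightarrow> ('r, 'n) ring_scheme \<Rightarrow> ('g \<times> 'g \<Rightarrow> 'r) monoid" where
  "cocycles2 G T R =
     \<lparr>carrier = {f \<in> cochains2 G T R.
        coboundary2 G R f = (\<lambda>_\<in>carrier G \<times> carrier G \<times> carrier G. \<zero>\<^bsub>R\<^esub>)},
      monoid.mult = add_cochain2 G R,
      one = (\<lambda>_\<in>carrier G \<times> carrier G. \<zero>\<^bsub>R\<^esub>)\<rparr>"

definition coboundaries2 ::
  "('g, 'm) monoid_scheme \<Rightarrow> 'g topology \<Rightarrow> ('r, 'n) ring_scheme \<Rightarrow> ('g \<times> 'g \<Rightarrow> 'r) set" where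
  "coboundaries2 G T R = coboundary1 G R ` cochains1 G T R"

text \<open>
  Quotient groups in HOL-Algebra are written multiplicatively: the zero class in \<open>H\<^sup>2\<close> is
  \<open>\<one>\<^bsub>H2 G T R\<^esub>\<close>.
\<close>

definition H2 ::
  "('g, 'm) monoid_scheme \<Rightarrow> 'g topology \<Rightarrow> ('r, 'n) ring_scheme \<Rightarrow>
     ('g \<times> 'g \<Rightarrow> 'r) set monoid" where
  "H2 G T R = cocycles2 G T R Mod coboundaries2 G T R"

definition class2 ::
  "('g, 'm) monoid_scheme \<Rightarrow> 'g topology \<Rightarrow> ('r, 'n) ring_scheme \<Rightarrow>
     ('g \<times> 'g \<Rightarrow> 'r) \<Rightarrow> ('g \<times> 'g \<Rightarrow> 'r) set" where
  "class2 G T R c = coboundaries2 G T R #>\<^bsub>cocycles2 G T R\<^esub> c"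


section \<open>Triple Massey products\<close>

definition triple_massey_defined ::
  "('g, 'm) monoid_scheme \<Rightarrow> 'g topology \<Rightarrow> ('r, 'n) ring_scheme \<Rightarrow>
     ('g \<Rightarrow> 'r) \<Rightarrow> ('g \<Rightarrow> 'r) \<Rightarrow> ('g \<Rightarrow> 'r) \<Rightarrow> bool" where
  "triple_massey_defined G T R \<chi>1 \<chi>2 \<chi>3 \<longleftrightarrow>
     class2 G T R (cup G R \<chi>1 \<chi>2) = \<one>\<^bsub>H2 G T R\<^esub> \<and>
     class2 G T R (cup G R \<chi>2 \<chi>3) = \<one>\<^bsub>H2 G T R\<^esub>"

definition defining_system ::
  "('g, 'm) monoid_scheme \<Rightarrow> 'g topology \<Rightarrow> ('r, 'n) ring_scheme \<Rightarrow>
     ('g \<Rightarrow> 'r) \<Rightarrow> ('g \<Rightarrow> 'r) \<Rightarrow> ('g \<Rightarrow> 'r) \<Rightarrow> ('g \<Rightarrow> 'r) \<times> ('g \<Rightarrow> 'r) \<Rightarrow> bool" where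
  "defining_system G T R \<chi>1 \<chi>2 \<chi>3 = (\<lambda>(D12, D23).
     D12 \<in> cochains1 G T R \<and> D23 \<in> cochains1 G T R \<and>
     coboundary1 G R D12 = cup G R \<chi>1 \<chi>2 \<and> coboundary1 G R D23 = cup G R \<chi>2 \<chi>3)"

definition massey_value ::
  "('g, 'm) monoid_scheme \<Rightarrow> 'g topology \<Rightarrow> ('r, 'n) ring_scheme \<Rightarrow>
     ('g \<Rightarrow> 'r) \<Rightarrow> ('g \<Rightarrow> 'r) \<Rightarrow> ('g \<Rightarrow> 'r) \<times> ('g \<Rightarrow> 'r) \<Rightarrow> ('g \<times> 'g \<Rightarrow> 'r) set" where
  "massey_value G T R \<chi>1 \<chi>3 = (\<lambda>(D12, D23).
     class2 G T R (add_cochain2 G R (cup G R \<chi>1 D23) (cup G R D12 \<chi>3)))"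

definition triple_massey ::
  "('g, 'm) monoid_scheme \<Rightarrow> 'g topology \<Rightarrow> ('r, 'n) ring_scheme \<Rightarrow>
     ('g \<Rightarrow> 'r) \<Rightarrow> ('g \<Rightarrow> 'r) \<Rightarrow> ('g \<Rightarrow> 'r) \<Rightarrow> ('g \<times> 'g \<Rightarrow> 'r) set set" where
  "triple_massey G T R \<chi>1 \<chi>2 \<chi>3 =
     {massey_value G T R \<chi>1 \<chi>3 D | D. defining_system G T R \<chi>1 \<chi>2 \<chi>3 D}"

text \<open>\<^term>\<open>residue_ring (int p)\<close> is the field with \<open>p\<close> elements.\<close>

definition vanishing_triple_massey_property ::
  "nat \<Rightarrow> ('g, 'm) monoid_scheme \<Rightarrow> 'g topology \<Rightarrow> bool" where
  "vanishing_triple_massey_property p G T \<longleftrightarrow>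
     (let R = residue_ring (int p) in
      \<forall>\<chi>1 \<in> H1 G T R. \<forall>\<chi>2 \<in> H1 G T R. \<forall>\<chi>3 \<in> H1 G T R.
        triple_massey_defined G T R \<chi>1 \<chi>2 \<chi>3 \<longrightarrow>
        \<one>\<^bsub>H2 G T R\<^esub> \<in> triple_massey G T R \<chi>1 \<chi>2 \<chi>3)"

end

theory Submission
  imports Defs
begin

text \<open>
  The proof works with explicit functions instead of extensions of the base field. Let \<open>L\<close> be the
  separable closure and \<open>G\<close> the Galois group, and let \<open>a\<close>, \<open>b\<close>, \<open>c\<close> be homomorphisms from \<open>G\<close> to the
  integers mod \<open>p\<close> with \<open>a \<union> b = \<partial>D12\<close> and \<open>b \<union> c = \<partial>D23\<close>. Everything rests on Hilbert's Theorem 90, in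
  its multiplicative and additive forms; it follows from Dedekind's independence of characters, by
  summing over the finitely many restrictions of elements of \<open>G\<close> to a finite subset of \<open>L\<close>
  (\<open>hilbert90\<close>, \<open>additive_hilbert90\<close>, \<open>hilbert90_equivariant\<close>).

  In characteristic \<open>p\<close> every defining system has value zero: additive Hilbert 90 first splits \<open>c\<close> and
  then \<open>D23\<close> over \<open>L\<close>, which writes the value as the coboundary of a cochain \<open>u\<close> with values in \<open>L\<close>.
  Now \<open>u\<^sup>p - u\<close> is a cocycle, and solving an Artin-Schreier equation in \<open>L\<close> moves \<open>u\<close> into the prime field
  (\<open>massey_vanishes_char_p\<close>).

  In all other characteristics, suppose \<open>\<psi> \<union> b = \<partial>D\<close>. Then Hilbert 90 provides a function \<open>z\<close> on pairs of
  a primitive \<open>p\<close>-th root of unity \<open>\<xi>\<close> and a residue \<open>i\<close> such that \<open>\<sigma>\<close> maps \<open>z(\<xi>, i)\<close> to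
  \<open>z(\<sigma>\<xi>, i + \<psi>(\<sigma>))\<close>, up to the power of \<open>\<sigma>\<xi>\<close> with exponent \<open>-((i + \<psi>(\<sigma>))b(\<sigma>) + D(\<sigma>))\<close>
  (\<open>cup_splitting_exists\<close>). The lemma applies to \<open>a\<close>, to \<open>c\<close>, and also to \<open>a - c\<close>; call the resulting
  functions \<open>z\<^sub>a\<close>, \<open>z\<^sub>c\<close> and \<open>z\<^sub>m\<close>, and let \<open>B(\<xi>)\<close> be a Kummer generator for \<open>b\<close>. The functions
  \<open>\<alpha>(i) = B z\<^sub>a(i + 1) / z\<^sub>a(i)\<close>, \<open>\<gamma>(j) = B z\<^sub>c(j + 1) / z\<^sub>c(j)\<close> and \<open>e(i, j) = z\<^sub>c(j) z\<^sub>m(i - j) / z\<^sub>a(i)\<close>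
  are then equivariant for the translations by \<open>a(\<sigma>)\<close> and \<open>c(\<sigma>)\<close>. The first two have the same norm
  \<open>B\<^sup>p\<close> (this is the norm criterion for the triviality of a cyclic algebra), and
  \<open>\<alpha>(i) / \<gamma>(j) = e(i, j) / e(i + 1, j + 1)\<close> is Hilbert 90 for their quotient, made explicit.

  The Kummer cocycles of \<open>\<alpha>\<close>, \<open>\<gamma>\<close>, \<open>e\<close> are functions \<open>f(i)\<close>, \<open>h(j)\<close>, \<open>k(i, j)\<close> mod \<open>p\<close>, which depend on
  \<open>\<sigma>\<close> and satisfy \<open>k(i, j) - k(i + 1, j + 1) = f(i) - h(j)\<close>, while \<open>f\<close> and \<open>h\<close> both sum to \<open>b\<close>. From
  here on only finite sums mod \<open>p\<close> occur. With \<open>r = \<Sum>\<^sub>j k(0, j)\<close> and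
  \<open>s = r + \<Sum>\<^sub>i i f(i) + \<Sum>\<^sub>j j h(j)\<close>, the pair \<open>r\<close>, \<open>s - b c\<close> is a defining system, and its value is the
  coboundary of \<open>\<Sum>\<^sub>j j k(0, j) - \<Sum>\<^sub>i (i(i - 1)/2) f(i) - r c\<close>, where the second sum is left out if
  \<open>p = 2\<close> (\<open>massey_primitive_translate\<close>, \<open>massey_vanishes_kummer\<close>).

  Two features make the argument uniform. Functions of a residue \<open>i\<close> stand for elements of
  the algebra obtained by adjoining a \<open>p\<close>-th root, whether or not this algebra is a field; this covers
  linearly dependent \<open>a\<close> and \<open>c\<close>. And all primitive roots of unity \<open>\<xi>\<close> are used at once, which covers
  base fields without them: adding up discrete logarithms over the \<open>p - 1\<close> choices of \<open>\<xi>\<close> replaces a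
  corestriction from the field with \<open>\<xi>\<close> adjoined.
\<close>

section \<open>Separable elements\<close>

definition ac_eval :: "'a::field Polynomial.poly \<Rightarrow> 'a alg_closure \<Rightarrow> 'a alg_closure" where
  "ac_eval f x = Polynomial.poly (map_poly to_ac f) x"

lemma ac_eval_0 [simp]: "ac_eval 0 x = 0"
  by (simp add: ac_eval_def)

lemma ac_eval_pCons [simp]: "ac_eval (pCons a f) x = to_ac a + x * ac_eval f x"
  by (simp add: ac_eval_def map_poly_pCons)

lemma ac_eval_1 [simp]: "ac_eval 1 x = 1"
  by (simp add: one_pCons)

lemma ac_eval_add [simp]: "ac_eval (f + g) x = ac_eval f x + ac_eval g x"
  by (induction f g rule: poly_induct2) (simp_all add: algebra_simps)

lemma ac_eval_minus [simp]: "ac_eval (- f) x = - ac_eval f x"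
  by (induction f) (simp_all add: algebra_simps)

lemma ac_eval_diff [simp]: "ac_eval (f - g) x = ac_eval f x - ac_eval g x"
  using ac_eval_add[of f "- g" x] by simp

lemma ac_eval_smult [simp]: "ac_eval (Polynomial.smult a f) x = to_ac a * ac_eval f x"
  by (induction f) (simp_all add: algebra_simps)

lemma ac_eval_mult [simp]: "ac_eval (f * g) x = ac_eval f x * ac_eval g x"
  by (induction f) (simp_all add: algebra_simps)

lemma ac_eval_power [simp]: "ac_eval (f ^ n) x = ac_eval f x ^ n"
  by (induction n) simp_all

lemma ac_eval_of_nat [simp]: "ac_eval (of_nat n) x = of_nat n"
  by (induction n) simp_all

lemma ac_eval_pcompose: "ac_eval (pcompose f g) x = ac_eval f (ac_eval g x)"
  by (induction f) (simp_all add: pcompose_pCons)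

lemma ac_eval_monom: "ac_eval (Polynomial.monom a n) x = to_ac a * x ^ n"
  by (induction n) (simp_all add: monom_0 monom_Suc)

lemma pderiv_map_poly_to_ac: "pderiv (map_poly to_ac f) = map_poly to_ac (pderiv f)"
  by (rule poly_eqI) (simp add: coeff_map_poly coeff_pderiv)

lemma map_poly_to_ac_eq_0 [simp]: "map_poly to_ac f = 0 \<longleftrightarrow> f = 0"
  by (simp add: map_poly_eq_0_iff)

lemma minimal_poly_exists:
  fixes x :: "'a::field alg_closure"
  obtains m :: "'a Polynomial.poly" where "m \<noteq> 0" "ac_eval m x = 0"
    "\<And>f. ac_eval f x = 0 \<longleftrightarrow> m dvd f"
proof -
  define Q :: "'a Polynomial.poly \<Rightarrow> bool" where "Q = (\<lambda>m. m \<noteq> 0 \<and> ac_eval m x = 0)"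
  obtain f where "Q f"
    using alg_closure_algebraic[of x] unfolding Q_def ac_eval_def by metis
  define m where "m = arg_min Polynomial.degree Q"
  have m: "Q m" unfolding m_def by (rule arg_min_natI) fact
  have min: "Polynomial.degree m \<le> Polynomial.degree f" if "Q f" for f
    unfolding m_def by (rule arg_min_nat_le) fact
  have "ac_eval f x = 0 \<longleftrightarrow> m dvd f" for f
  proof
    assume "m dvd f"
    then show "ac_eval f x = 0" using m by (auto simp: Q_def elim!: dvdE)
  next
    assume f: "ac_eval f x = 0"
    have "ac_eval (f div m * m + f mod m) x = 0" using f by simp
    then have "ac_eval (f mod m) x = 0"
      using m unfolding ac_eval_add ac_eval_mult by (simp add: Q_def)
    then have "f mod m = 0"
      using min[of "f mod m"] m degree_mod_less'[of m f] by (force simp: Q_def)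
    then show "m dvd f" by auto
  qed
  with m that show ?thesis by (auto simp: Q_def)
qed

lemma irreducible_minimal_poly:
  fixes x :: "'a::field alg_closure"
  assumes "m \<noteq> 0" "\<And>f. ac_eval f x = 0 \<longleftrightarrow> m dvd f"
  shows "Factorial_Ring.irreducible (m :: 'a Polynomial.poly)"
proof (rule Factorial_Ring.irreducibleI)
  show "m \<noteq> 0" by fact
  show "\<not> m dvd 1" using assms(2)[of 1] by simp
  fix a b assume "m = a * b"
  then have "ac_eval a x * ac_eval b x = 0" 
    using assms(2)[of m] by simp
  then have "m dvd a \<or> m dvd b" using assms(2) by simp
  then show "a dvd 1 \<or> b dvd 1"
  proof
    assume "m dvd a"
    then have "is_unit b"
      using \<open>m = a * b\<close> assms(1) by (metis dvd_mult_cancel_left dvd_mult_unit_iff mult.right_neutral mult_eq_0_iff)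
    then show ?thesis ..
  next
    assume "m dvd b"
    then have "is_unit a"
      using \<open>m = a * b\<close> assms(1) by (metis dvd_mult_cancel_left mult.commute mult.right_neutral mult_eq_0_iff)
    then show ?thesis ..
  qed
qed

text \<open>
  This criterion is independent of the characteristic: the order of a root exceeds one exactly if
  the cofactor of a linear factor vanishes there, and this cofactor is the value of the
  derivative.
\<close>

lemma rsquarefree_iff_simple_roots:
  fixes p :: "'a::field Polynomial.poly"
  assumes "p \<noteq> 0"
  shows "rsquarefree p \<longleftrightarrow> (\<forall>a. \<not> (Polynomial.poly p a = 0 \<and> Polynomial.poly (pderiv p) a = 0))"
proof -
  have "Polynomial.order a p \<le> 1 \<longleftrightarrow> \<not> (Polynomial.poly p a = 0 \<and> Polynomial.poly (pderiv p) a = 0)" for a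
  proof (cases "Polynomial.poly p a = 0")
    case False
    then show ?thesis by (simp add: order_0I)
  next
    case True
    then obtain q where q: "p = [:-a, 1:] * q" 
      by (auto simp: poly_eq_0_iff_dvd)
    have d: "Polynomial.poly (pderiv p) a = Polynomial.poly q a"
      unfolding q pderiv_mult by (simp add: pderiv_pCons)
    have "Polynomial.order a p \<ge> 2 \<longleftrightarrow> [:-a, 1:] ^ 2 dvd p"
      using assms by (simp add: order_divides)
    also have "\<dots> \<longleftrightarrow> [:-a, 1:] dvd q"
      unfolding q power2_eq_square by (subst dvd_times_left_cancel_iff) auto
    also have "\<dots> \<longleftrightarrow> Polynomial.poly q a = 0" by (simp add: poly_eq_0_iff_dvd)
    finally show ?thesis using d True by auto
  qed
  moreover have "Polynomial.order a p \<le> 1 \<longleftrightarrow> Polynomial.order a p = 0 \<or> Polynomial.order a p = 1" for a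
    by auto
  ultimately show ?thesis using assms by (simp add: rsquarefree_def)
qed

text \<open>
  It suffices to exhibit any polynomial with a simple root at \<open>x\<close>, which makes separability easy
  to check: such a polynomial is a multiple of the minimal polynomial, whose derivative is then
  nonzero and hence coprime to it.
\<close>

lemma separable_element_iff:
  "separable_element x \<longleftrightarrow> (\<exists>h. ac_eval h x = 0 \<and> ac_eval (pderiv h) x \<noteq> 0)"
proof
  assume "separable_element x"
  then obtain f where f: "Factorial_Ring.irreducible f" "ac_eval f x = 0" "rsquarefree (map_poly to_ac f)"
    by (auto simp: separable_element_def ac_eval_def)
  from f have "ac_eval (pderiv f) x \<noteq> 0"
    using rsquarefree_iff_simple_roots[of "map_poly to_ac f"]
    by (auto simp: ac_eval_def pderiv_map_poly_to_ac Factorial_Ring.irreducible_def)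
  with f show "\<exists>h. ac_eval h x = 0 \<and> ac_eval (pderiv h) x \<noteq> 0" by blast
next
  assume "\<exists>h. ac_eval h x = 0 \<and> ac_eval (pderiv h) x \<noteq> 0"
  then obtain h where h: "ac_eval h x = 0" "ac_eval (pderiv h) x \<noteq> 0" by blast
  obtain g where g: "g \<noteq> 0" "ac_eval g x = 0" "\<And>f. ac_eval f x = 0 \<longleftrightarrow> g dvd f"
    using minimal_poly_exists[of x] by metis
  have irr: "Factorial_Ring.irreducible g"
    using irreducible_minimal_poly g by metis
  obtain k where k: "h = g * k" using g h by (auto elim: dvdE)
  have g': "ac_eval (pderiv g) x \<noteq> 0"
    using h(2) g(2) by (auto simp: k pderiv_mult)
  have "\<not> (ac_eval g a = 0 \<and> ac_eval (pderiv g) a = 0)" for a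
  proof
    assume a: "ac_eval g a = 0 \<and> ac_eval (pderiv g) a = 0"
    obtain m where m: "m \<noteq> 0" "ac_eval m a = 0" "\<And>f. ac_eval f a = 0 \<longleftrightarrow> m dvd f"
      using minimal_poly_exists[of a] by metis
    have "m dvd g" using m(3) a by blast
    moreover have "\<not> is_unit m" using m(3)[of 1] by simp
    ultimately have "g dvd m" using irr by (metis irreducibleD')
    then have "g dvd pderiv g" using m(3) a dvd_trans by blast
    then show False using g g' by blast
  qed
  then have "rsquarefree (map_poly to_ac g)"
    using g(1) by (subst rsquarefree_iff_simple_roots) (auto simp: ac_eval_def pderiv_map_poly_to_ac)
  with irr g show "separable_element x" by (auto simp: separable_element_def ac_eval_def)
qed

text \<open>
  Polynomials in two variables, as polynomials in \<open>X\<close> whose coefficients are polynomials in \<open>W\<close>. The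
  constant \<open>ac_deriv2\<close> below is the value of the partial derivative with respect to \<open>W\<close>.
\<close>

definition ac_eval2 :: "'a::field Polynomial.poly Polynomial.poly \<Rightarrow> 'a alg_closure \<Rightarrow> 'a alg_closure \<Rightarrow> 'a alg_closure" where
  "ac_eval2 P w x = Polynomial.poly (map_poly (\<lambda>c. ac_eval c w) P) x"

definition ac_deriv2 :: "'a::field Polynomial.poly Polynomial.poly \<Rightarrow> 'a alg_closure \<Rightarrow> 'a alg_closure \<Rightarrow> 'a alg_closure" where
  "ac_deriv2 P w x = Polynomial.poly (map_poly (\<lambda>c. ac_eval (pderiv c) w) P) x"

lemma ac_eval2_simps [simp]:
  "ac_eval2 0 w x = 0" "ac_eval2 (pCons c P) w x = ac_eval c w + x * ac_eval2 P w x"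
  by (simp_all add: ac_eval2_def map_poly_pCons)

lemma ac_deriv2_simps [simp]:
  "ac_deriv2 0 w x = 0" "ac_deriv2 (pCons c P) w x = ac_eval (pderiv c) w + x * ac_deriv2 P w x"
  by (simp_all add: ac_deriv2_def map_poly_pCons)

lemma ac_eval2_1 [simp]: "ac_eval2 1 w x = 1" by (simp add: one_pCons)

lemma ac_eval2_add [simp]: "ac_eval2 (P + Q) w x = ac_eval2 P w x + ac_eval2 Q w x"
  by (induction P Q rule: poly_induct2) (simp_all add: algebra_simps)

lemma ac_deriv2_add [simp]: "ac_deriv2 (P + Q) w x = ac_deriv2 P w x + ac_deriv2 Q w x"
  by (induction P Q rule: poly_induct2) (simp_all add: algebra_simps pderiv_add)

lemma ac_eval2_smult [simp]: "ac_eval2 (Polynomial.smult c P) w x = ac_eval c w * ac_eval2 P w x"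
  by (induction P) (simp_all add: algebra_simps)

lemma ac_deriv2_smult [simp]:
  "ac_deriv2 (Polynomial.smult c P) w x = ac_eval (pderiv c) w * ac_eval2 P w x + ac_eval c w * ac_deriv2 P w x"
  by (induction P) (simp_all add: algebra_simps pderiv_mult)

lemma ac_eval2_mult [simp]: "ac_eval2 (P * Q) w x = ac_eval2 P w x * ac_eval2 Q w x"
  by (induction P) (simp_all add: algebra_simps)

lemma ac_deriv2_mult [simp]:
  "ac_deriv2 (P * Q) w x = ac_deriv2 P w x * ac_eval2 Q w x + ac_eval2 P w x * ac_deriv2 Q w x"
  by (induction P) (simp_all add: algebra_simps)

definition subst2 :: "'a::field Polynomial.poly \<Rightarrow> 'a Polynomial.poly Polynomial.poly \<Rightarrow> 'a Polynomial.poly Polynomial.poly" where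
  "subst2 g Q = Polynomial.poly (map_poly (\<lambda>a. [:[:a:]:]) g) Q"

lemma subst2_simps [simp]: "subst2 0 Q = 0" "subst2 (pCons a g) Q = [:[:a:]:] + Q * subst2 g Q"
  by (simp_all add: subst2_def map_poly_pCons)

lemma subst2_add [simp]: "subst2 (f + g) Q = subst2 f Q + subst2 g Q"
  by (induction f g rule: poly_induct2) (simp_all add: algebra_simps)

lemma ac_eval2_subst2 [simp]: "ac_eval2 (subst2 g Q) w x = ac_eval g (ac_eval2 Q w x)"
  by (induction g) simp_all

lemma ac_deriv2_subst2 [simp]:
  "ac_deriv2 (subst2 g Q) w x = ac_eval (pderiv g) (ac_eval2 Q w x) * ac_deriv2 Q w x"
  by (induction g) (simp_all add: algebra_simps pderiv_pCons)

text \<open>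
  This is the reason why separable elements form a field. If \<open>w\<close> is not separable, then any
  polynomial in \<open>W\<close> that vanishes at \<open>w\<close> has a derivative that vanishes there as well, so that
  differentiation in \<open>W\<close> is a well-defined derivation on the field generated by \<open>w\<close>. It
  extends to the field generated by \<open>w\<close> and the separable element \<open>x\<close>, and there it kills \<open>x\<close>. A relation
  \<open>P(w, x) = 0\<close> can therefore be differentiated with respect to \<open>W\<close>. For instance, if \<open>w = x + y\<close> with \<open>y\<close> a
  simple root of \<open>g\<close>, the relation \<open>g(W - X)\<close> gives a contradiction.

  Instead of constructing the derivation, the proof divides by a relation \<open>m\<close> of minimal degree in
  \<open>X\<close>. The remainders have coefficients vanishing at \<open>w\<close>, so they do not contribute, and the
  polynomial \<open>h\<close> for \<open>x\<close>, which does not involve \<open>W\<close>, shows that the derivative of \<open>m\<close> vanishes.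
\<close>

lemma ac_deriv2_vanishes:
  fixes w x :: "'a::field alg_closure"
  assumes x: "separable_element x" and w: "\<not> separable_element w"
    and P: "ac_eval2 P w x = 0"
  shows "ac_deriv2 P w x = 0"
proof -
  have w: "ac_eval (pderiv c) w = 0" if "ac_eval c w = 0" for c
    using w that by (auto simp: separable_element_iff)
  obtain h where h: "ac_eval h x = 0" "ac_eval (pderiv h) x \<noteq> 0"
    using x by (auto simp: separable_element_iff)
  define E where "E = (\<lambda>P :: 'a Polynomial.poly Polynomial.poly. map_poly (\<lambda>c. ac_eval c w) P)"
  have coeff_E: "Polynomial.coeff (E P) n = ac_eval (Polynomial.coeff P n) w" for P n
    by (simp add: E_def coeff_map_poly)
  define Q where "Q = (\<lambda>m. E m \<noteq> 0 \<and> ac_eval2 m w x = 0)"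
  \<comment> \<open>The polynomial of \<open>x\<close>, viewed as a relation that does not involve \<open>W\<close>.\<close>
  define h_lift where "h_lift = subst2 h [:0, 1:]"
  have h_lift: "ac_eval2 h_lift w x = 0" "ac_deriv2 h_lift w x = 0"
    using h(1) by (simp_all add: h_lift_def pderiv_1)
  have pd_E: "E (pderiv P) = pderiv (E P)" for P
    by (rule poly_eqI) (simp add: coeff_E coeff_pderiv flip: of_nat_Suc)
  have h_lift': "ac_eval2 (pderiv h_lift) w x = ac_eval (pderiv h) x"
  proof -
    have "pderiv h_lift = subst2 (pderiv h) [:0, 1:]"
      unfolding h_lift_def
      by (induction h) (simp_all add: pderiv_pCons pderiv_add pderiv_mult algebra_simps)
    then show ?thesis by simp
  qed
  have "Q h_lift"
    using h_lift h_lift' h(2) pd_E[of h_lift] by (auto simp: Q_def ac_eval2_def E_def)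
  define m where "m = arg_min Polynomial.degree Q"
  have m: "Q m" unfolding m_def by (rule arg_min_natI) fact
  have min: "Polynomial.degree m \<le> Polynomial.degree f" if "Q f" for f
    unfolding m_def by (rule arg_min_nat_le) fact
  have "m \<noteq> 0" using m by (auto simp: Q_def E_def)
  \<comment> \<open>Otherwise dropping the leading term gives a relation of smaller degree.\<close>
  have lc: "ac_eval (Polynomial.lead_coeff m) w \<noteq> 0"
  proof
    assume 0: "ac_eval (Polynomial.lead_coeff m) w = 0"
    define m' where "m' = m - Polynomial.monom (Polynomial.lead_coeff m) (Polynomial.degree m)"
    have "E m' = E m"
      using 0 by (intro poly_eqI) (auto simp: coeff_E m'_def)
    then have "Q m'" using m by (auto simp: Q_def ac_eval2_def E_def)
    moreover have "Polynomial.degree m' < Polynomial.degree m"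
    proof -
      have "E m' \<noteq> 0" using \<open>Q m'\<close> by (simp add: Q_def)
      then have "m' \<noteq> 0" by (auto simp: E_def)
      moreover have "Polynomial.coeff m' (Polynomial.degree m) = 0" by (simp add: m'_def)
      moreover have "Polynomial.degree m' \<le> Polynomial.degree m"
        unfolding m'_def by (intro degree_diff_le) (simp_all add: degree_monom_le)
      ultimately show ?thesis
        by (metis leading_coeff_0_iff le_neq_implies_less)
    qed
    ultimately show False using min by fastforce
  qed
  have division: "\<exists>c q r. ac_eval c w \<noteq> 0 \<and> Polynomial.smult c P = m * q + r \<and> E r = 0"
    if "ac_eval2 P w x = 0" for P
  proof -
    obtain q r where qr: "pseudo_divmod P m = (q, r)" by (cases "pseudo_divmod P m")
    define c where "c = Polynomial.lead_coeff m ^ (Suc (Polynomial.degree P) - Polynomial.degree m)"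
    have eq: "Polynomial.smult c P = m * q + r"
      using pseudo_divmod(1)[OF \<open>m \<noteq> 0\<close> qr] by (simp add: c_def)
    have "ac_eval2 (m * q + r) w x = 0"
      using that by (simp flip: eq)
    then have "ac_eval2 r w x = 0" using m by (simp add: Q_def)
    moreover have "r = 0 \<or> Polynomial.degree r < Polynomial.degree m"
      using pseudo_divmod(2)[OF \<open>m \<noteq> 0\<close> qr] .
    ultimately have "E r = 0"
      using min[of r] by (force simp: Q_def E_def)
    moreover have "ac_eval c w \<noteq> 0" using lc by (simp add: c_def)
    ultimately show ?thesis using eq by blast
  qed
  have rem: "ac_deriv2 r w x = 0" "ac_eval2 r w x = 0" "ac_eval2 (pderiv r) w x = 0" if "E r = 0" for r
  proof -
    have "map_poly (\<lambda>c. ac_eval (pderiv c) w) r = 0"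
      using that w by (auto simp: poly_eq_iff coeff_E coeff_map_poly)
    then show "ac_deriv2 r w x = 0" by (simp add: ac_deriv2_def)
    show "ac_eval2 r w x = 0" "ac_eval2 (pderiv r) w x = 0"
      using that pd_E[of r] by (simp_all add: ac_eval2_def E_def)
  qed
  have dm: "ac_deriv2 m w x = 0"
  proof -
    obtain c q r where c: "ac_eval c w \<noteq> 0" "Polynomial.smult c h_lift = m * q + r" "E r = 0"
      using division[OF h_lift(1)] by blast
    have "ac_deriv2 (Polynomial.smult c h_lift) w x = 0" using h_lift by simp
    then have *: "ac_deriv2 m w x * ac_eval2 q w x = 0"
      using m rem[OF c(3)] unfolding c(2) by (simp add: Q_def)
    have "ac_eval2 (pderiv (Polynomial.smult c h_lift)) w x \<noteq> 0"
      using c(1) h_lift' h(2) by (simp add: pderiv_smult)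
    then have "ac_eval2 q w x \<noteq> 0"
      using m rem[OF c(3)] unfolding c(2) by (auto simp add: Q_def pderiv_mult pderiv_add)
    with * show ?thesis by simp
  qed
  obtain c q r where c: "ac_eval c w \<noteq> 0" "Polynomial.smult c P = m * q + r" "E r = 0"
    using division[OF P] by blast
  have "ac_deriv2 (Polynomial.smult c P) w x = 0"
    using m rem[OF c(3)] dm unfolding c(2) by (simp add: Q_def)
  with P c(1) show ?thesis by simp
qed

lemma separable_to_ac: "separable_element (to_ac a)"
  unfolding separable_element_iff by (intro exI[of _ "[:-a, 1:]"]) (simp add: pderiv_pCons)

lemma separable_inverse:
  assumes "separable_element x"
  shows "separable_element (inverse x)"
proof (cases "x = 0")
  case True
  then show ?thesis using assms by simp
next
  case False
  show ?thesis
  proof (rule ccontr)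
    assume "\<not> ?thesis"
    \<comment> \<open>The relation \<open>W X - 1\<close>.\<close>
    then have "ac_deriv2 [:-1, [:0, 1:]:] (inverse x) x = 0"
      using assms False by (intro ac_deriv2_vanishes) auto
    with False show False by (simp add: pderiv_minus pderiv_pCons)
  qed
qed

lemma separable_add:
  assumes "separable_element x" "separable_element y"
  shows "separable_element (x + y)"
proof (rule ccontr)
  assume *: "\<not> ?thesis"
  obtain g where g: "ac_eval g y = 0" "ac_eval (pderiv g) y \<noteq> 0"
    using assms(2) by (auto simp: separable_element_iff)
  \<comment> \<open>The relation \<open>g(W - X)\<close>.\<close>
  have "ac_deriv2 (subst2 g [:[:0, 1:], -1:]) (x + y) x = 0"
    using assms(1) * g by (intro ac_deriv2_vanishes) auto
  with g show False by (simp add: pderiv_pCons pderiv_minus)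
qed

lemma separable_mult:
  assumes "separable_element x" "separable_element y"
  shows "separable_element (x * y)"
proof (cases "x = 0")
  case True
  then show ?thesis using assms by simp
next
  case False
  show ?thesis
  proof (rule ccontr)
    assume *: "\<not> ?thesis"
    obtain g where g: "ac_eval g y = 0" "ac_eval (pderiv g) y \<noteq> 0"
      using assms(2) by (auto simp: separable_element_iff)
    \<comment> \<open>The relation \<open>g(W X)\<close> between \<open>x y\<close> and the inverse of \<open>x\<close>.\<close>
    have "ac_deriv2 (subst2 g [:0, [:0, 1:]:]) (x * y) (inverse x) = 0"
      using * g False separable_inverse[OF assms(1)] 
      by (intro ac_deriv2_vanishes) (auto simp: field_simps)
    with g False show False by (simp add: pderiv_pCons field_simps)
  qed
qed

lemma separable_minus:
  assumes "separable_element x"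
  shows "separable_element (- x)"
  using separable_mult[OF separable_to_ac[of "-1"] assms] by simp

lemma separable_nth_root:
  fixes x :: "'a::field alg_closure"
  assumes "separable_element (x ^ n)" "x \<noteq> 0" "of_nat n \<noteq> (0 :: 'a)"
  shows "separable_element x"
proof -
  obtain h where h: "ac_eval h (x ^ n) = 0" "ac_eval (pderiv h) (x ^ n) \<noteq> 0"
    using assms(1) by (auto simp: separable_element_iff)
  have "of_nat n \<noteq> (0 :: 'a alg_closure)"
    using assms(3) by (metis to_ac_of_nat to_ac_eq_0_iff)
  then show ?thesis
    unfolding separable_element_iff using h assms(2)
    by (intro exI[of _ "pcompose h (Polynomial.monom 1 n)"])
       (simp add: ac_eval_pcompose ac_eval_monom pderiv_pcompose pderiv_monom)
qed

lemma separable_artin_schreier_root: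
  fixes x :: "'a::field alg_closure"
  assumes "separable_element (x ^ n - x)" "of_nat n = (0 :: 'a)"
  shows "separable_element x"
proof -
  obtain h where h: "ac_eval h (x ^ n - x) = 0" "ac_eval (pderiv h) (x ^ n - x) \<noteq> 0"
    using assms(1) by (auto simp: separable_element_iff)
  then show ?thesis
    unfolding separable_element_iff using h assms(2)
    by (intro exI[of _ "pcompose h (Polynomial.monom 1 n - [:0, 1:])"])
       (simp add: ac_eval_pcompose ac_eval_monom pderiv_pcompose pderiv_monom pderiv_diff pderiv_pCons)
qed

section \<open>Hilbert 90 for groups of field automorphisms\<close>

text \<open>
  The set \<open>M\<close> on which the characters live is a parameter, because only a submonoid
  of the field will have well-behaved images.
\<close>

lemma dedekind_independence:
  fixes \<phi> :: "'i \<Rightarrow> 'm \<Rightarrow> 'k::field" and mult :: "'m \<Rightarrow> 'm \<Rightarrow> 'm"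
  assumes "finite R"
    and mult: "\<And>m n. m \<in> M \<Longrightarrow> n \<in> M \<Longrightarrow> mult m n \<in> M"
    and hom: "\<And>r m n. r \<in> R \<Longrightarrow> m \<in> M \<Longrightarrow> n \<in> M \<Longrightarrow> \<phi> r (mult m n) = \<phi> r m * \<phi> r n"
    and e: "e \<in> M" and one: "\<And>r. r \<in> R \<Longrightarrow> \<phi> r e \<noteq> 0"
    and distinct: "\<And>r s. r \<in> R \<Longrightarrow> s \<in> R \<Longrightarrow> r \<noteq> s \<Longrightarrow> \<exists>m\<in>M. \<phi> r m \<noteq> \<phi> s m"
    and zero: "\<And>m. m \<in> M \<Longrightarrow> (\<Sum>r\<in>R. c r * \<phi> r m) = 0"
    and "r \<in> R"
  shows "c r = 0"
  using \<open>finite R\<close> hom one distinct zero \<open>r \<in> R\<close>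
proof (induction R arbitrary: c r rule: finite_induct)
  case empty
  then show ?case by simp
next
  case (insert s R)
  have R: "c r = 0" if r: "r \<in> R" for r
  proof -
    have "r \<noteq> s" using r insert.hyps by blast
    then obtain n where n: "n \<in> M" "\<phi> r n \<noteq> \<phi> s n"
      using insert.prems(3)[of r s] r by blast
    \<comment> \<open>Subtract \<open>\<phi> s n\<close> times the relation from its translate by \<open>n\<close>; this eliminates \<open>s\<close>.\<close>
    have "c r * (\<phi> r n - \<phi> s n) = 0"
    proof (rule insert.IH[where c = "\<lambda>r. c r * (\<phi> r n - \<phi> s n)" and r = r])
      fix m assume m: "m \<in> M"
      have "0 = (\<Sum>r\<in>insert s R. c r * \<phi> r (mult n m)) - \<phi> s n * (\<Sum>r\<in>insert s R. c r * \<phi> r m)"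
        using insert.prems(4) m mult[OF n(1) m] by simp
      also have "\<dots> = (\<Sum>r\<in>R. c r * \<phi> r (mult n m)) - \<phi> s n * (\<Sum>r\<in>R. c r * \<phi> r m)"
        using insert.hyps insert.prems(1)[of s n m] n m by (simp add: algebra_simps)
      also have "\<dots> = (\<Sum>r\<in>R. c r * (\<phi> r n - \<phi> s n) * \<phi> r m)"
        using insert.prems(1) n m
        by (simp add: sum_distrib_left sum_subtractf[symmetric] algebra_simps cong: sum.cong)
      finally show "(\<Sum>r\<in>R. c r * (\<phi> r n - \<phi> s n) * \<phi> r m) = 0" ..
    qed (use insert.prems r in auto)
    with n show ?thesis by simp
  qed
  have "c s * \<phi> s e = 0"
    using insert.prems(4)[OF e] R insert.hyps by simp
  then have "c s = 0" using insert.prems(2) by simp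
  with R insert.prems(5) show ?case by blast
qed

text \<open>
  A group \<open>G\<close> of automorphisms of a field \<open>L\<close> with finite orbits. The field is a subset of a type so
  that \<open>L\<close> may be the separable closure, and \<open>G\<close> need not be closed in any topology, so
  that the results also apply to stabilizers.
\<close>

locale galois_action =
  fixes L :: "'k::field set" and G :: "('k \<Rightarrow> 'k) set"
  assumes L_1: "1 \<in> L" and L_add: "x \<in> L \<Longrightarrow> y \<in> L \<Longrightarrow> x + y \<in> L"
    and L_minus: "x \<in> L \<Longrightarrow> - x \<in> L"
    and L_mult: "x \<in> L \<Longrightarrow> y \<in> L \<Longrightarrow> x * y \<in> L"
    and L_inverse: "x \<in> L \<Longrightarrow> inverse x \<in> L"
    and G_in: "\<sigma> \<in> G \<Longrightarrow> x \<in> L \<Longrightarrow> \<sigma> x \<in> L"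
    and G_add: "\<sigma> \<in> G \<Longrightarrow> x \<in> L \<Longrightarrow> y \<in> L \<Longrightarrow> \<sigma> (x + y) = \<sigma> x + \<sigma> y"
    and G_mult: "\<sigma> \<in> G \<Longrightarrow> x \<in> L \<Longrightarrow> y \<in> L \<Longrightarrow> \<sigma> (x * y) = \<sigma> x * \<sigma> y"
    and G_1: "\<sigma> \<in> G \<Longrightarrow> \<sigma> 1 = 1"
    and G_comp: "\<sigma> \<in> G \<Longrightarrow> \<tau> \<in> G \<Longrightarrow> compose L \<sigma> \<tau> \<in> G"
    and G_id: "(\<lambda>x\<in>L. x) \<in> G"
    and G_inv: "\<sigma> \<in> G \<Longrightarrow> \<exists>\<tau>\<in>G. (\<forall>x\<in>L. \<sigma> (\<tau> x) = x) \<and> (\<forall>x\<in>L. \<tau> (\<sigma> x) = x)"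
    and G_ext: "\<sigma> \<in> G \<Longrightarrow> \<sigma> \<in> extensional L"
    and finite_orbit: "x \<in> L \<Longrightarrow> finite ((\<lambda>\<sigma>. \<sigma> x) ` G)"
begin

lemma L_0: "0 \<in> L"
  using L_add[OF L_1 L_minus[OF L_1]] by simp

lemma L_diff: "x \<in> L \<Longrightarrow> y \<in> L \<Longrightarrow> x - y \<in> L"
  using L_add[OF _ L_minus, of x y] by simp

lemma L_divide: "x \<in> L \<Longrightarrow> y \<in> L \<Longrightarrow> x / y \<in> L"
  by (simp add: divide_inverse L_mult L_inverse)

lemma L_power: "x \<in> L \<Longrightarrow> x ^ n \<in> L"
  by (induction n) (simp_all add: L_1 L_mult)

lemma L_power_int: "x \<in> L \<Longrightarrow> x powi n \<in> L"
  by (cases "n \<ge> 0") (simp_all add: power_int_def L_power L_inverse)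

lemma L_of_nat: "of_nat n \<in> L"
  by (induction n) (simp_all add: L_0 L_1 L_add)

lemma L_of_int: "of_int n \<in> L"
  by (cases n rule: int_cases2) (simp_all add: L_of_nat L_minus)

lemma L_sum: "(\<And>i. i \<in> A \<Longrightarrow> f i \<in> L) \<Longrightarrow> sum f A \<in> L"
  by (induction A rule: infinite_finite_induct) (simp_all add: L_0 L_add)

lemma L_prod: "(\<And>i. i \<in> A \<Longrightarrow> f i \<in> L) \<Longrightarrow> prod f A \<in> L"
  by (induction A rule: infinite_finite_induct) (simp_all add: L_1 L_mult)

lemmas L_closed = L_0 L_1 L_add L_minus L_mult L_inverse L_diff L_divide L_power L_power_int
  L_of_nat L_of_int L_sum L_prod G_in

lemma G_0: "\<sigma> \<in> G \<Longrightarrow> \<sigma> 0 = 0"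
  using G_add[OF _ L_0 L_0, of \<sigma>] by (metis add_0 add_cancel_left_right)

lemma G_minus: "\<sigma> \<in> G \<Longrightarrow> x \<in> L \<Longrightarrow> \<sigma> (- x) = - \<sigma> x"
  using G_add[OF _ L_minus, of \<sigma> x x] G_0[of \<sigma>] by (simp add: eq_neg_iff_add_eq_0)

lemma G_diff: "\<sigma> \<in> G \<Longrightarrow> x \<in> L \<Longrightarrow> y \<in> L \<Longrightarrow> \<sigma> (x - y) = \<sigma> x - \<sigma> y"
  using G_add[OF _ _ L_minus, of \<sigma> x y] G_minus by simp

lemma G_inverse: "\<sigma> \<in> G \<Longrightarrow> x \<in> L \<Longrightarrow> \<sigma> (inverse x) = inverse (\<sigma> x)"
  using G_mult[OF _ _ L_inverse, of \<sigma> x x] G_0[of \<sigma>] G_1[of \<sigma>]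
  by (cases "x = 0") (simp_all, metis inverse_unique)

lemma G_divide: "\<sigma> \<in> G \<Longrightarrow> x \<in> L \<Longrightarrow> y \<in> L \<Longrightarrow> \<sigma> (x / y) = \<sigma> x / \<sigma> y"
  by (simp add: divide_inverse G_mult G_inverse L_inverse)

lemma G_power: "\<sigma> \<in> G \<Longrightarrow> x \<in> L \<Longrightarrow> \<sigma> (x ^ n) = \<sigma> x ^ n"
  by (induction n) (simp_all add: G_1 G_mult L_power)

lemma G_power_int: "\<sigma> \<in> G \<Longrightarrow> x \<in> L \<Longrightarrow> \<sigma> (x powi n) = \<sigma> x powi n"
  by (cases "n \<ge> 0") (simp_all add: power_int_def G_power G_inverse L_inverse)

lemma G_of_nat: "\<sigma> \<in> G \<Longrightarrow> \<sigma> (of_nat n) = of_nat n"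
  by (induction n) (simp_all add: G_0 G_1 G_add L_of_nat L_1)

lemma G_of_int: "\<sigma> \<in> G \<Longrightarrow> \<sigma> (of_int n) = of_int n"
  by (cases n rule: int_cases2) (simp_all add: G_of_nat L_of_nat G_minus)

lemma G_sum: "\<sigma> \<in> G \<Longrightarrow> (\<And>i. i \<in> A \<Longrightarrow> f i \<in> L) \<Longrightarrow> \<sigma> (sum f A) = (\<Sum>i\<in>A. \<sigma> (f i))"
  by (induction A rule: infinite_finite_induct) (simp_all add: G_0 G_add L_sum)

lemma G_eq_0_iff: "\<sigma> \<in> G \<Longrightarrow> x \<in> L \<Longrightarrow> \<sigma> x = 0 \<longleftrightarrow> x = 0"
  using G_mult[OF _ _ L_inverse, of \<sigma> x x] G_0[of \<sigma>] G_1[of \<sigma>] by (cases "x = 0") auto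

lemma G_inj: "\<sigma> \<in> G \<Longrightarrow> x \<in> L \<Longrightarrow> y \<in> L \<Longrightarrow> \<sigma> x = \<sigma> y \<longleftrightarrow> x = y"
  using G_eq_0_iff[of \<sigma> "x - y"] by (simp add: G_diff L_diff)

lemma compose_apply: "x \<in> L \<Longrightarrow> compose L \<sigma> \<tau> x = \<sigma> (\<tau> x)"
  by (simp add: compose_def)

lemma G_eqI: "\<sigma> \<in> G \<Longrightarrow> \<tau> \<in> G \<Longrightarrow> (\<And>x. x \<in> L \<Longrightarrow> \<sigma> x = \<tau> x) \<Longrightarrow> \<sigma> = \<tau>"
  using G_ext by (intro extensionalityI[of _ L])

text \<open>
  Uniform local constancy: the value of \<open>F\<close> depends only on the restriction to a finite set \<open>S\<close>. For the
  cochains at hand this is the same as continuity, and unlike pointwise local constancy it directly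
  reduces sums over \<open>G\<close> to finite ones.
\<close>

definition determined_by :: "'k set \<Rightarrow> (('k \<Rightarrow> 'k) \<Rightarrow> 'b) \<Rightarrow> bool" where
  "determined_by S F \<longleftrightarrow> (\<forall>\<sigma>\<in>G. \<forall>\<tau>\<in>G. (\<forall>x\<in>S. \<sigma> x = \<tau> x) \<longrightarrow> F \<sigma> = F \<tau>)"

lemma determined_by_comp2:
  assumes "determined_by S F" "determined_by S F'"
  shows "determined_by S (\<lambda>\<sigma>. h (F \<sigma>) (F' \<sigma>))"
  unfolding determined_by_def
proof (intro ballI impI)
  fix \<sigma> \<tau> assume "\<sigma> \<in> G" "\<tau> \<in> G" "\<forall>x\<in>S. \<sigma> x = \<tau> x"
  then have "F \<sigma> = F \<tau>" "F' \<sigma> = F' \<tau>" using assms unfolding determined_by_def by blast+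
  then show "h (F \<sigma>) (F' \<sigma>) = h (F \<tau>) (F' \<tau>)" by simp
qed

definition locally_constant :: "(('k \<Rightarrow> 'k) \<Rightarrow> 'b) \<Rightarrow> bool" where
  "locally_constant F \<longleftrightarrow> (\<exists>S. finite S \<and> S \<subseteq> L \<and> determined_by S F)"

lemma locally_constant_const: "locally_constant (\<lambda>_. c)"
  by (auto simp: locally_constant_def determined_by_def intro!: exI[of _ "{}"])

lemma locally_constant_apply: "x \<in> L \<Longrightarrow> locally_constant (\<lambda>\<sigma>. \<sigma> x)"
  by (auto simp: locally_constant_def determined_by_def intro!: exI[of _ "{x}"])

lemma locally_constant_comp: "locally_constant F \<Longrightarrow> locally_constant (\<lambda>\<sigma>. h (F \<sigma>))"
  unfolding locally_constant_def determined_by_def by metis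

lemma locally_constant_comp2:
  assumes "locally_constant F" "locally_constant F'"
  shows "locally_constant (\<lambda>\<sigma>. h (F \<sigma>) (F' \<sigma>))"
proof -
  obtain S S' where "finite S" "S \<subseteq> L" "determined_by S F" "finite S'" "S' \<subseteq> L" "determined_by S' F'"
    using assms by (auto simp: locally_constant_def)
  then have "finite (S \<union> S') \<and> S \<union> S' \<subseteq> L \<and> determined_by (S \<union> S') (\<lambda>\<sigma>. h (F \<sigma>) (F' \<sigma>))"
    unfolding determined_by_def by (metis Un_iff Un_subset_iff finite_Un)
  then show ?thesis unfolding locally_constant_def by blast
qed

text \<open>
  A finite family is packaged into one function-valued map, which makes it possible to evaluate it at
  an index that itself depends on \<open>\<sigma>\<close>.
\<close>

lemma locally_constant_family:
  assumes "finite A" "\<And>i. i \<in> A \<Longrightarrow> locally_constant (F i)"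
  shows "locally_constant (\<lambda>\<sigma>. \<lambda>i\<in>A. F i \<sigma>)"
  using assms
proof (induction A rule: finite_induct)
  case empty
  show ?case using locally_constant_const[of "\<lambda>i\<in>{}. undefined"] by (simp add: restrict_def)
next
  case (insert a A)
  have "locally_constant (\<lambda>\<sigma>. (\<lambda>g y. g(a := y)) (\<lambda>i\<in>A. F i \<sigma>) (F a \<sigma>))"
    using insert.IH insert.prems by (intro locally_constant_comp2[where h = "\<lambda>g y. g(a := y)"]) blast+
  moreover have "(\<lambda>i\<in>A. F i \<sigma>)(a := F a \<sigma>) = (\<lambda>i\<in>insert a A. F i \<sigma>)" for \<sigma>
    by (auto simp: fun_eq_iff)
  ultimately show ?case by (simp only:)
qed

lemma locally_constant_sum:
  assumes "\<And>i. i \<in> A \<Longrightarrow> locally_constant (F i)"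
  shows "locally_constant (\<lambda>\<sigma>. \<Sum>i\<in>A. F i \<sigma>)"
  using assms
  by (induction A rule: infinite_finite_induct)
     (auto intro: locally_constant_const locally_constant_comp2)

lemma locally_constant_cong:
  assumes "locally_constant F" "\<And>\<sigma>. \<sigma> \<in> G \<Longrightarrow> F \<sigma> = F' \<sigma>"
  shows "locally_constant F'"
  using assms unfolding locally_constant_def determined_by_def by metis

text \<open>
  The cosets of the pointwise stabilizer of \<open>S\<close> correspond to the restrictions to \<open>S\<close>, of which there
  are finitely many. Sums over cosets, as in the finite case of Hilbert 90, become sums
  over restrictions, evaluated at chosen lifts.
\<close>

definition restrictions :: "'k set \<Rightarrow> ('k \<Rightarrow> 'k) set" where
  "restrictions S = (\<lambda>\<sigma>. restrict \<sigma> S) ` G"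

definition lift :: "'k set \<Rightarrow> ('k \<Rightarrow> 'k) \<Rightarrow> ('k \<Rightarrow> 'k)" where
  "lift S r = (SOME \<sigma>. \<sigma> \<in> G \<and> restrict \<sigma> S = r)"

definition total :: "'k set \<Rightarrow> (('k \<Rightarrow> 'k) \<Rightarrow> 'k) \<Rightarrow> 'k" where
  "total S F = (\<Sum>r\<in>restrictions S. F (lift S r))"

lemma lift: "r \<in> restrictions S \<Longrightarrow> lift S r \<in> G" "r \<in> restrictions S \<Longrightarrow> restrict (lift S r) S = r"
proof -
  assume "r \<in> restrictions S"
  then have "\<exists>\<sigma>. \<sigma> \<in> G \<and> restrict \<sigma> S = r" by (auto simp: restrictions_def)
  from someI_ex[OF this] show "lift S r \<in> G" "restrict (lift S r) S = r"
    by (auto simp: lift_def)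
qed

lemma lift_restrict: "\<sigma> \<in> G \<Longrightarrow> x \<in> S \<Longrightarrow> lift S (restrict \<sigma> S) x = \<sigma> x"
  using lift(2)[of "restrict \<sigma> S" S] unfolding restrictions_def
  by (metis imageI restrict_apply')

lemma finite_restrictions:
  assumes "finite S" "S \<subseteq> L"
  shows "finite (restrictions S)"
proof (rule finite_subset)
  show "restrictions S \<subseteq> (\<Pi>\<^sub>E x\<in>S. (\<lambda>\<sigma>. \<sigma> x) ` G)"
    by (auto simp: restrictions_def)
  show "finite (\<Pi>\<^sub>E x\<in>S. (\<lambda>\<sigma>. \<sigma> x) ` G)"
    using assms finite_orbit by (intro finite_PiE) auto
qed

lemma total_cong:
  assumes "\<And>\<sigma>. \<sigma> \<in> G \<Longrightarrow> F \<sigma> = F' \<sigma>"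
  shows "total S F = total S F'"
  unfolding total_def using assms lift by (intro sum.cong) auto

lemma total_translate:
  assumes "S \<subseteq> L" "determined_by S F" "\<tau> \<in> G"
  shows "total S (\<lambda>\<sigma>. F (compose L \<tau> \<sigma>)) = total S F"
proof -
  obtain \<tau>' where \<tau>': "\<tau>' \<in> G" "\<And>x. x \<in> L \<Longrightarrow> \<tau> (\<tau>' x) = x" "\<And>x. x \<in> L \<Longrightarrow> \<tau>' (\<tau> x) = x"
    using G_inv[OF assms(3)] by blast
  have inverse: "restrict (compose L b (lift S (restrict (compose L a (lift S r)) S))) S = r"
    if "r \<in> restrictions S" "a \<in> G" "b \<in> G" "\<And>x. x \<in> L \<Longrightarrow> b (a x) = x" for a b r
  proof
    fix x
    show "restrict (compose L b (lift S (restrict (compose L a (lift S r)) S))) S x = r x"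
    proof (cases "x \<in> S")
      case True
      then have "x \<in> L" using assms(1) by blast
      with True that show ?thesis
        using lift[OF that(1)] lift_restrict[OF G_comp[OF that(2) lift(1)[OF that(1)]], of x S]
        by (simp add: compose_apply G_in) (metis restrict_apply')
    next
      case False
      then show ?thesis using lift(2)[OF that(1)] by (metis restrict_apply)
    qed
  qed
  show ?thesis
    unfolding total_def
  proof (rule sum.reindex_bij_witness[where
        j = "\<lambda>r. restrict (compose L \<tau> (lift S r)) S" and i = "\<lambda>r. restrict (compose L \<tau>' (lift S r)) S"])
    fix r assume r: "r \<in> restrictions S"
    show "restrict (compose L \<tau>' (lift S r)) S \<in> restrictions S"
      "restrict (compose L \<tau> (lift S r)) S \<in> restrictions S"
      using r \<tau>' assms(3) lift(1) G_comp by (auto simp: restrictions_def)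
    show "restrict (compose L \<tau>' (lift S (restrict (compose L \<tau> (lift S r)) S))) S = r"
      "restrict (compose L \<tau> (lift S (restrict (compose L \<tau>' (lift S r)) S))) S = r"
      using inverse r \<tau>' assms(3) by auto
    have \<tau>r: "compose L \<tau> (lift S r) \<in> G" using r assms(3) lift(1) G_comp by auto
    then have "restrict (compose L \<tau> (lift S r)) S \<in> restrictions S" by (auto simp: restrictions_def)
    from lift(1)[OF this] lift_restrict[OF \<tau>r, of _ S] \<tau>r
    show "F (lift S (restrict (compose L \<tau> (lift S r)) S)) = F (compose L \<tau> (lift S r))"
      using assms(2) unfolding determined_by_def by blast
  qed
qed

text \<open>
  Dedekind independence is applied on the monoid of all elements whose image is determined by the
  restriction to \<open>S\<close>: this contains \<open>S\<close>, so different restrictions are different characters on it.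
\<close>

lemma total_nonzero:
  assumes S: "finite S" "S \<subseteq> L" and c: "\<And>\<sigma>. \<sigma> \<in> G \<Longrightarrow> c \<sigma> \<noteq> 0"
  obtains \<theta> where "\<theta> \<in> L" "determined_by S (\<lambda>\<sigma>. \<sigma> \<theta>)" "total S (\<lambda>\<sigma>. c \<sigma> * \<sigma> \<theta>) \<noteq> 0"
proof (rule ccontr)
  note thesis = that
  assume not: "\<not> thesis"
  define M where "M = {\<theta> \<in> L. determined_by S (\<lambda>\<sigma>. \<sigma> \<theta>)}"
  define r0 where "r0 = restrict (\<lambda>x\<in>L. x) S"
  have r0: "r0 \<in> restrictions S" using G_id unfolding r0_def restrictions_def by (rule imageI)
  have "c (lift S r0) = 0"
  proof (rule dedekind_independence[where R = "restrictions S" and M = M and mult = "(*)" and e = 1 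
         and \<phi> = "\<lambda>r. lift S r" and c = "\<lambda>r. c (lift S r)" and r = r0])
    show "m * n \<in> M" if "m \<in> M" "n \<in> M" for m n
    proof -
      have mn: "m \<in> L" "n \<in> L" using that by (auto simp: M_def)
      have "\<sigma> (m * n) = \<tau> (m * n)" if "\<sigma> \<in> G" "\<tau> \<in> G" "\<forall>x\<in>S. \<sigma> x = \<tau> x" for \<sigma> \<tau>
      proof -
        have "\<sigma> m = \<tau> m" "\<sigma> n = \<tau> n"
          using that \<open>m \<in> M\<close> \<open>n \<in> M\<close> unfolding M_def determined_by_def by blast+
        then show ?thesis using G_mult that mn by metis
      qed
      then show ?thesis using mn unfolding M_def determined_by_def by (simp add: L_mult)
    qed
    show "1 \<in> M" by (auto simp: M_def L_1 G_1 determined_by_def)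
    show "\<exists>m\<in>M. lift S r m \<noteq> lift S s m" if "r \<in> restrictions S" "s \<in> restrictions S" "r \<noteq> s" for r s
    proof -
      have "restrict (lift S r) S \<noteq> restrict (lift S s) S" using that lift(2) by auto
      then obtain x where "x \<in> S" "lift S r x \<noteq> lift S s x" by (metis restrict_ext)
      moreover have "x \<in> M" using \<open>x \<in> S\<close> S by (auto simp: M_def determined_by_def)
      ultimately show ?thesis by blast
    qed
    show "(\<Sum>r\<in>restrictions S. c (lift S r) * lift S r m) = 0" if "m \<in> M" for m
      using not thesis[of m] that unfolding M_def total_def by blast
    show "lift S r 1 \<noteq> 0" if "r \<in> restrictions S" for r
      using G_1[OF lift(1)[OF that]] by simp
  qed (use lift G_1 G_mult r0 finite_restrictions[OF S] in \<open>auto simp: M_def\<close>)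
  with c lift r0 show False by blast
qed

text \<open>
  As in the classical proof, \<open>w\<close> is a sum of the \<open>f(\<sigma>) \<sigma>(\<theta>)\<close>, and independence of characters makes it nonzero for
  some \<open>\<theta>\<close>.
\<close>

theorem hilbert90:
  assumes "locally_constant f" "\<And>\<sigma>. \<sigma> \<in> G \<Longrightarrow> f \<sigma> \<in> L" "\<And>\<sigma>. \<sigma> \<in> G \<Longrightarrow> f \<sigma> \<noteq> 0"
    and cocycle: "\<And>\<sigma> \<tau>. \<sigma> \<in> G \<Longrightarrow> \<tau> \<in> G \<Longrightarrow> f (compose L \<sigma> \<tau>) = f \<sigma> * \<sigma> (f \<tau>)"
  obtains w where "w \<in> L" "w \<noteq> 0" "\<And>\<sigma>. \<sigma> \<in> G \<Longrightarrow> f \<sigma> * \<sigma> w = w"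
proof -
  obtain S where S: "finite S" "S \<subseteq> L" "determined_by S f"
    using assms(1) by (auto simp: locally_constant_def)
  obtain \<theta> where \<theta>: "\<theta> \<in> L" "determined_by S (\<lambda>\<sigma>. \<sigma> \<theta>)" "total S (\<lambda>\<sigma>. f \<sigma> * \<sigma> \<theta>) \<noteq> 0"
    using total_nonzero[OF S(1,2), of f] assms(3) by blast
  define w where "w = total S (\<lambda>\<sigma>. f \<sigma> * \<sigma> \<theta>)"
  have "w \<in> L" unfolding w_def total_def using lift(1) assms(2) \<theta>(1) by (intro L_sum L_mult) (auto simp: G_in)
  moreover have "f \<tau> * \<tau> w = w" if \<tau>: "\<tau> \<in> G" for \<tau>
  proof -
    have "\<tau> w = total S (\<lambda>\<sigma>. \<tau> (f \<sigma> * \<sigma> \<theta>))"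
      unfolding w_def total_def
      using lift(1) assms(2) \<theta>(1) \<tau> by (intro G_sum L_mult) (auto simp: G_in)
    then have "f \<tau> * \<tau> w = total S (\<lambda>\<sigma>. f \<tau> * \<tau> (f \<sigma> * \<sigma> \<theta>))"
      by (simp add: total_def sum_distrib_left)
    also have "\<dots> = total S (\<lambda>\<sigma>. f (compose L \<tau> \<sigma>) * compose L \<tau> \<sigma> \<theta>)"
      using cocycle \<tau> assms(2) \<theta>(1) by (intro total_cong) (simp add: G_mult G_in compose_apply)
    also have "\<dots> = w"
      unfolding w_def by (rule total_translate[OF S(2) determined_by_comp2[OF S(3) \<theta>(2)] \<tau>])
    finally show ?thesis .
  qed
  ultimately show ?thesis using \<theta>(3) that unfolding w_def by blast
qed

text \<open>
  Here \<open>\<theta>\<close> is chosen with nonzero trace \<open>t\<close>, and the sum of the \<open>f(\<sigma>) \<sigma>(\<theta>)\<close> is divided by \<open>t\<close>.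
\<close>

theorem additive_hilbert90:
  assumes "locally_constant f" "\<And>\<sigma>. \<sigma> \<in> G \<Longrightarrow> f \<sigma> \<in> L"
    and cocycle: "\<And>\<sigma> \<tau>. \<sigma> \<in> G \<Longrightarrow> \<tau> \<in> G \<Longrightarrow> f (compose L \<sigma> \<tau>) = f \<sigma> + \<sigma> (f \<tau>)"
  obtains w where "w \<in> L" "\<And>\<sigma>. \<sigma> \<in> G \<Longrightarrow> f \<sigma> + \<sigma> w = w"
proof -
  obtain S where S: "finite S" "S \<subseteq> L" "determined_by S f"
    using assms(1) by (auto simp: locally_constant_def)
  obtain \<theta> where \<theta>: "\<theta> \<in> L" "determined_by S (\<lambda>\<sigma>. \<sigma> \<theta>)" "total S (\<lambda>\<sigma>. 1 * \<sigma> \<theta>) \<noteq> 0"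
    using total_nonzero[OF S(1,2), of "\<lambda>_. 1"] by auto
  define t where "t = total S (\<lambda>\<sigma>. \<sigma> \<theta>)"
  have t: "t \<in> L" "t \<noteq> 0" using \<theta> lift(1) by (auto simp: t_def total_def G_in intro!: L_sum)
  have t_fixed: "\<tau> t = t" if \<tau>: "\<tau> \<in> G" for \<tau>
  proof -
    have "\<tau> t = total S (\<lambda>\<sigma>. compose L \<tau> \<sigma> \<theta>)"
      unfolding t_def total_def
      using lift(1) \<theta>(1) \<tau> by (subst G_sum) (auto simp: compose_apply G_in)
    also have "\<dots> = t" unfolding t_def by (rule total_translate[OF S(2) \<theta>(2) \<tau>])
    finally show ?thesis .
  qed
  define w where "w = total S (\<lambda>\<sigma>. f \<sigma> * \<sigma> \<theta>)"
  have w: "w \<in> L" unfolding w_def total_def using lift(1) assms(2) \<theta>(1) by (intro L_sum L_mult) (auto simp: G_in)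
  have "f \<tau> * t + \<tau> w = w" if \<tau>: "\<tau> \<in> G" for \<tau>
  proof -
    have "f \<tau> * t = f \<tau> * total S (\<lambda>\<sigma>. compose L \<tau> \<sigma> \<theta>)"
      unfolding t_def by (simp only: total_translate[OF S(2) \<theta>(2) \<tau>])
    moreover have "\<tau> w = total S (\<lambda>\<sigma>. \<tau> (f \<sigma>) * compose L \<tau> \<sigma> \<theta>)"
      unfolding w_def total_def
      using lift(1) assms(2) \<theta>(1) \<tau> by (subst G_sum) (auto simp: G_mult compose_apply L_mult G_in)
    ultimately have "f \<tau> * t + \<tau> w = total S (\<lambda>\<sigma>. (f \<tau> + \<tau> (f \<sigma>)) * compose L \<tau> \<sigma> \<theta>)"
      by (simp add: total_def sum_distrib_left sum.distrib distrib_right)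
    also have "\<dots> = total S (\<lambda>\<sigma>. f (compose L \<tau> \<sigma>) * compose L \<tau> \<sigma> \<theta>)"
      using cocycle \<tau> by (intro total_cong) simp
    also have "\<dots> = w"
      unfolding w_def by (rule total_translate[OF S(2) determined_by_comp2[OF S(3) \<theta>(2)] \<tau>])
    finally show ?thesis .
  qed
  moreover have "\<tau> (w / t) = \<tau> w / t" if "\<tau> \<in> G" for \<tau>
    using that t w t_fixed by (simp add: G_divide)
  ultimately have "f \<tau> + \<tau> (w / t) = w / t" if "\<tau> \<in> G" for \<tau>
    using that t by (simp add: field_simps)
  with t w that[of "w / t"] show ?thesis by (simp add: L_divide)
qed

end

context galois_action
begin

text \<open>
  Cochains mod \<open>p\<close> are represented by integer-valued functions, so that they can be multiplied with
  indices and summed in the ring of integers. A primitive is a 1-cochain with a given coboundary.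
\<close>

definition character :: "nat \<Rightarrow> (('k \<Rightarrow> 'k) \<Rightarrow> int) \<Rightarrow> bool" where
  "character p b \<longleftrightarrow> locally_constant b \<and>
     (\<forall>\<sigma>\<in>G. \<forall>\<tau>\<in>G. [b (compose L \<sigma> \<tau>) = b \<sigma> + b \<tau>] (mod int p))"

definition primitive_of ::
  "nat \<Rightarrow> (('k \<Rightarrow> 'k) \<Rightarrow> int) \<Rightarrow> (('k \<Rightarrow> 'k) \<Rightarrow> ('k \<Rightarrow> 'k) \<Rightarrow> int) \<Rightarrow> bool" where
  "primitive_of p D V \<longleftrightarrow> locally_constant D \<and>
     (\<forall>\<sigma>\<in>G. \<forall>\<tau>\<in>G. [D (compose L \<sigma> \<tau>) = D \<sigma> + D \<tau> - V \<sigma> \<tau>] (mod int p))"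

lemma characterD:
  assumes "character p b"
  shows "locally_constant b"
    "\<sigma> \<in> G \<Longrightarrow> \<tau> \<in> G \<Longrightarrow> [b (compose L \<sigma> \<tau>) = b \<sigma> + b \<tau>] (mod int p)"
  using assms unfolding character_def by blast+

lemma primitive_ofD:
  assumes "primitive_of p D V"
  shows "locally_constant D"
    "\<sigma> \<in> G \<Longrightarrow> \<tau> \<in> G \<Longrightarrow> [D (compose L \<sigma> \<tau>) = D \<sigma> + D \<tau> - V \<sigma> \<tau>] (mod int p)"
  using assms unfolding primitive_of_def by blast+

lemma character_identity:
  assumes "character p b"
  shows "[b (\<lambda>x\<in>L. x) = 0] (mod int p)"
proof -
  have "compose L (\<lambda>x\<in>L. x) (\<lambda>x\<in>L. x) = (\<lambda>x\<in>L. x)" by (simp add: compose_def fun_eq_iff)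
  with characterD(2)[OF assms G_id G_id] show ?thesis by (simp add: cong_iff_dvd_diff)
qed

lemma subgroup_action:
  assumes "H \<subseteq> G" "(\<lambda>x\<in>L. x) \<in> H" "\<And>\<sigma> \<tau>. \<sigma> \<in> H \<Longrightarrow> \<tau> \<in> H \<Longrightarrow> compose L \<sigma> \<tau> \<in> H"
    and "\<And>\<sigma>. \<sigma> \<in> H \<Longrightarrow> \<exists>\<tau>\<in>H. (\<forall>x\<in>L. \<sigma> (\<tau> x) = x) \<and> (\<forall>x\<in>L. \<tau> (\<sigma> x) = x)"
  shows "galois_action L H"
proof
  have HG: "\<sigma> \<in> G" if "\<sigma> \<in> H" for \<sigma>
    using that assms(1) by blast
  show "finite ((\<lambda>\<sigma>. \<sigma> x) ` H)" if "x \<in> L" for x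
    using finite_orbit[OF that] assms(1) by (meson finite_subset image_mono)
  show "\<exists>\<tau>\<in>H. (\<forall>x\<in>L. \<sigma> (\<tau> x) = x) \<and> (\<forall>x\<in>L. \<tau> (\<sigma> x) = x)" if "\<sigma> \<in> H" for \<sigma>
    using assms(4)[OF that] .
qed (simp_all add: L_1 L_add L_minus L_mult L_inverse G_in G_add G_mult G_1 G_ext assms(2,3)
      subsetD[OF assms(1)])

text \<open>
  Hilbert 90 for functions on a \<open>G\<close>-set, with \<open>Y(\<sigma>, x)\<close> the value of the cocycle at the point \<open>\<sigma>x\<close>. This
  combines Shapiro's lemma with Hilbert 90: on each orbit, split the cocycle of the stabilizer of a
  representative, and transport the solution along the orbit.
\<close>

theorem hilbert90_equivariant:
  fixes act :: "('k \<Rightarrow> 'k) \<Rightarrow> 'x \<Rightarrow> 'x" and Y :: "('k \<Rightarrow> 'k) \<Rightarrow> 'x \<Rightarrow> 'k"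
  assumes act: "\<And>\<sigma> x. \<sigma> \<in> G \<Longrightarrow> x \<in> A \<Longrightarrow> act \<sigma> x \<in> A"
      "\<And>x. x \<in> A \<Longrightarrow> act (\<lambda>x\<in>L. x) x = x"
      "\<And>\<sigma> \<tau> x. \<sigma> \<in> G \<Longrightarrow> \<tau> \<in> G \<Longrightarrow> x \<in> A \<Longrightarrow> act (compose L \<sigma> \<tau>) x = act \<sigma> (act \<tau> x)"
    and Y: "\<And>x. x \<in> A \<Longrightarrow> locally_constant (\<lambda>\<sigma>. Y \<sigma> x)"
      "\<And>\<sigma> x. \<sigma> \<in> G \<Longrightarrow> x \<in> A \<Longrightarrow> Y \<sigma> x \<in> L" "\<And>\<sigma> x. \<sigma> \<in> G \<Longrightarrow> x \<in> A \<Longrightarrow> Y \<sigma> x \<noteq> 0"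
      "\<And>\<sigma> \<tau> x. \<sigma> \<in> G \<Longrightarrow> \<tau> \<in> G \<Longrightarrow> x \<in> A \<Longrightarrow> Y (compose L \<sigma> \<tau>) x = Y \<sigma> (act \<tau> x) * \<sigma> (Y \<tau> x)"
  obtains z where "\<And>x. x \<in> A \<Longrightarrow> z x \<in> L" "\<And>x. x \<in> A \<Longrightarrow> z x \<noteq> 0"
    "\<And>\<sigma> x. \<sigma> \<in> G \<Longrightarrow> x \<in> A \<Longrightarrow> Y \<sigma> x * \<sigma> (z x) = z (act \<sigma> x)"
proof -
  have ex: "\<exists>w. w \<in> L \<and> w \<noteq> 0 \<and> (\<forall>\<sigma>\<in>G. act \<sigma> x = x \<longrightarrow> Y \<sigma> x * \<sigma> w = w)" if x: "x \<in> A" for x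
  proof -
    define H where "H = {\<sigma> \<in> G. act \<sigma> x = x}"
    interpret H: galois_action L H
    proof (rule subgroup_action)
      show "(\<lambda>x\<in>L. x) \<in> H" using G_id act(2) x by (simp add: H_def)
      show "compose L \<sigma> \<tau> \<in> H" if "\<sigma> \<in> H" "\<tau> \<in> H" for \<sigma> \<tau>
        using that act(3) x G_comp by (auto simp: H_def)
      fix \<sigma> assume \<sigma>: "\<sigma> \<in> H"
      then obtain \<tau> where \<tau>: "\<tau> \<in> G" "\<forall>x\<in>L. \<sigma> (\<tau> x) = x" "\<forall>x\<in>L. \<tau> (\<sigma> x) = x"
        using G_inv[of \<sigma>] by (auto simp: H_def)
      have "compose L \<tau> \<sigma> = (\<lambda>x\<in>L. x)"
        using \<sigma> \<tau> G_comp G_id by (intro G_eqI) (auto simp: compose_apply H_def)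
      then have "act \<tau> (act \<sigma> x) = x" using act(2,3) \<sigma> \<tau>(1) x by (metis (mono_tags, lifting) H_def mem_Collect_eq)
      then have "\<tau> \<in> H" using \<sigma> \<tau>(1) by (auto simp: H_def)
      with \<tau> show "\<exists>\<tau>\<in>H. (\<forall>x\<in>L. \<sigma> (\<tau> x) = x) \<and> (\<forall>x\<in>L. \<tau> (\<sigma> x) = x)" by blast
    qed (auto simp: H_def)
    have HG: "\<sigma> \<in> G" "act \<sigma> x = x" if "\<sigma> \<in> H" for \<sigma>
      using that by (auto simp: H_def)
    obtain S where S: "finite S" "S \<subseteq> L" "determined_by S (\<lambda>\<sigma>. Y \<sigma> x)"
      using Y(1)[OF x] unfolding locally_constant_def by blast
    then have "H.determined_by S (\<lambda>\<sigma>. Y \<sigma> x)"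
      unfolding determined_by_def H.determined_by_def by (simp add: HG(1))
    with S have lc: "H.locally_constant (\<lambda>\<sigma>. Y \<sigma> x)"
      unfolding H.locally_constant_def by blast
    obtain w where "w \<in> L" "w \<noteq> 0" "\<And>\<sigma>. \<sigma> \<in> H \<Longrightarrow> Y \<sigma> x * \<sigma> w = w"
    proof (rule H.hilbert90[OF lc])
      show "Y (compose L \<sigma> \<tau>) x = Y \<sigma> x * \<sigma> (Y \<tau> x)" if "\<sigma> \<in> H" "\<tau> \<in> H" for \<sigma> \<tau>
        using Y(4)[of \<sigma> \<tau> x] HG that x by simp
    qed (use Y(2,3) HG(1) x in blast)+
    then show ?thesis by (auto simp: H_def)
  qed
  then obtain w where w: "\<And>x. x \<in> A \<Longrightarrow> w x \<in> L" "\<And>x. x \<in> A \<Longrightarrow> w x \<noteq> 0"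
      "\<And>\<sigma> x. x \<in> A \<Longrightarrow> \<sigma> \<in> G \<Longrightarrow> act \<sigma> x = x \<Longrightarrow> Y \<sigma> x * \<sigma> (w x) = w x"
    by metis
  define orbit where "orbit x = {act \<sigma> x | \<sigma>. \<sigma> \<in> G}" for x
  have orbit_eq: "orbit (act \<sigma> x) = orbit x" if "\<sigma> \<in> G" "x \<in> A" for \<sigma> x
  proof -
    obtain \<tau> where \<tau>: "\<tau> \<in> G" "\<forall>x\<in>L. \<tau> (\<sigma> x) = x" using G_inv[OF \<open>\<sigma> \<in> G\<close>] by blast
    have "compose L \<tau> \<sigma> = (\<lambda>x\<in>L. x)"
      using that \<tau> G_comp G_id by (intro G_eqI) (auto simp: compose_apply)
    then have inverse_act: "act \<tau> (act \<sigma> x) = x" using act(2,3) that \<tau>(1) by metis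
    show ?thesis
    proof
      show "orbit (act \<sigma> x) \<subseteq> orbit x" 
      proof
        fix y assume "y \<in> orbit (act \<sigma> x)"
        then obtain \<rho> where \<rho>: "\<rho> \<in> G" "y = act \<rho> (act \<sigma> x)" by (auto simp: orbit_def)
        then have "y = act (compose L \<rho> \<sigma>) x" using act(3) that by simp
        then show "y \<in> orbit x" using G_comp \<rho>(1) that(1) by (auto simp: orbit_def)
      qed
      show "orbit x \<subseteq> orbit (act \<sigma> x)" 
      proof
        fix y assume "y \<in> orbit x"
        then obtain \<rho> where \<rho>: "\<rho> \<in> G" "y = act \<rho> x" by (auto simp: orbit_def)
        then have "y = act (compose L \<rho> \<tau>) (act \<sigma> x)" using inverse_act act(1,3) that \<tau> by simp
        then show "y \<in> orbit (act \<sigma> x)" using G_comp \<rho>(1) \<tau>(1) by (auto simp: orbit_def)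
      qed
    qed
  qed
  define rep where "rep x = (SOME y. y \<in> orbit x)" for x
  define g where "g x = (SOME \<sigma>. \<sigma> \<in> G \<and> act \<sigma> (rep x) = x)" for x
  have rep: "rep x \<in> A" "g x \<in> G" "act (g x) (rep x) = x" if x: "x \<in> A" for x
  proof -
    have "x \<in> orbit x" using act(2)[OF x] G_id by (force simp: orbit_def)
    then have "rep x \<in> orbit x" unfolding rep_def by (metis someI_ex)
    then obtain \<sigma> where \<sigma>: "\<sigma> \<in> G" "rep x = act \<sigma> x" by (auto simp: orbit_def)
    then show "rep x \<in> A" using act(1) x by simp
    have "x \<in> orbit (rep x)" using orbit_eq[OF \<sigma>(1) x] \<open>x \<in> orbit x\<close> \<sigma>(2) by simp
    then have "\<exists>\<sigma>. \<sigma> \<in> G \<and> act \<sigma> (rep x) = x" by (auto simp: orbit_def)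
    from someI_ex[OF this] show "g x \<in> G" "act (g x) (rep x) = x" by (auto simp: g_def)
  qed
  define z where "z x = Y (g x) (rep x) * g x (w (rep x))" for x
  have z: "z (act \<sigma> y) = Y \<sigma> y * \<sigma> (w y)" if \<sigma>: "\<sigma> \<in> G" and y: "y \<in> A" "rep (act \<sigma> y) = y" for \<sigma> y
  proof -
    define x where "x = act \<sigma> y"
    have x: "x \<in> A" using act(1) \<sigma> y by (simp add: x_def)
    have g: "g x \<in> G" "act (g x) y = x" using rep(2,3)[OF x] y(2) by (simp_all add: x_def)
    obtain \<tau> where \<tau>: "\<tau> \<in> G" "\<forall>t\<in>L. g x (\<tau> t) = t" "\<forall>t\<in>L. \<tau> (g x t) = t" 
      using G_inv[OF g(1)] by blast
    \<comment> \<open>The element \<open>h\<close> stabilizes \<open>y\<close>, so that \<open>z\<close> does not depend on the choice of \<open>g\<close>.\<close>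
  define h where "h = compose L \<tau> \<sigma>"
    have h: "h \<in> G" using G_comp \<tau>(1) \<sigma> by (simp add: h_def)
    have "compose L \<tau> (g x) = (\<lambda>x\<in>L. x)"
      using g \<tau> G_comp G_id by (intro G_eqI) (auto simp: compose_apply)
    then have "act \<tau> x = y" using act(2,3) y(1) g \<tau>(1) by metis
    then have hy: "act h y = y" using act(3)[OF \<tau>(1) \<sigma> y(1)] by (simp add: h_def x_def)
    have \<sigma>_eq: "\<sigma> = compose L (g x) h"
      using g(1) h \<sigma> \<tau> G_comp by (intro G_eqI) (auto simp: h_def compose_apply G_in)
    have "Y \<sigma> y * \<sigma> (w y) = Y (g x) y * (g x (Y h y) * g x (h (w y)))"
      using Y(4)[OF g(1) h y(1)] hy w(1)[OF y(1)] by (simp add: compose_apply flip: \<sigma>_eq)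
         (simp add: \<sigma>_eq compose_apply)
    also have "g x (Y h y) * g x (h (w y)) = g x (Y h y * h (w y))"
      using g(1) h Y(2) y(1) w(1) by (simp add: G_mult G_in)
    also have "Y h y * h (w y) = w y" using w(3)[OF y(1) h hy] .
    finally show ?thesis using y(2) by (simp add: z_def x_def)
  qed
  show ?thesis
  proof
    fix x assume x: "x \<in> A"
    show "z x \<in> L" "z x \<noteq> 0"
      using Y(2,3) rep[OF x] w(1,2) by (simp_all add: z_def L_mult G_in G_eq_0_iff)
  next
    fix \<sigma> x assume \<sigma>: "\<sigma> \<in> G" and x: "x \<in> A"
    note r = rep[OF x]
    have "rep (act \<sigma> x) = rep x" unfolding rep_def orbit_eq[OF \<sigma> x] ..
    moreover have "act \<sigma> x = act (compose L \<sigma> (g x)) (rep x)"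
      using act(3)[OF \<sigma> r(2,1)] r(3) by simp
    ultimately have "z (act \<sigma> x) = Y (compose L \<sigma> (g x)) (rep x) * compose L \<sigma> (g x) (w (rep x))"
      using z[OF G_comp[OF \<sigma> r(2)] r(1)] by simp
    also have "\<dots> = Y \<sigma> x * \<sigma> (z x)"
      using Y(4)[OF \<sigma> r(2,1)] r \<sigma> Y(2)[OF r(2,1)] w(1)[OF r(1)]
      by (simp add: z_def compose_apply G_mult G_in)
    finally show "Y \<sigma> x * \<sigma> (z x) = z (act \<sigma> x)" ..
  qed
qed

end

section \<open>Characteristic p\<close>

context galois_action
begin

text \<open>
  The second cohomology group of \<open>G\<close> with coefficients mod \<open>p\<close> vanishes in characteristic \<open>p\<close>. For
  the cocycle in question, additive Hilbert 90 in degree 1 is enough, since its shape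
  suggests a primitive over \<open>L\<close>. Choose \<open>y\<close> with \<open>\<sigma>(y) = y + c(\<sigma>)\<close>. Then \<open>E(\<sigma>) = -D23(\<sigma>) - b(\<sigma>)\<sigma>(y)\<close> is a
  1-cocycle, hence \<open>E(\<sigma>) = \<sigma>(x) - x\<close>, and \<open>a(\<sigma>)\<sigma>(x) - D12(\<sigma>)\<sigma>(y)\<close> has the required coboundary.
\<close>

lemma massey_vanishes_char_p:
  fixes p :: nat and a b c D12 D23 :: "('k \<Rightarrow> 'k) \<Rightarrow> int"
  assumes p: "Factorial_Ring.prime p" "of_nat p = (0::'k)"
    and artin_schreier: "\<And>w. w \<in> L \<Longrightarrow> \<exists>y\<in>L. y ^ p - y = w"
    and a: "character p a" and b: "character p b" and c: "character p c"
    and D12: "primitive_of p D12 (\<lambda>\<sigma> \<tau>. a \<sigma> * b \<tau>)" and D23: "primitive_of p D23 (\<lambda>\<sigma> \<tau>. b \<sigma> * c \<tau>)"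
  obtains K where "primitive_of p K (\<lambda>\<sigma> \<tau>. a \<sigma> * D23 \<tau> + D12 \<sigma> * c \<tau>)"
proof -
  have char: "CHAR('k) = p"
  proof -
    have "CHAR('k) dvd p" using p(2) by (simp add: of_nat_eq_0_iff_char_dvd)
    moreover have "CHAR('k) \<noteq> 1" using CHAR_not_1'[where ?'a = 'k] by simp
    ultimately show ?thesis using p(1) by (metis prime_nat_iff)
  qed
  have of_int_eq: "(of_int m :: 'k) = of_int n \<longleftrightarrow> [m = n] (mod int p)" for m n
    by (simp add: of_int_eq_iff_cong_CHAR char)
  define i where "i = (of_int :: int \<Rightarrow> 'k)"
  have i: "i m \<in> L" "\<sigma> \<in> G \<Longrightarrow> \<sigma> (i m) = i m" for m \<sigma>
    by (simp_all add: i_def L_of_int G_of_int)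
  note lc = characterD(1)[OF a] characterD(1)[OF b] characterD(1)[OF c] primitive_ofD(1)[OF D12] primitive_ofD(1)[OF D23]
  note lc = lc[THEN locally_constant_comp[where h = i]]
  have a': "i (a (compose L \<sigma> \<tau>)) = i (a \<sigma>) + i (a \<tau>)"
    and b': "i (b (compose L \<sigma> \<tau>)) = i (b \<sigma>) + i (b \<tau>)"
    and c': "i (c (compose L \<sigma> \<tau>)) = i (c \<sigma>) + i (c \<tau>)"
    and D12': "i (D12 (compose L \<sigma> \<tau>)) = i (D12 \<sigma>) + i (D12 \<tau>) - i (a \<sigma>) * i (b \<tau>)"
    and D23': "i (D23 (compose L \<sigma> \<tau>)) = i (D23 \<sigma>) + i (D23 \<tau>) - i (b \<sigma>) * i (c \<tau>)"
    if "\<sigma> \<in> G" "\<tau> \<in> G" for \<sigma> \<tau>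
    using characterD(2)[OF a that] characterD(2)[OF b that] characterD(2)[OF c that]
      primitive_ofD(2)[OF D12 that] primitive_ofD(2)[OF D23 that]
    unfolding of_int_eq[symmetric] by (simp_all add: i_def algebra_simps)
  obtain w where w: "w \<in> L" "\<And>\<sigma>. \<sigma> \<in> G \<Longrightarrow> i (c \<sigma>) + \<sigma> w = w"
    by (rule additive_hilbert90[OF lc(3)]) (simp_all add: i c')
  define ch where "ch = - w"
  have ch: "ch \<in> L" using w by (simp add: ch_def L_minus)
  have ch_act: "\<sigma> ch = ch + i (c \<sigma>)" if "\<sigma> \<in> G" for \<sigma>
    using w(2)[OF that] w(1) that by (simp add: ch_def G_minus) (metis add_diff_cancel_right' minus_diff_eq uminus_add_conv_diff add.commute)
  define E where "E \<sigma> = - i (D23 \<sigma>) - i (b \<sigma>) * \<sigma> ch" for \<sigma>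
  have lcE: "locally_constant E"
    unfolding E_def 
    by (rule locally_constant_comp2[where h = "\<lambda>u v. - u - v", OF lc(5)
         locally_constant_comp2[where h = "(*)", OF lc(2) locally_constant_apply[OF ch]]])
  obtain x' where x': "x' \<in> L" "\<And>\<sigma>. \<sigma> \<in> G \<Longrightarrow> E \<sigma> + \<sigma> x' = x'"
  proof (rule additive_hilbert90[OF lcE])
    show "E \<sigma> \<in> L" if "\<sigma> \<in> G" for \<sigma>
      using that ch by (simp add: i E_def L_closed G_in)
    show "E (compose L \<sigma> \<tau>) = E \<sigma> + \<sigma> (E \<tau>)" if "\<sigma> \<in> G" "\<tau> \<in> G" for \<sigma> \<tau>
      using that ch by (simp add: i E_def b' D23' compose_apply G_diff G_minus G_mult G_add L_closed G_in ch_act algebra_simps)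
  qed auto
  define x where "x = - x'"
  have x: "x \<in> L" using x' by (simp add: x_def L_minus)
  have x_act: "\<sigma> x = x + E \<sigma>" if "\<sigma> \<in> G" for \<sigma>
    using x'(2)[OF that] x'(1) that by (simp add: x_def G_minus) (metis add_diff_cancel_right' minus_diff_eq uminus_add_conv_diff add.commute)
  define u where "u \<sigma> = i (a \<sigma>) * \<sigma> x - i (D12 \<sigma>) * \<sigma> ch" for \<sigma>
  have u_L: "u \<sigma> \<in> L" if "\<sigma> \<in> G" for \<sigma>
    using that x ch by (simp add: i u_def L_closed G_in)
  have lcu: "locally_constant u"
    unfolding u_def
    by (rule locally_constant_comp2[where h = "(-)",
          OF locally_constant_comp2[where h = "(*)", OF lc(1) locally_constant_apply[OF x]]
             locally_constant_comp2[where h = "(*)", OF lc(4) locally_constant_apply[OF ch]]])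
  define V where "V \<sigma> \<tau> = a \<sigma> * D23 \<tau> + D12 \<sigma> * c \<tau>" for \<sigma> \<tau>
  have u: "u (compose L \<sigma> \<tau>) = u \<sigma> + \<sigma> (u \<tau>) - i (V \<sigma> \<tau>)" if "\<sigma> \<in> G" "\<tau> \<in> G" for \<sigma> \<tau>
  proof -
    have "i (V \<sigma> \<tau>) = i (a \<sigma>) * i (D23 \<tau>) + i (D12 \<sigma>) * i (c \<tau>)" by (simp add: V_def i_def)
    moreover have "E \<tau> \<in> L" using that ch by (simp add: i E_def L_closed G_in)
    ultimately show ?thesis
      using that x ch
      by (simp add: i u_def a' D12' compose_apply G_diff G_mult G_add L_closed G_in x_act ch_act)
         (simp add: i E_def G_diff G_mult G_minus G_add L_closed G_in ch_act algebra_simps)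
  qed
  have frob: "(s + t) ^ p = s ^ p + t ^ p" for s t :: 'k
    using freshmans_dream[where ?'a = 'k] p(1) char by simp
  have frob_minus: "(- t) ^ p = - (t ^ p)" for t :: 'k
    using frob[of t "- t"] prime_gt_0_nat[OF p(1)] by (simp add: zero_power eq_neg_iff_add_eq_0 add.commute)
  have frob_diff: "(s - t) ^ p = s ^ p - t ^ p" for s t :: 'k
    using frob[of s "- t"] frob_minus[of t] by simp
  have frob_nat: "(of_nat n :: 'k) ^ p = of_nat n" for n
    by (induction n) (use prime_gt_0_nat[OF p(1)] in \<open>simp_all add: frob zero_power\<close>)
  have frob_i: "i m ^ p = i m" for m
    unfolding i_def by (cases m rule: int_cases2) (simp_all add: frob_nat frob_minus)
  define v where "v \<sigma> = u \<sigma> ^ p - u \<sigma>" for \<sigma>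
  obtain w' where w': "w' \<in> L" "\<And>\<sigma>. \<sigma> \<in> G \<Longrightarrow> v \<sigma> + \<sigma> w' = w'"
  proof (rule additive_hilbert90[of v])
    show "locally_constant v" unfolding v_def by (rule locally_constant_comp[OF lcu])
    show "v \<sigma> \<in> L" if "\<sigma> \<in> G" for \<sigma> using u_L[OF that] by (simp add: v_def L_closed)
    show "v (compose L \<sigma> \<tau>) = v \<sigma> + \<sigma> (v \<tau>)" if "\<sigma> \<in> G" "\<tau> \<in> G" for \<sigma> \<tau>
      using that u_L by (simp add: i v_def u frob frob_diff frob_i G_diff G_power L_power)
  qed auto
  obtain y where y: "y \<in> L" "y ^ p - y = w'" using artin_schreier[OF w'(1)] by blast
  \<comment> \<open>Subtracting the coboundary of \<open>y\<close> makes the values roots of \<open>X^p - X\<close>.\<close>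
  define u' where "u' \<sigma> = u \<sigma> - y + \<sigma> y" for \<sigma>
  have u'_root: "u' \<sigma> ^ p = u' \<sigma>" if "\<sigma> \<in> G" for \<sigma>
  proof -
    have "\<sigma> w' = \<sigma> y ^ p - \<sigma> y" using y that by (simp add: G_diff G_power L_power flip: y(2))
    then have "v \<sigma> + (\<sigma> y ^ p - \<sigma> y) = y ^ p - y" using w'(2)[OF that] y(2) by simp
    then show ?thesis by (simp add: u'_def v_def frob frob_diff algebra_simps)
  qed
  have roots: "\<exists>n. t = i n" if "t ^ p = t" for t
  proof -
    define P where "P = Polynomial.monom (1::'k) p + [:0, -1:]"
    have P: "Polynomial.poly P t = t ^ p - t" for t by (simp add: P_def poly_monom)
    have "p > 1" using p(1) prime_gt_1_nat by blast
    then have deg: "Polynomial.degree P = p"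
      unfolding P_def by (subst degree_add_eq_left) (simp_all add: degree_monom_eq)
    then have "P \<noteq> 0" using \<open>p > 1\<close> by auto
    then have "card {t. Polynomial.poly P t = 0} \<le> p"
      using card_poly_roots_bound deg by metis
    moreover have "card (i ` {0..<int p}) = p"
    proof (subst card_image)
      show "inj_on i {0..<int p}" unfolding i_def by (rule inj_onI) (auto simp: of_int_eq cong_def)
    qed simp
    moreover have "i ` {0..<int p} \<subseteq> {t. Polynomial.poly P t = 0}" by (auto simp: P frob_i)
    ultimately have "i ` {0..<int p} = {t. Polynomial.poly P t = 0}"
      using poly_roots_finite[OF \<open>P \<noteq> 0\<close>] by (intro card_seteq) auto
    with that P[of t] show ?thesis by force
  qed
  define K where "K \<sigma> = (SOME n. u' \<sigma> = i n)" for \<sigma>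
  have K: "u' \<sigma> = i (K \<sigma>)" if "\<sigma> \<in> G" for \<sigma>
    unfolding K_def using someI_ex[OF roots[OF u'_root[OF that]]] .
  have "locally_constant u'"
    unfolding u'_def
    by (rule locally_constant_comp2[where h = "\<lambda>s t. s - y + t", OF lcu locally_constant_apply[OF y(1)]])
  then have "locally_constant K"
    unfolding K_def by (rule locally_constant_comp)
  moreover have "[K (compose L \<sigma> \<tau>) = K \<sigma> + K \<tau> - (a \<sigma> * D23 \<tau> + D12 \<sigma> * c \<tau>)] (mod int p)"
    if "\<sigma> \<in> G" "\<tau> \<in> G" for \<sigma> \<tau>
  proof -
    have "i (K \<sigma>) + \<sigma> (i (K \<tau>)) - i (K (compose L \<sigma> \<tau>)) = i (V \<sigma> \<tau>)"
      unfolding K[OF that(1), symmetric] K[OF that(2), symmetric] K[OF G_comp[OF that], symmetric]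
      using that y u_L by (simp add: u'_def u compose_apply G_diff G_add L_closed G_in)
    then have "i (K (compose L \<sigma> \<tau>)) = i (K \<sigma>) + i (K \<tau>) - i (V \<sigma> \<tau>)"
      using that by (simp add: i algebra_simps)
    then show ?thesis unfolding of_int_eq[symmetric] by (simp add: i_def V_def)
  qed
  ultimately show ?thesis using that unfolding primitive_of_def by blast
qed

end

section \<open>Summation by parts modulo p\<close>

definition periodic :: "int \<Rightarrow> (int \<Rightarrow> int) \<Rightarrow> bool" where
  "periodic p f \<longleftrightarrow> (\<forall>i j. [i = j] (mod p) \<longrightarrow> [f i = f j] (mod p))"

lemma cong_add_multiple: "[a = b + p * t] (mod p) \<Longrightarrow> [a = b] (mod p)" for a b p t :: int
  by (simp add: cong_def)

lemma periodicD: "periodic p f \<Longrightarrow> [i = j] (mod p) \<Longrightarrow> [f i = f j] (mod p)"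
  unfolding periodic_def by blast

lemma periodicI: "(\<And>i j. [i = j] (mod p) \<Longrightarrow> [f i = f j] (mod p)) \<Longrightarrow> periodic p f"
  unfolding periodic_def by blast

lemma sum_periodic_shift:
  assumes "p > 0" "periodic p f"
  shows "[(\<Sum>i\<in>{0..<p}. f (i + s)) = (\<Sum>i\<in>{0..<p}. f i)] (mod p)"
proof -
  have "(\<Sum>i\<in>{0..<p}. f ((i + s) mod p)) = (\<Sum>i\<in>{0..<p}. f i)"
  proof (rule sum.reindex_bij_witness[where i = "\<lambda>i. (i - s) mod p" and j = "\<lambda>i. (i + s) mod p"])
    fix i assume "i \<in> {0..<p}"
    then show "((i + s) mod p - s) mod p = i" "((i - s) mod p + s) mod p = i"
      by (simp_all add: mod_diff_left_eq mod_add_left_eq)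
  qed (use assms(1) in simp_all)
  moreover have "[(\<Sum>i\<in>{0..<p}. f (i + s)) = (\<Sum>i\<in>{0..<p}. f ((i + s) mod p))] (mod p)"
    by (intro cong_sum periodicD[OF assms(2)]) (simp add: cong_def)
  ultimately show ?thesis by simp
qed

lemma sum_periodic_translate: 
  assumes "p > 0" "periodic p f" "\<And>i. [g i = f (i + s)] (mod p)"
  shows "[(\<Sum>i\<in>{0..<p}. g i) = (\<Sum>i\<in>{0..<p}. f i)] (mod p)"
  using cong_trans[OF cong_sum[OF assms(3)] sum_periodic_shift[OF assms(1,2)]] .

lemma sum_weighted_translate:
  assumes "p > 0" "periodic p w" "periodic p g" "\<And>i. [g' i = g (i - x)] (mod p)"
  shows "[(\<Sum>i\<in>{0..<p}. w i * g' i) = (\<Sum>i\<in>{0..<p}. w (i + x) * g i)] (mod p)"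
proof (rule sum_periodic_translate[OF assms(1), where s = "-x"])
  show "periodic p (\<lambda>i. w (i + x) * g i)"
    by (intro periodicI cong_mult periodicD[OF assms(2)] periodicD[OF assms(3)] cong_add cong_refl)
  show "[w i * g' i = w (i + - x + x) * g (i + - x)] (mod p)" for i
    using assms(4)[of i] by (intro cong_mult) auto
qed

text \<open>
  What remains of the field theory: functions \<open>f\<close>, \<open>h\<close>, \<open>k\<close> on residues mod \<open>p\<close>, realized as periodic functions on the
  integers, with \<open>b\<close> the common value of the sums of \<open>f\<close> and \<open>h\<close>. The relation \<open>k_diag\<close> makes \<open>k\<close> a
  primitive of \<open>f(i) - h(j)\<close> along the diagonal.
\<close>

locale massey_data =
  fixes p b :: int and f h :: "int \<Rightarrow> int" and k :: "int \<Rightarrow> int \<Rightarrow> int"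
  assumes p: "Factorial_Ring.prime p"
    and f_per: "periodic p f" and h_per: "periodic p h"
    and k_per: "[i = i'] (mod p) \<Longrightarrow> [j = j'] (mod p) \<Longrightarrow> [k i j = k i' j'] (mod p)"
    and sum_f: "[(\<Sum>i\<in>{0..<p}. f i) = b] (mod p)"
    and sum_h: "[(\<Sum>i\<in>{0..<p}. h i) = b] (mod p)"
    and k_diag: "[k i j - k (i + 1) (j + 1) = f i - h j] (mod p)"
begin

lemma p_pos: "p > 0" using p by (simp add: prime_gt_0_int)

definition row :: "int \<Rightarrow> int" where "row i = (\<Sum>j\<in>{0..<p}. k i j)"
definition row_moment :: "int \<Rightarrow> int" where "row_moment i = (\<Sum>j\<in>{0..<p}. j * k i j)"
definition f_moment :: int where "f_moment = (\<Sum>i\<in>{0..<p}. i * f i)"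
definition h_moment :: int where "h_moment = (\<Sum>i\<in>{0..<p}. i * h i)"
definition half :: int where "half = (p + 1) div 2"
text \<open>
  The second binomial moment of \<open>f\<close>. For \<open>p = 2\<close> the binomial coefficient is not periodic,
  and the term is dropped: its role is taken over by the correction with \<open>f(i)\<close> in \<open>row_moment_step\<close>, whose factor
  \<open>p(p + 1)/2\<close> is divisible by \<open>p\<close> exactly if \<open>p\<close> is odd.
\<close>

definition f_moment2 :: int where
  "f_moment2 = (if p = 2 then 0 else \<Sum>i\<in>{0..<p}. half * (i * (i - 1)) * f i)"

lemma k_row_per: "periodic p (k i)"
  by (intro periodicI k_per cong_refl)

lemma k_step: "[k (i + 1) (j + 1) = k i j - f i + h j] (mod p)"
proof -
  have eq: "k (i + 1) (j + 1) - (k i j - f i + h j) = - ((k i j - k (i + 1) (j + 1)) - (f i - h j))"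
    by simp
  show ?thesis
    unfolding cong_iff_dvd_diff eq dvd_minus_iff by (rule k_diag[unfolded cong_iff_dvd_diff])
qed

lemma periodic_mult: "periodic p g \<Longrightarrow> periodic p (\<lambda>i. i * g i)"
  by (rule periodicI, rule cong_mult, assumption, rule periodicD)

text \<open>
  Adding up the diagonal relation over \<open>j\<close> removes \<open>f(i)\<close>, because it occurs \<open>p\<close> times.
\<close>

lemma row_step: "[row (i + 1) = row i + b] (mod p)"
proof -
  have "[(\<Sum>j\<in>{0..<p}. k (i + 1) (j + 1)) = row (i + 1)] (mod p)"
    unfolding row_def by (rule sum_periodic_shift[OF p_pos k_row_per])
  moreover have "[(\<Sum>j\<in>{0..<p}. k (i + 1) (j + 1)) = (\<Sum>j\<in>{0..<p}. k i j - f i + h j)] (mod p)"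
    by (intro cong_sum k_step)
  moreover have "(\<Sum>j\<in>{0..<p}. k i j - f i + h j) = row i - p * f i + (\<Sum>i\<in>{0..<p}. h i)"
    using p_pos by (simp add: sum.distrib sum_subtractf row_def)
  moreover have "[row i - p * f i + (\<Sum>i\<in>{0..<p}. h i) = row i - 0 + b] (mod p)"
    by (intro cong_add cong_diff sum_h) (auto simp: cong_0_iff)
  ultimately show ?thesis by (simp add: cong_def)
qed

lemma sum_Suc_times: "(\<Sum>j\<in>{0..<p}. (j + 1) * c) = (p * (p + 1) div 2) * c"
proof -
  have "(\<Sum>j\<in>{0..<int n}. (j + 1)) * 2 = int n * (int n + 1)" for n
  proof (induction n)
    case (Suc n)
    have "{0..<int (Suc n)} = insert (int n) {0..<int n}" by auto
    then show ?case using Suc by (simp add: algebra_simps)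
  qed simp
  from this[of "nat p"] have "(\<Sum>j\<in>{0..<p}. (j + 1)) = p * (p + 1) div 2" using p_pos by simp
  then show ?thesis by (metis sum_distrib_right)
qed

lemma row_moment_step:
  "[row_moment (i + 1) = row_moment i + row i + h_moment + b - (p * (p + 1) div 2) * f i] (mod p)"
proof -
  have "[(\<Sum>j\<in>{0..<p}. (j + 1) * k (i + 1) (j + 1)) = row_moment (i + 1)] (mod p)"
    unfolding row_moment_def by (rule sum_periodic_shift[OF p_pos periodic_mult[OF k_row_per]])
  moreover have "[(\<Sum>j\<in>{0..<p}. (j + 1) * k (i + 1) (j + 1)) = (\<Sum>j\<in>{0..<p}. (j + 1) * (k i j - f i + h j))] (mod p)"
    by (intro cong_sum cong_mult k_step cong_refl)
  moreover have "(\<Sum>j\<in>{0..<p}. (j + 1) * (k i j - f i + h j)) = 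
      row_moment i + row i + h_moment + (\<Sum>i\<in>{0..<p}. h i) - (\<Sum>j\<in>{0..<p}. (j + 1) * f i)"
    by (simp add: row_def row_moment_def h_moment_def algebra_simps sum.distrib sum_subtractf)
  moreover have "[row_moment i + row i + h_moment + (\<Sum>i\<in>{0..<p}. h i) - (\<Sum>j\<in>{0..<p}. (j + 1) * f i) = 
     row_moment i + row i + h_moment + b - (p * (p + 1) div 2) * f i] (mod p)"
    unfolding sum_Suc_times by (intro cong_add cong_diff sum_h cong_refl)
  ultimately show ?thesis by (simp add: cong_def)
qed

lemma row_eq: "[row (int n) = row 0 + int n * b] (mod p)"
proof (induction n)
  case (Suc n)
  have "[row (int n + 1) = row 0 + int n * b + b] (mod p)"
    using cong_trans[OF row_step cong_add[OF Suc cong_refl]] .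
  then show ?case by (simp add: algebra_simps)
qed simp

lemma row_uminus: "[row (- x) = row 0 - x * b] (mod p)"
proof -
  define n where "n = nat ((- x) mod p)"
  have n: "int n = (-x) mod p" using p_pos by (simp add: n_def)
  have nx: "[int n = - x] (mod p)" by (simp add: n)
  have "[row (int n) = row (- x)] (mod p)"
    unfolding row_def by (intro cong_sum k_per nx cong_refl)
  moreover have "[row 0 + int n * b = row 0 + (- x) * b] (mod p)"
    by (intro cong_add cong_mult cong_refl nx)
  ultimately show ?thesis using row_eq[of n] by (simp add: cong_def)
qed

lemma two_half: "p \<noteq> 2 \<Longrightarrow> 2 * half = p + 1"
  using p prime_odd_int[of p] prime_ge_2_int[of p] by (auto simp: half_def elim!: oddE)

lemma row_moment_odd:
  assumes "p \<noteq> 2"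
  shows "[row_moment (int n) = row_moment 0 + int n * (row 0 + b + h_moment) + half * (int n * (int n - 1)) * b] (mod p)"
proof (induction n)
  case (Suc n)
  have "[p * (p + 1) div 2 * f (int n) = 0] (mod p)"
  proof -
    have "p * (p + 1) div 2 = p * half"
      by (simp add: two_half[OF assms, symmetric])
    then show ?thesis by (simp add: cong_0_iff)
  qed
  with row_moment_step[of "int n"] have "[row_moment (int n + 1) = row_moment (int n) + row (int n) + h_moment + b - 0] (mod p)"
    by (meson cong_diff cong_refl cong_trans)
  moreover have "[row_moment (int n) + row (int n) + h_moment + b - 0 =
     (row_moment 0 + int n * (row 0 + b + h_moment) + half * (int n * (int n - 1)) * b) + (row 0 + int n * b) + h_moment + b - 0] (mod p)"
    by (intro cong_add cong_diff Suc row_eq cong_refl)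
  moreover have "(row_moment 0 + int n * (row 0 + b + h_moment) + half * (int n * (int n - 1)) * b) + (row 0 + int n * b) + h_moment + b - 0 
     = row_moment 0 + int (Suc n) * (row 0 + b + h_moment) + half * (int (Suc n) * (int (Suc n) - 1)) * b + p * (- (int n * b))"
  proof -
    have "half * (int (Suc n) * (int (Suc n) - 1)) * b = half * (int n * (int n - 1)) * b + (2 * half) * int n * b"
      by (simp add: algebra_simps)
    then show ?thesis unfolding two_half[OF assms] by (simp add: algebra_simps)
  qed
  ultimately have *: "[row_moment (int n + 1) = row_moment 0 + int (Suc n) * (row 0 + b + h_moment) + half * (int (Suc n) * (int (Suc n) - 1)) * b + p * (- (int n * b))] (mod p)"
    by (metis cong_trans)
  have "int (Suc n) = int n + 1" by simp
  then show ?case using cong_add_multiple[OF *] by (simp only:)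
qed simp

lemma row_moment_per: "[i = j] (mod p) \<Longrightarrow> [row_moment i = row_moment j] (mod p)"
  unfolding row_moment_def by (intro cong_sum cong_mult k_per cong_refl)

lemma row_moment_uminus:
  assumes "p \<noteq> 2"
  shows "[row_moment (- x) = row_moment 0 - x * (row 0 + b + h_moment) + half * (x * (x + 1)) * b] (mod p)"
proof -
  define n where "n = nat ((- x) mod p)"
  have n: "int n = (-x) mod p" using p_pos by (simp add: n_def)
  have nx: "[int n = - x] (mod p)" by (simp add: n)
  have "[row_moment (int n) = row_moment (- x)] (mod p)"
    by (rule row_moment_per[OF nx])
  moreover have "[row_moment 0 + int n * (row 0 + b + h_moment) + half * (int n * (int n - 1)) * b = 
     row_moment 0 + (- x) * (row 0 + b + h_moment) + half * ((- x) * ((- x) - 1)) * b] (mod p)"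
    by (intro cong_add cong_mult cong_refl nx cong_diff)
  ultimately have "[row_moment (- x) = row_moment 0 + (- x) * (row 0 + b + h_moment) + half * ((- x) * ((- x) - 1)) * b] (mod p)"
    using row_moment_odd[OF assms, of n] by (simp add: cong_def)
  then show ?thesis by (simp add: algebra_simps)
qed

definition massey_primitive :: int where "massey_primitive = row_moment 0 - f_moment2"
definition moment_total :: int where "moment_total = row 0 + f_moment + h_moment"

end

text \<open>
  The values at a product \<open>\<sigma>\<tau>\<close> of the Kummer cocycles involve those at \<open>\<tau>\<close>, translated by \<open>x = a(\<sigma>)\<close> and \<open>y = c(\<sigma>)\<close>.
  The following lemmas compute how the moments change under such a translation.
\<close>

locale massey_translate = massey_data +
  fixes x y :: int and f' h' :: "int \<Rightarrow> int" and k' :: "int \<Rightarrow> int \<Rightarrow> int"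
  assumes f': "[f' i = f (i - x)] (mod p)" and h': "[h' i = h (i - y)] (mod p)"
    and k': "[k' i j = k (i - x) (j - y)] (mod p)"
begin

lemmas translate = sum_weighted_translate[OF p_pos]

lemma periodic_id: "periodic p (\<lambda>i. i)"
  by (simp add: periodic_def)

lemma f_moment_translate: "[(\<Sum>i\<in>{0..<p}. i * f' i) = f_moment + x * b] (mod p)"
proof -
  note translate[OF periodic_id f_per f']
  also have "(\<Sum>i\<in>{0..<p}. (i + x) * f i) = f_moment + x * (\<Sum>i\<in>{0..<p}. f i)"
    by (simp add: f_moment_def algebra_simps sum.distrib sum_distrib_left)
  also have "[\<dots> = f_moment + x * b] (mod p)"
    by (intro cong_add cong_mult cong_refl sum_f)
  finally show ?thesis .
qed

lemma h_moment_translate: "[(\<Sum>i\<in>{0..<p}. i * h' i) = h_moment + y * b] (mod p)"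
proof -
  note translate[OF periodic_id h_per h']
  also have "(\<Sum>i\<in>{0..<p}. (i + y) * h i) = h_moment + y * (\<Sum>i\<in>{0..<p}. h i)"
    by (simp add: h_moment_def algebra_simps sum.distrib sum_distrib_left)
  also have "[\<dots> = h_moment + y * b] (mod p)"
    by (intro cong_add cong_mult cong_refl sum_h)
  finally show ?thesis .
qed

lemma k'_row: "[k' 0 j = k (- x) (j - y)] (mod p)"
  using k'[of 0 j] by simp

lemma row_translate: "[(\<Sum>j\<in>{0..<p}. k' 0 j) = row 0 - x * b] (mod p)"
proof -
  have "[(\<Sum>j\<in>{0..<p}. k' 0 j) = row (- x)] (mod p)"
    unfolding row_def
    by (rule sum_periodic_translate[OF p_pos k_row_per, where s = "-y"]) (use k'_row in simp)
  then show ?thesis using row_uminus cong_trans by blast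
qed

lemma row_moment_translate:
  "[(\<Sum>j\<in>{0..<p}. j * k' 0 j) = row_moment (- x) + y * (row 0 - x * b)] (mod p)"
proof -
  note translate[OF periodic_id k_row_per k'_row]
  also have "(\<Sum>j\<in>{0..<p}. (j + y) * k (- x) j) = row_moment (- x) + y * row (- x)"
    by (simp add: row_moment_def row_def algebra_simps sum.distrib sum_distrib_left)
  also have "[row_moment (- x) + y * row (- x) = row_moment (- x) + y * (row 0 - x * b)] (mod p)"
    by (intro cong_add cong_mult cong_refl row_uminus)
  finally show ?thesis .
qed

lemma f_moment2_translate:
  assumes "p \<noteq> 2"
  shows "[(\<Sum>i\<in>{0..<p}. half * (i * (i - 1)) * f' i) = 
     f_moment2 + x * f_moment + half * (x * (x - 1)) * b] (mod p)"
proof -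
  have "periodic p (\<lambda>i. half * (i * (i - 1)))"
    by (intro periodicI cong_mult cong_diff cong_refl)
  note translate[OF this f_per f']
  also have "(\<Sum>i\<in>{0..<p}. half * ((i + x) * (i + x - 1)) * f i) = 
     (\<Sum>i\<in>{0..<p}. half * (i * (i - 1)) * f i + (2 * half) * x * (i * f i) + half * (x * (x - 1)) * f i)"
    by (intro sum.cong refl) (simp add: algebra_simps)
  also have "\<dots> = f_moment2 + (2 * half) * x * f_moment + half * (x * (x - 1)) * (\<Sum>i\<in>{0..<p}. f i)"
    using assms by (simp add: f_moment2_def f_moment_def sum.distrib sum_distrib_left)
  also have "[\<dots> = f_moment2 + 1 * x * f_moment + half * (x * (x - 1)) * b] (mod p)"
    using sum_f two_half[OF assms] by (intro cong_add cong_mult cong_refl) (auto simp: cong_def)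
  finally show ?thesis by simp
qed

text \<open>
  Let \<open>p\<close> be odd. By \<open>row_moment_uminus\<close>, a translation of the first index by \<open>x\<close> changes the moment
  of a row by a multiple of \<open>x\<close> and a quadratic term \<open>x(x + 1)/2\<close> times \<open>b\<close>; the second moment of \<open>f\<close> is there to
  cancel the quadratic term. The expression on the right is bilinear up to \<open>xyb\<close>, which is what makes
  \<open>massey_primitive\<close> a primitive of a Massey product.
\<close>

lemma massey_primitive_translate:
  "[(\<Sum>j\<in>{0..<p}. j * k' 0 j) - (if p = 2 then 0 else \<Sum>i\<in>{0..<p}. half * (i * (i - 1)) * f' i)
     = massey_primitive - x * moment_total + y * row 0 - x * y * b] (mod p)"
proof (cases "p = 2")
  case False
  have "[(\<Sum>j\<in>{0..<p}. j * k' 0 j) = (row_moment 0 - x * (row 0 + b + h_moment) + half * (x * (x + 1)) * b) + y * (row 0 - x * b)] (mod p)"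
    by (rule cong_trans[OF row_moment_translate]) (intro cong_add cong_refl row_moment_uminus[OF False])
  from cong_diff[OF this f_moment2_translate[OF False]]
  have "[(\<Sum>j\<in>{0..<p}. j * k' 0 j) - (\<Sum>i\<in>{0..<p}. half * (i * (i - 1)) * f' i) =
     (row_moment 0 - x * (row 0 + b + h_moment) + half * (x * (x + 1)) * b) + y * (row 0 - x * b)
     - (f_moment2 + x * f_moment + half * (x * (x - 1)) * b)] (mod p)" .
  also have "(row_moment 0 - x * (row 0 + b + h_moment) + half * (x * (x + 1)) * b) + y * (row 0 - x * b)
     - (f_moment2 + x * f_moment + half * (x * (x - 1)) * b) = 
     massey_primitive - x * moment_total + y * row 0 - x * y * b + ((2 * half) * x * b - x * b)"
    by (simp add: massey_primitive_def moment_total_def algebra_simps)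
  also have "[\<dots> = massey_primitive - x * moment_total + y * row 0 - x * y * b + (1 * x * b - x * b)] (mod p)"
    using two_half[OF False] by (intro cong_add cong_diff cong_mult cong_refl) (auto simp: cong_def)
  finally show ?thesis using False by simp
next
  case True
  have I: "{0..<p} = {0, 1}" using True by auto
  have "[row_moment (- x) = row_moment 0 - x * moment_total] (mod p)"
  proof (cases "even x")
    case True
    then have "[- x = 0] (mod p)" "[x = 0] (mod p)" using \<open>p = 2\<close> by (auto simp: cong_0_iff)
    then have "[row_moment (- x) = row_moment 0] (mod p)" "[row_moment 0 - x * moment_total = row_moment 0 - 0 * moment_total] (mod p)"
      by (blast intro: row_moment_per cong_diff cong_mult cong_refl)+
    then show ?thesis by (simp add: cong_def)
  next
    case odd: False
    then have x: "[- x = 0 + 1] (mod p)" "[x = - 1] (mod p)" using \<open>p = 2\<close> 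
      by (auto simp: cong_iff_dvd_diff)
    have "[row_moment (- x) = row_moment (0 + 1)] (mod p)"
      by (rule row_moment_per[OF x(1)])
    also note row_moment_step
    also have "[row_moment 0 + row 0 + h_moment + b - p * (p + 1) div 2 * f 0
        = row_moment 0 + row 0 + h_moment + (\<Sum>i\<in>{0..<p}. f i) - p * (p + 1) div 2 * f 0] (mod p)"
      by (intro cong_diff cong_add cong_refl cong_sym[OF sum_f])
    also have "row_moment 0 + row 0 + h_moment + (\<Sum>i\<in>{0..<p}. f i) - p * (p + 1) div 2 * f 0 
        = row_moment 0 - (- 1) * moment_total + p * (- f 0)"
      unfolding moment_total_def f_moment_def I using \<open>p = 2\<close> by simp
    also have "[\<dots> = row_moment 0 - (- 1) * moment_total] (mod p)"
      by (rule cong_add_multiple[OF cong_refl])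
    also have "[row_moment 0 - (- 1) * moment_total = row_moment 0 - x * moment_total] (mod p)"
      by (intro cong_diff cong_mult cong_refl cong_sym[OF x(2)])
    finally show ?thesis .
  qed
  then have "[row_moment (- x) + y * (row 0 - x * b) = row_moment 0 - x * moment_total + y * (row 0 - x * b)] (mod p)"
    by (intro cong_add cong_refl)
  with row_moment_translate have "[(\<Sum>j\<in>{0..<p}. j * k' 0 j) = row_moment 0 - x * moment_total + y * (row 0 - x * b)] (mod p)"
    using cong_trans by blast
  moreover have "massey_primitive = row_moment 0" unfolding massey_primitive_def f_moment2_def by (simp only: True) simp
  moreover have "row_moment 0 - x * moment_total + y * (row 0 - x * b) = row_moment 0 - x * moment_total + y * row 0 - x * y * b"
    by (simp add: algebra_simps)
  ultimately show ?thesis using True by (simp add: add_diff_eq)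
qed

end

section \<open>Kummer theory without roots of unity in the base field\<close>

lemma power_int_cong:
  fixes \<xi> :: "'k::field"
  assumes "\<xi> ^ p = 1" "\<xi> \<noteq> 0" "[m = n] (mod int p)"
  shows "\<xi> powi m = \<xi> powi n"
proof -
  obtain t where t: "m = n + int p * t" using assms(3) by (metis cong_iff_lin cong_sym)
  have "\<xi> powi (int p * t) = 1"
    using assms(1) by (simp add: power_int_mult)
  then show ?thesis using assms(2) by (simp add: t power_int_add)
qed

text \<open>
  The group \<open>G\<close> may move the nontrivial root of unity \<open>\<xi>\<close>, as happens if the base field does not contain it.
\<close>

locale kummer_action = galois_action L G for L :: "'k::field set" and G :: "('k \<Rightarrow> 'k) set" +
  fixes p :: nat
  assumes p: "Factorial_Ring.prime p"
    and roots: "w \<in> L \<Longrightarrow> \<exists>v\<in>L. v ^ p = w"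
    and nontrivial_root: "\<exists>\<xi>\<in>L. \<xi> ^ p = 1 \<and> \<xi> \<noteq> 1"
begin

definition mu :: "'k set" where "mu = {\<xi> \<in> L. \<xi> ^ p = 1 \<and> \<xi> \<noteq> 1}"

lemma p_pos: "p > 0" using p by (simp add: prime_gt_0_nat)

lemma mu_L: "\<xi> \<in> mu \<Longrightarrow> \<xi> \<in> L" and mu_p: "\<xi> \<in> mu \<Longrightarrow> \<xi> ^ p = 1" by (auto simp: mu_def)

lemma mu_nonzero: "\<xi> \<in> mu \<Longrightarrow> \<xi> \<noteq> 0"
  using p_pos by (auto simp: mu_def zero_power)

lemma mu_power_int_eq_1_iff:
  assumes "\<xi> \<in> mu"
  shows "\<xi> powi m = 1 \<longleftrightarrow> int p dvd m"
proof
  assume *: "\<xi> powi m = 1"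
  show "int p dvd m"
  proof (rule ccontr)
    assume "\<not> int p dvd m"
    then have "coprime (int p) m" using p by (simp add: prime_imp_coprime)
    then obtain u v where "u * int p + v * m = 1" by (metis bezout_int coprime_iff_gcd_eq_1)
    moreover have "\<xi> powi (u * int p + v * m) = 1"
      using * mu_nonzero[OF assms] mu_p[OF assms] 
      by (simp add: power_int_add mult.commute[of u] mult.commute[of v] power_int_mult)
    ultimately show False using assms by (simp add: mu_def)
  qed
next
  assume "int p dvd m"
  then have "[m = 0] (mod int p)" by (simp add: cong_0_iff)
  then show "\<xi> powi m = 1" using power_int_cong[OF mu_p[OF assms] mu_nonzero[OF assms]] by fastforce
qed

lemma mu_power_int_eq_iff:
  assumes "\<xi> \<in> mu"
  shows "\<xi> powi m = \<xi> powi n \<longleftrightarrow> [m = n] (mod int p)"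
proof -
  have "\<xi> powi m = \<xi> powi n \<longleftrightarrow> \<xi> powi (m - n) = 1"
    using mu_nonzero[OF assms] by (simp add: power_int_diff)
  then show ?thesis using mu_power_int_eq_1_iff[OF assms] by (simp add: cong_iff_dvd_diff)
qed

lemma mu_power_int_image:
  assumes "\<xi> \<in> mu"
  shows "{u. u ^ p = 1} = (\<lambda>n. \<xi> powi n) ` {0..<int p}" "card {u :: 'k. u ^ p = 1} = p"
    "finite {u :: 'k. u ^ p = 1}"
proof -
  define P where "P = Polynomial.monom (1::'k) p + [:-1:]"
  have P: "Polynomial.poly P t = t ^ p - 1" for t by (simp add: P_def poly_monom)
  have deg: "Polynomial.degree P = p"
    unfolding P_def using p_pos by (subst degree_add_eq_left) (simp_all add: degree_monom_eq)
  then have "P \<noteq> 0" using p_pos by auto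
  then have 1: "card {t. Polynomial.poly P t = 0} \<le> p"
    using card_poly_roots_bound deg by metis
  have 2: "card ((\<lambda>n. \<xi> powi n) ` {0..<int p}) = p"
  proof (subst card_image)
    show "inj_on (\<lambda>n. \<xi> powi n) {0..<int p}"
      by (rule inj_onI) (auto simp: mu_power_int_eq_iff[OF assms] cong_def)
  qed simp
  have 3: "(\<lambda>n. \<xi> powi n) ` {0..<int p} \<subseteq> {t. Polynomial.poly P t = 0}"
    using mu_power_int_eq_1_iff[OF assms] by (auto simp: P simp flip: power_int_of_nat power_int_mult)
  have eq: "{t. Polynomial.poly P t = 0} = {u. u ^ p = 1}" by (auto simp: P)
  show fin: "finite {u :: 'k. u ^ p = 1}" unfolding eq[symmetric] using poly_roots_finite[OF \<open>P \<noteq> 0\<close>] .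
  show "{u. u ^ p = 1} = (\<lambda>n. \<xi> powi n) ` {0..<int p}"
    using card_seteq[OF _ 3] 1 2 fin unfolding eq by auto
  with 2 show "card {u :: 'k. u ^ p = 1} = p" by simp
qed

lemma card_mu: "card mu = p - 1" and finite_mu: "finite mu"
proof -
  obtain \<xi> where \<xi>: "\<xi> \<in> mu" using nontrivial_root by (auto simp: mu_def)
  have "mu = {u. u ^ p = 1} - {1}"
    using mu_power_int_image(1)[OF \<xi>] mu_L[OF \<xi>] by (auto simp: mu_def L_power_int)
  then show "card mu = p - 1" "finite mu" using mu_power_int_image(2,3)[OF \<xi>] by simp_all
qed

text \<open>
  The discrete logarithm to the base \<open>\<xi>\<close>, determined only mod \<open>p\<close>.
\<close>

definition dlog :: "'k \<Rightarrow> 'k \<Rightarrow> int" where "dlog \<xi> u = (SOME n. \<xi> powi n = u)"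

lemma power_int_dlog: "\<xi> \<in> mu \<Longrightarrow> u ^ p = 1 \<Longrightarrow> \<xi> powi dlog \<xi> u = u"
  unfolding dlog_def using mu_power_int_image(1)[of \<xi>] by (intro someI_ex[of "\<lambda>n. \<xi> powi n = u"]) force

lemma dlog_cong: "\<xi> \<in> mu \<Longrightarrow> \<xi> powi n = u \<Longrightarrow> [dlog \<xi> u = n] (mod int p)"
proof -
  assume \<xi>: "\<xi> \<in> mu" and u: "\<xi> powi n = u"
  have "u ^ p = 1" using mu_power_int_eq_1_iff[OF \<xi>, of "n * int p"] u by (simp add: power_int_mult)
  then show ?thesis using power_int_dlog[OF \<xi>] u mu_power_int_eq_iff[OF \<xi>] by metis
qed

lemma dlog_mult:
  assumes "\<xi> \<in> mu" "u ^ p = 1" "v ^ p = 1"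
  shows "[dlog \<xi> (u * v) = dlog \<xi> u + dlog \<xi> v] (mod int p)"
  using assms mu_nonzero by (intro dlog_cong) (simp_all add: power_int_add power_int_dlog)

lemma mu_act: "\<sigma> \<in> G \<Longrightarrow> \<xi> \<in> mu \<Longrightarrow> \<sigma> \<xi> \<in> mu"
  using G_inj[of \<sigma> \<xi> 1] G_power[of \<sigma> \<xi> p] by (simp add: mu_def G_in G_1 L_1)

text \<open>
  The logarithm does not notice \<open>\<sigma>\<close> if it moves the base along. This is why letting the base vary
  over all of \<open>mu\<close> yields trivial coefficients although the roots of unity are not fixed.
\<close>

lemma dlog_act:
  assumes "\<sigma> \<in> G" "\<xi> \<in> mu" "u ^ p = 1"
  shows "[dlog (\<sigma> \<xi>) (\<sigma> u) = dlog \<xi> u] (mod int p)"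
  using assms G_power_int[of \<sigma> \<xi> "dlog \<xi> u"]
  by (intro dlog_cong[OF mu_act[OF assms(1,2)]]) (simp add: mu_L power_int_dlog)

lemma mu_bij: "\<sigma> \<in> G \<Longrightarrow> bij_betw \<sigma> mu mu"
  unfolding bij_betw_def using mu_act mu_L G_inj finite_mu
  by (metis (no_types, lifting) endo_inj_surj image_subsetI inj_onI)

text \<open>
  Over a base field that contains \<open>\<xi>\<close>, the value \<open>B(\<xi>)\<close> is a \<open>p\<close>-th root of the element that corresponds to the character \<open>b\<close>.
\<close>

definition kummer_generator :: "(('k \<Rightarrow> 'k) \<Rightarrow> int) \<Rightarrow> ('k \<Rightarrow> 'k) \<Rightarrow> bool" where
  "kummer_generator b B \<longleftrightarrow> (\<forall>\<xi>\<in>mu. B \<xi> \<in> L \<and> B \<xi> \<noteq> 0) \<and>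
     (\<forall>\<sigma>\<in>G. \<forall>\<xi>\<in>mu. \<sigma> (B \<xi>) = \<sigma> \<xi> powi b \<sigma> * B (\<sigma> \<xi>))"

text \<open>
  Up to roots of unity, \<open>z\<close> is equivariant for the action of \<open>G\<close> on pairs \<open>(\<xi>, i)\<close>, with translation by \<open>\<psi>\<close> on the residue \<open>i\<close>. The
  exponents record how \<open>D\<close> trivializes \<open>\<psi> \<union> b\<close>.
\<close>

definition cup_splitting ::
  "(('k \<Rightarrow> 'k) \<Rightarrow> int) \<Rightarrow> (('k \<Rightarrow> 'k) \<Rightarrow> int) \<Rightarrow> (('k \<Rightarrow> 'k) \<Rightarrow> int) \<Rightarrow> ('k \<Rightarrow> int \<Rightarrow> 'k) \<Rightarrow> bool" where
  "cup_splitting \<psi> b D z \<longleftrightarrow> (\<forall>\<xi>\<in>mu. \<forall>i. z \<xi> i \<in> L \<and> z \<xi> i \<noteq> 0) \<and>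
     (\<forall>\<xi> i j. [i = j] (mod int p) \<longrightarrow> z \<xi> i = z \<xi> j) \<and>
     (\<forall>\<sigma>\<in>G. \<forall>\<xi>\<in>mu. \<forall>i. \<sigma> (z \<xi> (i - \<psi> \<sigma>)) = z (\<sigma> \<xi>) i / \<sigma> \<xi> powi (i * b \<sigma> + D \<sigma>))"

lemma kummer_generator_exists:
  assumes "character p b"
  obtains B where "kummer_generator b B"
proof -
  note b = characterD[OF assms]
  obtain B where B: "\<And>\<xi>. \<xi> \<in> mu \<Longrightarrow> B \<xi> \<in> L" "\<And>\<xi>. \<xi> \<in> mu \<Longrightarrow> B \<xi> \<noteq> 0"
    "\<And>\<sigma> \<xi>. \<sigma> \<in> G \<Longrightarrow> \<xi> \<in> mu \<Longrightarrow> \<sigma> \<xi> powi (- b \<sigma>) * \<sigma> (B \<xi>) = B (\<sigma> \<xi>)"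
  proof (rule hilbert90_equivariant[where A = mu and act = "\<lambda>\<sigma> \<xi>. \<sigma> \<xi>" and Y = "\<lambda>\<sigma> \<xi>. \<sigma> \<xi> powi (- b \<sigma>)"])
    show "locally_constant (\<lambda>\<sigma>. \<sigma> \<xi> powi (- b \<sigma>))" if "\<xi> \<in> mu" for \<xi>
      by (rule locally_constant_comp2[where h = "\<lambda>u n. u powi (- n)", OF locally_constant_apply[OF mu_L[OF that]] b(1)])
    show "compose L \<sigma> \<tau> \<xi> powi (- b (compose L \<sigma> \<tau>)) = \<sigma> (\<tau> \<xi>) powi (- b \<sigma>) * \<sigma> (\<tau> \<xi> powi (- b \<tau>))"
      if "\<sigma> \<in> G" "\<tau> \<in> G" "\<xi> \<in> mu" for \<sigma> \<tau> \<xi>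
    proof -
      have st: "\<sigma> (\<tau> \<xi>) \<in> mu" using that mu_act by blast
      have "[- b (compose L \<sigma> \<tau>) = - b \<sigma> + - b \<tau>] (mod int p)"
        using b(2)[OF that(1,2)] by (metis cong_minus_minus_iff minus_add_distrib)
      then have "\<sigma> (\<tau> \<xi>) powi (- b (compose L \<sigma> \<tau>)) = \<sigma> (\<tau> \<xi>) powi (- b \<sigma>) * \<sigma> (\<tau> \<xi>) powi (- b \<tau>)"
        using mu_nonzero[OF st] by (simp add: mu_power_int_eq_iff[OF st] flip: power_int_add)
      then show ?thesis using that by (simp add: compose_apply mu_L G_power_int G_in)
    qed
  qed (auto simp: mu_act mu_L mu_nonzero compose_apply L_power_int G_in)
  then have "\<sigma> (B \<xi>) = \<sigma> \<xi> powi b \<sigma> * B (\<sigma> \<xi>)" if "\<sigma> \<in> G" "\<xi> \<in> mu" for \<sigma> \<xi>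
    using B(3)[OF that] mu_nonzero[OF mu_act[OF that]] by (simp add: power_int_minus field_simps)
  with B that show ?thesis unfolding kummer_generator_def by blast
qed

text \<open>
  The exponents \<open>(i + \<psi>(\<sigma>))b(\<sigma>) + D(\<sigma>)\<close> form a 1-cocycle with values in the functions of \<open>i\<close>: they describe
  the lift of \<open>b\<close> to the affine functions on which \<open>G\<close> acts through translation by \<open>\<psi>\<close>, and the existence of
  this lift is what the vanishing of \<open>\<psi> \<union> b\<close> means. Hilbert 90 for the \<open>G\<close>-set of
  pairs \<open>(\<xi>, i)\<close> splits this cocycle over \<open>L\<close>.
\<close>

lemma cup_splitting_exists:
  assumes \<psi>_char: "character p \<psi>" and b_char: "character p b" and D_prim: "primitive_of p D (\<lambda>\<sigma> \<tau>. \<psi> \<sigma> * b \<tau>)"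
  obtains z where "cup_splitting \<psi> b D z"
proof -
  note \<psi> = characterD[OF \<psi>_char] and b = characterD[OF b_char] and D = primitive_ofD[OF D_prim]
  define A where "A = mu \<times> {0..<int p}"
  define act where "act \<sigma> x = (\<sigma> (fst x), (snd x + \<psi> \<sigma>) mod int p)" for \<sigma> :: "'k \<Rightarrow> 'k" and x
  define Y where "Y \<sigma> x = \<sigma> (fst x) powi ((snd x + \<psi> \<sigma>) * b \<sigma> + D \<sigma>)" for \<sigma> :: "'k \<Rightarrow> 'k" and x
  obtain z where z: "\<And>x. x \<in> A \<Longrightarrow> z x \<in> L" "\<And>x. x \<in> A \<Longrightarrow> z x \<noteq> 0"
    "\<And>\<sigma> x. \<sigma> \<in> G \<Longrightarrow> x \<in> A \<Longrightarrow> Y \<sigma> x * \<sigma> (z x) = z (act \<sigma> x)"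
  proof (rule hilbert90_equivariant[where A = A and act = act and Y = Y])
    show "act \<sigma> x \<in> A" if "\<sigma> \<in> G" "x \<in> A" for \<sigma> x
      using that p_pos by (auto simp: A_def act_def mu_act)
    show "act (\<lambda>x\<in>L. x) x = x" if "x \<in> A" for x
    proof -
      have "[\<psi> (\<lambda>x\<in>L. x) = 0] (mod int p)" by (rule character_identity[OF \<psi>_char])
      then have "[snd x + \<psi> (\<lambda>x\<in>L. x) = snd x + 0] (mod int p)" by (intro cong_add cong_refl)
      with that show ?thesis by (auto simp: act_def A_def mu_L cong_def)
    qed
    show "act (compose L \<sigma> \<tau>) x = act \<sigma> (act \<tau> x)" if "\<sigma> \<in> G" "\<tau> \<in> G" "x \<in> A" for \<sigma> \<tau> x
    proof -
      have "[snd x + \<psi> (compose L \<sigma> \<tau>) = snd x + (\<psi> \<sigma> + \<psi> \<tau>)] (mod int p)"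
        using \<psi>(2) that by (intro cong_add cong_refl) auto
      then show ?thesis
        using that by (auto simp: act_def A_def compose_apply mu_L cong_def mod_add_left_eq mod_add_right_eq algebra_simps)
    qed
    show "locally_constant (\<lambda>\<sigma>. Y \<sigma> x)" if "x \<in> A" for x
    proof -
      have "fst x \<in> L" using that by (auto simp: A_def mu_L)
      then have "locally_constant (\<lambda>\<sigma>. \<sigma> (fst x))" by (rule locally_constant_apply)
      moreover have "locally_constant (\<lambda>\<sigma>. (snd x + \<psi> \<sigma>) * b \<sigma> + D \<sigma>)"
        by (rule locally_constant_comp2[where h = "(+)", OF locally_constant_comp2[where h = "\<lambda>u v. (snd x + u) * v", OF \<psi>(1) b(1)] D(1)])
      ultimately show ?thesis
        unfolding Y_def by (rule locally_constant_comp2[where h = "(powi)"])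
    qed
    show "Y \<sigma> x \<in> L" "Y \<sigma> x \<noteq> 0" if "\<sigma> \<in> G" "x \<in> A" for \<sigma> x
      using that mu_act[of \<sigma> "fst x"] mu_nonzero[of "\<sigma> (fst x)"] mu_L[of "\<sigma> (fst x)"]
      by (auto simp: Y_def A_def L_power_int)
    show "Y (compose L \<sigma> \<tau>) x = Y \<sigma> (act \<tau> x) * \<sigma> (Y \<tau> x)" if "\<sigma> \<in> G" "\<tau> \<in> G" "x \<in> A" for \<sigma> \<tau> x
    proof -
      obtain \<xi> i where x: "x = (\<xi>, i)" and \<xi>: "\<xi> \<in> mu" using \<open>x \<in> A\<close> unfolding A_def by blast
      have st: "\<sigma> (\<tau> \<xi>) \<in> mu" using that \<xi> mu_act by blast
      have "[(i + \<psi> (compose L \<sigma> \<tau>)) * b (compose L \<sigma> \<tau>) + D (compose L \<sigma> \<tau>) =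
             (i + (\<psi> \<sigma> + \<psi> \<tau>)) * (b \<sigma> + b \<tau>) + (D \<sigma> + D \<tau> - \<psi> \<sigma> * b \<tau>)] (mod int p)"
        using \<psi>(2) b(2) D(2) that by (intro cong_add cong_mult cong_refl) auto
      also have "(i + (\<psi> \<sigma> + \<psi> \<tau>)) * (b \<sigma> + b \<tau>) + (D \<sigma> + D \<tau> - \<psi> \<sigma> * b \<tau>) = 
         ((i + \<psi> \<tau>) + \<psi> \<sigma>) * b \<sigma> + D \<sigma> + ((i + \<psi> \<tau>) * b \<tau> + D \<tau>)" by (simp add: algebra_simps)
      also have "[((i + \<psi> \<tau>) + \<psi> \<sigma>) * b \<sigma> + D \<sigma> + ((i + \<psi> \<tau>) * b \<tau> + D \<tau>) =
         ((i + \<psi> \<tau>) mod int p + \<psi> \<sigma>) * b \<sigma> + D \<sigma> + ((i + \<psi> \<tau>) * b \<tau> + D \<tau>)] (mod int p)"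
        by (intro cong_add cong_mult cong_refl) (simp add: cong_def)
      finally show ?thesis
        using that \<xi> mu_nonzero[OF st]
        by (simp add: x Y_def act_def compose_apply mu_L G_power_int G_in mu_power_int_eq_iff[OF st] flip: power_int_add)
    qed
  qed auto
  define z' where "z' \<xi> i = z (\<xi>, i mod int p)" for \<xi> i
  have mem: "(\<xi>, i mod int p) \<in> A" if "\<xi> \<in> mu" for \<xi> i using that p_pos by (simp add: A_def)
  have "\<sigma> (z' \<xi> (i - \<psi> \<sigma>)) = z' (\<sigma> \<xi>) i / \<sigma> \<xi> powi (i * b \<sigma> + D \<sigma>)" if "\<sigma> \<in> G" "\<xi> \<in> mu" for \<sigma> \<xi> i
  proof -
    have "[((i - \<psi> \<sigma>) mod int p + \<psi> \<sigma>) * b \<sigma> + D \<sigma> = ((i - \<psi> \<sigma>) + \<psi> \<sigma>) * b \<sigma> + D \<sigma>] (mod int p)"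
      by (intro cong_add cong_mult cong_refl) (simp add: cong_def)
    then have "Y \<sigma> (\<xi>, (i - \<psi> \<sigma>) mod int p) = \<sigma> \<xi> powi (i * b \<sigma> + D \<sigma>)"
      using mu_act[OF that] by (simp add: Y_def mu_power_int_eq_iff)
    then show ?thesis
      using z(3)[OF that(1) mem[OF that(2), of "i - \<psi> \<sigma>"]] mu_nonzero[OF mu_act[OF that]]
      by (simp add: z'_def act_def mod_add_left_eq mod_add_right_eq field_simps)
  qed
  then show ?thesis
    using z(1,2) mem by (intro that[of z']) (auto simp: cup_splitting_def z'_def cong_def)
qed

end

context galois_action
begin

text \<open>
  Used for translations by \<open>a(\<sigma>)\<close>, which takes only finitely many values.
\<close>

lemma locally_constant_dependent:
  assumes "finite N" "\<And>\<sigma>. \<sigma> \<in> G \<Longrightarrow> n \<sigma> \<in> N" "locally_constant n" "\<And>m. m \<in> N \<Longrightarrow> locally_constant (F m)"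
  shows "locally_constant (\<lambda>\<sigma>. F (n \<sigma>) \<sigma>)"
proof (rule locally_constant_cong)
  show "locally_constant (\<lambda>\<sigma>. (\<lambda>g m. g m) (\<lambda>m\<in>N. F m \<sigma>) (n \<sigma>))"
    by (rule locally_constant_comp2[OF locally_constant_family[OF assms(1,4)] assms(3)])
qed (use assms(2) in simp)

end

locale kummer_massey = kummer_action L G p
  for L :: "'k::field set" and G :: "('k \<Rightarrow> 'k) set" and p :: nat +
  fixes a c :: "('k \<Rightarrow> 'k) \<Rightarrow> int"
  assumes a_char: "character p a" and c_char: "character p c"
    and a_range: "\<sigma> \<in> G \<Longrightarrow> a \<sigma> \<in> {0..<int p}" and c_range: "\<sigma> \<in> G \<Longrightarrow> c \<sigma> \<in> {0..<int p}"
begin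

lemmas a_lc = characterD(1)[OF a_char] and c_lc = characterD(1)[OF c_char]
  and a_hom = characterD(2)[OF a_char] and c_hom = characterD(2)[OF c_char]

definition ratio :: "('k \<Rightarrow> int \<Rightarrow> int \<Rightarrow> 'k) \<Rightarrow> ('k \<Rightarrow> 'k) \<Rightarrow> 'k \<Rightarrow> int \<Rightarrow> int \<Rightarrow> 'k" where
  "ratio \<Phi> \<sigma> \<xi> i j = \<sigma> (\<Phi> \<xi> (i - a \<sigma>) (j - c \<sigma>)) / \<Phi> (\<sigma> \<xi>) i j"

text \<open>
  Families of elements indexed by a primitive root \<open>\<xi>\<close> and two residues, whose \<open>p\<close>-th power
  is equivariant: \<open>G\<close> acts on the residues through translation by \<open>a\<close> and \<open>c\<close>.
\<close>

definition kummer_family :: "('k \<Rightarrow> int \<Rightarrow> int \<Rightarrow> 'k) \<Rightarrow> bool" where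
  "kummer_family \<Phi> \<longleftrightarrow>
     (\<forall>\<xi>\<in>mu. \<forall>i j. \<Phi> \<xi> i j \<in> L \<and> \<Phi> \<xi> i j \<noteq> 0) \<and>
     (\<forall>\<xi>\<in>mu. \<forall>i j i' j'. [i = i'] (mod int p) \<longrightarrow> [j = j'] (mod int p) \<longrightarrow> \<Phi> \<xi> i j = \<Phi> \<xi> i' j') \<and>
     (\<forall>\<sigma>\<in>G. \<forall>\<xi>\<in>mu. \<forall>i j. \<sigma> (\<Phi> \<xi> (i - a \<sigma>) (j - c \<sigma>) ^ p) = \<Phi> (\<sigma> \<xi>) i j ^ p)"

text \<open>
  The Kummer cocycle, averaged over \<open>mu\<close>. The sign is the inverse of \<open>card mu = p - 1\<close> modulo \<open>p\<close>.
\<close>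

definition kummer :: "('k \<Rightarrow> int \<Rightarrow> int \<Rightarrow> 'k) \<Rightarrow> ('k \<Rightarrow> 'k) \<Rightarrow> int \<Rightarrow> int \<Rightarrow> int" where
  "kummer \<Phi> \<sigma> i j = - (\<Sum>\<xi>\<in>mu. dlog (\<sigma> \<xi>) (ratio \<Phi> \<sigma> \<xi> i j))"

lemma kummer_familyD:
  assumes "kummer_family \<Phi>" "\<xi> \<in> mu"
  shows "\<Phi> \<xi> i j \<in> L" "\<Phi> \<xi> i j \<noteq> 0"
    "[i = i'] (mod int p) \<Longrightarrow> [j = j'] (mod int p) \<Longrightarrow> \<Phi> \<xi> i j = \<Phi> \<xi> i' j'"
    "\<sigma> \<in> G \<Longrightarrow> \<sigma> (\<Phi> \<xi> (i - a \<sigma>) (j - c \<sigma>) ^ p) = \<Phi> (\<sigma> \<xi>) i j ^ p"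
  using assms unfolding kummer_family_def by blast+

lemma ratio_power: 
  assumes "kummer_family \<Phi>" "\<xi> \<in> mu" "\<sigma> \<in> G"
  shows "ratio \<Phi> \<sigma> \<xi> i j ^ p = 1"
proof -
  have "\<Phi> \<xi> (i - a \<sigma>) (j - c \<sigma>) \<in> L" "\<Phi> (\<sigma> \<xi>) i j \<noteq> 0"
    using kummer_familyD[OF assms(1)] assms(2) mu_act[OF assms(3,2)] by blast+
  then show ?thesis
    using kummer_familyD(4)[OF assms, of i j] assms(3) by (simp add: ratio_def power_divide G_power)
qed

lemma ratio_in_L:
  assumes "kummer_family \<Phi>" "\<xi> \<in> mu" "\<sigma> \<in> G"
  shows "ratio \<Phi> \<sigma> \<xi> i j \<in> L"
  using kummer_familyD(1)[OF assms(1,2)] kummer_familyD(1)[OF assms(1) mu_act[OF assms(3,2)]] assms(3)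
  by (simp add: ratio_def L_divide G_in)

lemma kummer_periodic:
  assumes "kummer_family \<Phi>" "\<sigma> \<in> G" "[i = i'] (mod int p)" "[j = j'] (mod int p)"
  shows "kummer \<Phi> \<sigma> i j = kummer \<Phi> \<sigma> i' j'"
proof -
  have "ratio \<Phi> \<sigma> \<xi> i j = ratio \<Phi> \<sigma> \<xi> i' j'" if "\<xi> \<in> mu" for \<xi>
  proof -
    have "\<Phi> \<xi> (i - a \<sigma>) (j - c \<sigma>) = \<Phi> \<xi> (i' - a \<sigma>) (j' - c \<sigma>)"
      by (rule kummer_familyD(3)[OF assms(1) that]) (intro cong_diff assms cong_refl)+
    moreover have "\<Phi> (\<sigma> \<xi>) i j = \<Phi> (\<sigma> \<xi>) i' j'"
      by (rule kummer_familyD(3)[OF assms(1) mu_act[OF assms(2) that] assms(3,4)])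
    ultimately show ?thesis by (simp add: ratio_def)
  qed
  then show ?thesis by (simp add: kummer_def cong: sum.cong)
qed

lemma kummer_compose:
  assumes \<Phi>: "kummer_family \<Phi>" and \<sigma>: "\<sigma> \<in> G" and \<tau>: "\<tau> \<in> G"
  shows "[kummer \<Phi> (compose L \<sigma> \<tau>) i j = kummer \<Phi> \<sigma> i j + kummer \<Phi> \<tau> (i - a \<sigma>) (j - c \<sigma>)] (mod int p)"
proof -
  let ?q = "\<lambda>\<xi>. ratio \<Phi> \<tau> \<xi> (i - a \<sigma>) (j - c \<sigma>)"
  have eq: "ratio \<Phi> (compose L \<sigma> \<tau>) \<xi> i j = \<sigma> (?q \<xi>) * ratio \<Phi> \<sigma> (\<tau> \<xi>) i j"
    if \<xi>: "\<xi> \<in> mu" for \<xi>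
  proof -
    have shift: "\<Phi> \<xi> (i - a (compose L \<sigma> \<tau>)) (j - c (compose L \<sigma> \<tau>)) = \<Phi> \<xi> (i - a \<sigma> - a \<tau>) (j - c \<sigma> - c \<tau>)"
    proof (rule kummer_familyD(3)[OF \<Phi> \<xi>])
      show "[i - a (compose L \<sigma> \<tau>) = i - a \<sigma> - a \<tau>] (mod int p)"
        unfolding diff_diff_eq by (intro cong_diff cong_refl a_hom \<sigma> \<tau>)
      show "[j - c (compose L \<sigma> \<tau>) = j - c \<sigma> - c \<tau>] (mod int p)"
        unfolding diff_diff_eq by (intro cong_diff cong_refl c_hom \<sigma> \<tau>)
    qed
    have "\<Phi> \<xi> (i - a \<sigma> - a \<tau>) (j - c \<sigma> - c \<tau>) \<in> L" "\<Phi> (\<tau> \<xi>) (i - a \<sigma>) (j - c \<sigma>) \<in> L"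
      "\<Phi> (\<tau> \<xi>) (i - a \<sigma>) (j - c \<sigma>) \<noteq> 0"
      using kummer_familyD(1,2)[OF \<Phi>] \<xi> mu_act[OF \<tau> \<xi>] by blast+
    then show ?thesis
      using \<sigma> \<tau> \<xi> by (simp add: ratio_def shift compose_apply mu_L G_divide G_in G_eq_0_iff)
  qed
  have "[(\<Sum>\<xi>\<in>mu. dlog (compose L \<sigma> \<tau> \<xi>) (ratio \<Phi> (compose L \<sigma> \<tau>) \<xi> i j)) =
     (\<Sum>\<xi>\<in>mu. dlog (\<tau> \<xi>) (?q \<xi>) + dlog (\<sigma> (\<tau> \<xi>)) (ratio \<Phi> \<sigma> (\<tau> \<xi>) i j))] (mod int p)"
  proof (rule cong_sum)
    fix \<xi> assume \<xi>: "\<xi> \<in> mu"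
    have t: "\<tau> \<xi> \<in> mu" by (rule mu_act[OF \<tau> \<xi>])
    have st: "\<sigma> (\<tau> \<xi>) \<in> mu" by (rule mu_act[OF \<sigma> t])
    have r: "?q \<xi> ^ p = 1" "?q \<xi> \<in> L"
      using ratio_power[OF \<Phi> \<xi> \<tau>] ratio_in_L[OF \<Phi> \<xi> \<tau>] by auto
    have 1: "[dlog (\<sigma> (\<tau> \<xi>)) (\<sigma> (?q \<xi>) * ratio \<Phi> \<sigma> (\<tau> \<xi>) i j) = 
       dlog (\<sigma> (\<tau> \<xi>)) (\<sigma> (?q \<xi>)) + dlog (\<sigma> (\<tau> \<xi>)) (ratio \<Phi> \<sigma> (\<tau> \<xi>) i j)] (mod int p)"
      using r ratio_power[OF \<Phi> t \<sigma>] \<sigma> G_power[OF \<sigma> r(2), of p] by (intro dlog_mult st) (simp_all add: G_1)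
    have 2: "[dlog (\<sigma> (\<tau> \<xi>)) (\<sigma> (?q \<xi>)) = dlog (\<tau> \<xi>) (?q \<xi>)] (mod int p)"
      by (rule dlog_act[OF \<sigma> t r(1)])
    show "[dlog (compose L \<sigma> \<tau> \<xi>) (ratio \<Phi> (compose L \<sigma> \<tau>) \<xi> i j) = 
      dlog (\<tau> \<xi>) (?q \<xi>) + dlog (\<sigma> (\<tau> \<xi>)) (ratio \<Phi> \<sigma> (\<tau> \<xi>) i j)] (mod int p)"
      unfolding eq[OF \<xi>] compose_apply[OF mu_L[OF \<xi>]] by (rule cong_trans[OF 1 cong_add[OF 2 cong_refl]])
  qed
  also have "(\<Sum>\<xi>\<in>mu. dlog (\<tau> \<xi>) (?q \<xi>) + dlog (\<sigma> (\<tau> \<xi>)) (ratio \<Phi> \<sigma> (\<tau> \<xi>) i j)) =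
      (\<Sum>\<xi>\<in>mu. dlog (\<sigma> \<xi>) (ratio \<Phi> \<sigma> \<xi> i j)) + (\<Sum>\<xi>\<in>mu. dlog (\<tau> \<xi>) (?q \<xi>))"
    unfolding sum.distrib using sum.reindex_bij_betw[OF mu_bij[OF \<tau>], of "\<lambda>\<xi>. dlog (\<sigma> \<xi>) (ratio \<Phi> \<sigma> \<xi> i j)"] by simp
  finally have "[- (\<Sum>\<xi>\<in>mu. dlog (compose L \<sigma> \<tau> \<xi>) (ratio \<Phi> (compose L \<sigma> \<tau>) \<xi> i j)) = 
      - ((\<Sum>\<xi>\<in>mu. dlog (\<sigma> \<xi>) (ratio \<Phi> \<sigma> \<xi> i j)) + (\<Sum>\<xi>\<in>mu. dlog (\<tau> \<xi>) (?q \<xi>)))] (mod int p)"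
    by (simp only: cong_minus_minus_iff)
  then show ?thesis by (simp add: kummer_def)
qed

lemma kummer_family_mult:
  assumes "kummer_family \<Phi>" "kummer_family \<Psi>"
  shows "kummer_family (\<lambda>\<xi> i j. \<Phi> \<xi> i j * \<Psi> \<xi> i j)"
  unfolding kummer_family_def
proof (intro conjI ballI allI impI)
  fix \<xi> i j assume \<xi>: "\<xi> \<in> mu"
  note \<Phi> = kummer_familyD[OF assms(1) \<xi>] and \<Psi> = kummer_familyD[OF assms(2) \<xi>]
  show "\<Phi> \<xi> i j * \<Psi> \<xi> i j \<in> L" "\<Phi> \<xi> i j * \<Psi> \<xi> i j \<noteq> 0" using \<Phi>(1,2) \<Psi>(1,2) by (simp_all add: L_mult)
  show "\<Phi> \<xi> i j * \<Psi> \<xi> i j = \<Phi> \<xi> i' j' * \<Psi> \<xi> i' j'" if "[i = i'] (mod int p)" "[j = j'] (mod int p)" for i' j'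
    using \<Phi>(3)[OF that] \<Psi>(3)[OF that] by simp
next
  fix \<sigma> \<xi> i j assume \<sigma>: "\<sigma> \<in> G" and \<xi>: "\<xi> \<in> mu"
  note \<Phi> = kummer_familyD[OF assms(1) \<xi>] and \<Psi> = kummer_familyD[OF assms(2) \<xi>]
  show "\<sigma> ((\<Phi> \<xi> (i - a \<sigma>) (j - c \<sigma>) * \<Psi> \<xi> (i - a \<sigma>) (j - c \<sigma>)) ^ p) = (\<Phi> (\<sigma> \<xi>) i j * \<Psi> (\<sigma> \<xi>) i j) ^ p"
    unfolding power_mult_distrib using \<Phi>(4)[OF \<sigma>] \<Psi>(4)[OF \<sigma>] \<Phi>(1) \<Psi>(1) \<sigma> by (simp add: G_mult L_power)
qed

lemma kummer_family_shift:
  assumes "kummer_family \<Phi>"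
  shows "kummer_family (\<lambda>\<xi> i j. \<Phi> \<xi> (i + s) (j + t))"
  unfolding kummer_family_def
proof (intro conjI ballI allI impI)
  fix \<xi> i j assume \<xi>: "\<xi> \<in> mu"
  note \<Phi> = kummer_familyD[OF assms(1) \<xi>]
  show "\<Phi> \<xi> (i + s) (j + t) \<in> L" "\<Phi> \<xi> (i + s) (j + t) \<noteq> 0" using \<Phi>(1,2) by simp_all
  show "\<Phi> \<xi> (i + s) (j + t) = \<Phi> \<xi> (i' + s) (j' + t)" if "[i = i'] (mod int p)" "[j = j'] (mod int p)" for i' j'
    by (rule \<Phi>(3)) (intro cong_add that cong_refl)+
next
  fix \<sigma> \<xi> i j assume \<sigma>: "\<sigma> \<in> G" and \<xi>: "\<xi> \<in> mu"
  show "\<sigma> (\<Phi> \<xi> (i - a \<sigma> + s) (j - c \<sigma> + t) ^ p) = \<Phi> (\<sigma> \<xi>) (i + s) (j + t) ^ p"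
    using kummer_familyD(4)[OF assms \<xi> \<sigma>, of "i + s" "j + t"] by (simp add: algebra_simps)
qed

lemma kummer_mult:
  assumes "kummer_family \<Phi>" "kummer_family \<Psi>" "\<sigma> \<in> G"
  shows "[kummer (\<lambda>\<xi> i j. \<Phi> \<xi> i j * \<Psi> \<xi> i j) \<sigma> i j = kummer \<Phi> \<sigma> i j + kummer \<Psi> \<sigma> i j] (mod int p)"
proof -
  have "[(\<Sum>\<xi>\<in>mu. dlog (\<sigma> \<xi>) (ratio (\<lambda>\<xi> i j. \<Phi> \<xi> i j * \<Psi> \<xi> i j) \<sigma> \<xi> i j)) = 
     (\<Sum>\<xi>\<in>mu. dlog (\<sigma> \<xi>) (ratio \<Phi> \<sigma> \<xi> i j) + dlog (\<sigma> \<xi>) (ratio \<Psi> \<sigma> \<xi> i j))] (mod int p)"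
  proof (rule cong_sum)
    fix \<xi> assume \<xi>: "\<xi> \<in> mu"
    have "ratio (\<lambda>\<xi> i j. \<Phi> \<xi> i j * \<Psi> \<xi> i j) \<sigma> \<xi> i j = ratio \<Phi> \<sigma> \<xi> i j * ratio \<Psi> \<sigma> \<xi> i j"
      using kummer_familyD(1)[OF assms(1) \<xi>] kummer_familyD(1)[OF assms(2) \<xi>] assms(3)
      by (simp add: ratio_def G_mult)
    then show "[dlog (\<sigma> \<xi>) (ratio (\<lambda>\<xi> i j. \<Phi> \<xi> i j * \<Psi> \<xi> i j) \<sigma> \<xi> i j) = 
      dlog (\<sigma> \<xi>) (ratio \<Phi> \<sigma> \<xi> i j) + dlog (\<sigma> \<xi>) (ratio \<Psi> \<sigma> \<xi> i j)] (mod int p)"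
      using dlog_mult[OF mu_act[OF assms(3) \<xi>] ratio_power[OF assms(1) \<xi> assms(3)] ratio_power[OF assms(2) \<xi> assms(3)]]
      by simp
  qed
  then have "[- (\<Sum>\<xi>\<in>mu. dlog (\<sigma> \<xi>) (ratio (\<lambda>\<xi> i j. \<Phi> \<xi> i j * \<Psi> \<xi> i j) \<sigma> \<xi> i j)) = 
     - (\<Sum>\<xi>\<in>mu. dlog (\<sigma> \<xi>) (ratio \<Phi> \<sigma> \<xi> i j) + dlog (\<sigma> \<xi>) (ratio \<Psi> \<sigma> \<xi> i j))] (mod int p)"
    by (simp only: cong_minus_minus_iff)
  then show ?thesis by (simp add: kummer_def sum.distrib)
qed

lemma kummer_shift: "kummer (\<lambda>\<xi> i j. \<Phi> \<xi> (i + s) (j + t)) \<sigma> i j = kummer \<Phi> \<sigma> (i + s) (j + t)"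
  by (simp add: kummer_def ratio_def algebra_simps)

text \<open>
  Stated with arbitrary directions \<open>s\<close>, \<open>t\<close> so that it covers the norms along both coordinates.
\<close>

lemma kummer_prod_shift:
  assumes \<Phi>: "kummer_family \<Phi>" and \<sigma>: "\<sigma> \<in> G"
  shows "kummer_family (\<lambda>\<xi> i j. \<Prod>l\<in>{0..int n}. \<Phi> \<xi> (i + s * l) (j + t * l)) \<and>
    [kummer (\<lambda>\<xi> i j. \<Prod>l\<in>{0..int n}. \<Phi> \<xi> (i + s * l) (j + t * l)) \<sigma> i j
      = (\<Sum>l\<in>{0..int n}. kummer \<Phi> \<sigma> (i + s * l) (j + t * l))] (mod int p)"
proof (induction n)
  case 0
  show ?case using \<Phi> by simp
next
  case (Suc n)
  have I: "{0..int (Suc n)} = insert (int (Suc n)) {0..int n}" by auto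
  let ?\<Psi> = "\<lambda>\<xi> i j. \<Phi> \<xi> (i + s * int (Suc n)) (j + t * int (Suc n))"
  let ?P = "\<lambda>\<xi> i j. \<Prod>l\<in>{0..int n}. \<Phi> \<xi> (i + s * l) (j + t * l)"
  have \<Psi>: "kummer_family ?\<Psi>" by (rule kummer_family_shift[OF \<Phi>])
  have eq: "(\<lambda>\<xi> i j. \<Prod>l\<in>{0..int (Suc n)}. \<Phi> \<xi> (i + s * l) (j + t * l)) = (\<lambda>\<xi> i j. ?\<Psi> \<xi> i j * ?P \<xi> i j)"
    unfolding I by simp
  have "[kummer (\<lambda>\<xi> i j. ?\<Psi> \<xi> i j * ?P \<xi> i j) \<sigma> i j = kummer ?\<Psi> \<sigma> i j + kummer ?P \<sigma> i j] (mod int p)"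
    using kummer_mult[OF \<Psi> _ \<sigma>] Suc by blast
  also have "[kummer ?\<Psi> \<sigma> i j + kummer ?P \<sigma> i j = kummer ?\<Psi> \<sigma> i j + (\<Sum>l\<in>{0..int n}. kummer \<Phi> \<sigma> (i + s * l) (j + t * l))] (mod int p)"
    using Suc by (intro cong_add cong_refl) blast
  also have "kummer ?\<Psi> \<sigma> i j + (\<Sum>l\<in>{0..int n}. kummer \<Phi> \<sigma> (i + s * l) (j + t * l)) = (\<Sum>l\<in>{0..int (Suc n)}. kummer \<Phi> \<sigma> (i + s * l) (j + t * l))"
    unfolding I kummer_shift by simp
  finally show ?case unfolding eq using kummer_family_mult[OF \<Psi>] Suc by blast
qed

lemma kummer_locally_constant:
  assumes \<Phi>: "kummer_family \<Phi>"
  shows "locally_constant (\<lambda>\<sigma>. kummer \<Phi> \<sigma> i j)"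
  unfolding kummer_def
proof (rule locally_constant_comp[where h = uminus], rule locally_constant_sum)
  fix \<xi> assume \<xi>: "\<xi> \<in> mu"
  have ac: "locally_constant (\<lambda>\<sigma>. (a \<sigma>, c \<sigma>))" by (rule locally_constant_comp2[OF a_lc c_lc])
  have lc: "locally_constant (\<lambda>\<sigma>. (\<lambda>m \<sigma>. \<sigma> (\<Phi> \<xi> (i - fst m) (j - snd m))) (a \<sigma>, c \<sigma>) \<sigma>)"
  proof (rule locally_constant_dependent[OF _ _ ac])
    show "finite ({0..<int p} \<times> {0..<int p})" by simp
    show "(a \<sigma>, c \<sigma>) \<in> {0..<int p} \<times> {0..<int p}" if "\<sigma> \<in> G" for \<sigma> using a_range[OF that] c_range[OF that] by blast
    show "locally_constant (\<lambda>\<sigma>. \<sigma> (\<Phi> \<xi> (i - fst m) (j - snd m)))" for m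
      by (rule locally_constant_apply[OF kummer_familyD(1)[OF \<Phi> \<xi>]])
  qed
  have "locally_constant (\<lambda>\<sigma>. dlog (\<sigma> \<xi>) (\<sigma> (\<Phi> \<xi> (i - a \<sigma>) (j - c \<sigma>)) / \<Phi> (\<sigma> \<xi>) i j))"
    by (rule locally_constant_comp2[where h = "\<lambda>u v. dlog u (v / \<Phi> u i j)", OF locally_constant_apply[OF mu_L[OF \<xi>]] lc[simplified]])
  then show "locally_constant (\<lambda>\<sigma>. dlog (\<sigma> \<xi>) (ratio \<Phi> \<sigma> \<xi> i j))" by (simp add: ratio_def)
qed

text \<open>
  For a Kummer generator each summand of the average is \<open>b\<close>, so that the average is again \<open>b\<close>.
\<close>

lemma kummer_constant:
  assumes B: "\<And>\<xi>. \<xi> \<in> mu \<Longrightarrow> B \<xi> \<in> L" "\<And>\<xi>. \<xi> \<in> mu \<Longrightarrow> B \<xi> \<noteq> 0"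
    "\<And>\<xi>. \<xi> \<in> mu \<Longrightarrow> \<sigma> (B \<xi>) = \<sigma> \<xi> powi b * B (\<sigma> \<xi>)" and \<sigma>: "\<sigma> \<in> G"
  shows "[kummer (\<lambda>\<xi> i j. B \<xi>) \<sigma> i j = b] (mod int p)"
proof -
  have "[(\<Sum>\<xi>\<in>mu. dlog (\<sigma> \<xi>) (ratio (\<lambda>\<xi> i j. B \<xi>) \<sigma> \<xi> i j)) = (\<Sum>\<xi>\<in>mu. b)] (mod int p)"
  proof (rule cong_sum)
    fix \<xi> assume \<xi>: "\<xi> \<in> mu"
    show "[dlog (\<sigma> \<xi>) (ratio (\<lambda>\<xi> i j. B \<xi>) \<sigma> \<xi> i j) = b] (mod int p)"
      using B(3)[OF \<xi>] B(2)[OF mu_act[OF \<sigma> \<xi>]] by (intro dlog_cong mu_act[OF \<sigma> \<xi>]) (simp add: ratio_def)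
  qed
  also have "(\<Sum>\<xi>\<in>mu. b) = - b + int p * b"
    using p_pos by (simp add: card_mu of_nat_diff algebra_simps)
  finally have "[(\<Sum>\<xi>\<in>mu. dlog (\<sigma> \<xi>) (ratio (\<lambda>\<xi> i j. B \<xi>) \<sigma> \<xi> i j)) = - b] (mod int p)"
    by (rule cong_add_multiple)
  then have "[- (\<Sum>\<xi>\<in>mu. dlog (\<sigma> \<xi>) (ratio (\<lambda>\<xi> i j. B \<xi>) \<sigma> \<xi> i j)) = - (- b)] (mod int p)"
    by (simp only: cong_minus_minus_iff)
  then show ?thesis by (simp add: kummer_def)
qed

end

text \<open>
  If \<open>g\<close> is periodic with period \<open>n + 1\<close>, then the norm of \<open>g(i + 1)/g(i)\<close> is therefore 1.
\<close>

lemma prod_telescope_int: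
  fixes g :: "int \<Rightarrow> 'k::field"
  assumes "\<And>i. g i \<noteq> 0"
  shows "(\<Prod>l\<in>{0..int n}. g (l + 1) / g l) = g (int n + 1) / g 0"
proof (induction n)
  case (Suc n)
  have I: "{0..int (Suc n)} = insert (int (Suc n)) {0..int n}" by auto
  show ?case unfolding I using assms by (simp add: Suc add.commute)
qed simp

context kummer_massey
begin

definition pth_root :: "'k \<Rightarrow> 'k" where "pth_root w = (SOME v. v \<in> L \<and> v ^ p = w)"

lemma pth_root: "w \<in> L \<Longrightarrow> pth_root w \<in> L" "w \<in> L \<Longrightarrow> pth_root w ^ p = w"
  using roots[of w] unfolding pth_root_def by (metis (mono_tags, lifting) someI_ex)+

lemma pth_root_nonzero: "w \<in> L \<Longrightarrow> w \<noteq> 0 \<Longrightarrow> pth_root w \<noteq> 0"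
  using pth_root(2)[of w] p_pos by (auto simp: zero_power)

lemma kummer_cong:
  assumes "\<And>\<xi> i j. \<xi> \<in> mu \<Longrightarrow> \<Phi> \<xi> i j = \<Psi> \<xi> i j" "\<sigma> \<in> G"
  shows "kummer \<Phi> \<sigma> i j = kummer \<Psi> \<sigma> i j"
  unfolding kummer_def ratio_def using assms mu_act by (simp cong: sum.cong)

lemma kummer_familyI:
  assumes "\<And>\<xi> i j. \<xi> \<in> mu \<Longrightarrow> \<Phi> \<xi> i j \<in> L" "\<And>\<xi> i j. \<xi> \<in> mu \<Longrightarrow> \<Phi> \<xi> i j \<noteq> 0"
    "\<And>\<xi> i j i' j'. \<xi> \<in> mu \<Longrightarrow> [i = i'] (mod int p) \<Longrightarrow> [j = j'] (mod int p) \<Longrightarrow> \<Phi> \<xi> i j = \<Phi> \<xi> i' j'"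
    "\<And>\<xi> i j. \<xi> \<in> mu \<Longrightarrow> \<Phi> \<xi> i j ^ p = \<Psi> \<xi> i j"
    "\<And>\<sigma> \<xi> i j. \<sigma> \<in> G \<Longrightarrow> \<xi> \<in> mu \<Longrightarrow> \<sigma> (\<Psi> \<xi> (i - a \<sigma>) (j - c \<sigma>)) = \<Psi> (\<sigma> \<xi>) i j"
  shows "kummer_family \<Phi>"
  unfolding kummer_family_def
proof (intro conjI ballI allI impI)
  show "\<sigma> (\<Phi> \<xi> (i - a \<sigma>) (j - c \<sigma>) ^ p) = \<Phi> (\<sigma> \<xi>) i j ^ p" if "\<sigma> \<in> G" "\<xi> \<in> mu" for \<sigma> \<xi> i j
    unfolding assms(4)[OF that(2)] assms(4)[OF mu_act[OF that]] by (rule assms(5)[OF that])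
qed (use assms(1-3) in blast)+

text \<open>
  The \<open>p\<close>-th power of this element is \<open>\<alpha>\<close> or \<open>\<gamma>\<close>, for the two choices of \<open>z\<close>. Choosing roots of \<open>B\<close> and \<open>z\<close> rather than
  of the quotient ensures that the norm is exactly \<open>B\<close>, with no root of unity left over.
\<close>

definition norm_element :: "('k \<Rightarrow> 'k) \<Rightarrow> ('k \<Rightarrow> int \<Rightarrow> 'k) \<Rightarrow> 'k \<Rightarrow> int \<Rightarrow> 'k" where
  "norm_element B z \<xi> n = pth_root (B \<xi>) * (pth_root (z \<xi> (n + 1)) / pth_root (z \<xi> n))"

text \<open>
  The linear form \<open>u i + v j\<close> is one of the two coordinates (up to sign), and \<open>\<psi>\<close> is \<open>a\<close> or \<open>c\<close> accordingly.
\<close>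

lemma norm_element_family:
  assumes B: "kummer_generator b B" and z: "cup_splitting \<psi> b D z"
    and \<psi>: "\<And>\<sigma>. \<psi> \<sigma> = u * a \<sigma> + v * c \<sigma>" and uv: "u * u + v * v = 1"
  defines "F \<equiv> \<lambda>\<xi> i j. norm_element B z \<xi> (u * i + v * j)"
  shows "kummer_family F"
    and "\<sigma> \<in> G \<Longrightarrow> [(\<Sum>l\<in>{0..<int p}. kummer F \<sigma> (u * l) (v * l)) = b \<sigma>] (mod int p)"
proof -
  have BL: "B \<xi> \<in> L" "B \<xi> \<noteq> 0" if "\<xi> \<in> mu" for \<xi> using B that unfolding kummer_generator_def by blast+
  have B_act: "\<sigma> (B \<xi>) = \<sigma> \<xi> powi b \<sigma> * B (\<sigma> \<xi>)" if "\<sigma> \<in> G" "\<xi> \<in> mu" for \<sigma> \<xi>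
    using B that unfolding kummer_generator_def by blast
  have zL: "z \<xi> i \<in> L" "z \<xi> i \<noteq> 0" if "\<xi> \<in> mu" for \<xi> i using z that unfolding cup_splitting_def by blast+
  have z_per: "z \<xi> i = z \<xi> j" if "[i = j] (mod int p)" for \<xi> i j using z that unfolding cup_splitting_def by blast
  have z_act: "\<sigma> (z \<xi> (i - \<psi> \<sigma>)) = z (\<sigma> \<xi>) i / \<sigma> \<xi> powi (i * b \<sigma> + D \<sigma>)" if "\<sigma> \<in> G" "\<xi> \<in> mu" for \<sigma> \<xi> i
    using z that unfolding cup_splitting_def by blast
  note roots = pth_root(1)[OF BL(1)] pth_root(1)[OF zL(1)] pth_root(2)[OF BL(1)] pth_root(2)[OF zL(1)]
    pth_root_nonzero[OF BL] pth_root_nonzero[OF zL]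
  show F: "kummer_family F"
  proof (rule kummer_familyI[where \<Psi> = "\<lambda>\<xi> i j. B \<xi> * (z \<xi> (u * i + v * j + 1) / z \<xi> (u * i + v * j))"])
    show "F \<xi> i j = F \<xi> i' j'" if "[i = i'] (mod int p)" "[j = j'] (mod int p)" for \<xi> i j i' j'
    proof -
      have ij: "[u * i + v * j = u * i' + v * j'] (mod int p)" by (intro cong_add cong_mult cong_refl that)
      show ?thesis using z_per[OF ij] z_per[OF cong_add[OF ij cong_refl], of \<xi> 1] by (simp add: F_def norm_element_def)
    qed
    show "\<sigma> (B \<xi> * (z \<xi> (u * (i - a \<sigma>) + v * (j - c \<sigma>) + 1) / z \<xi> (u * (i - a \<sigma>) + v * (j - c \<sigma>)))) =
        B (\<sigma> \<xi>) * (z (\<sigma> \<xi>) (u * i + v * j + 1) / z (\<sigma> \<xi>) (u * i + v * j))"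
      if "\<sigma> \<in> G" "\<xi> \<in> mu" for \<sigma> \<xi> i j
    proof -
      define n where "n = u * i + v * j"
      have n: "u * (i - a \<sigma>) + v * (j - c \<sigma>) = n - \<psi> \<sigma>" "n - \<psi> \<sigma> + 1 = (n + 1) - \<psi> \<sigma>"
        by (simp_all add: n_def \<psi> algebra_simps)
      have nz: "\<sigma> \<xi> \<noteq> 0" by (rule mu_nonzero[OF mu_act[OF that]])
      have pw: "\<sigma> \<xi> powi ((n + 1) * b \<sigma> + D \<sigma>) = \<sigma> \<xi> powi b \<sigma> * \<sigma> \<xi> powi (n * b \<sigma> + D \<sigma>)"
        using nz by (simp add: algebra_simps flip: power_int_add)
      have "\<sigma> (B \<xi> * (z \<xi> (n + 1 - \<psi> \<sigma>) / z \<xi> (n - \<psi> \<sigma>))) = \<sigma> (B \<xi>) * (\<sigma> (z \<xi> (n + 1 - \<psi> \<sigma>)) / \<sigma> (z \<xi> (n - \<psi> \<sigma>)))"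
        using that BL zL by (simp add: G_mult G_divide L_divide L_mult)
      also have "\<dots> = B (\<sigma> \<xi>) * (z (\<sigma> \<xi>) (n + 1) / z (\<sigma> \<xi>) n)"
        unfolding z_act[OF that] B_act[OF that] pw using nz by simp
      finally show ?thesis unfolding n unfolding n_def .
    qed
  qed (simp_all add: F_def norm_element_def roots L_mult L_divide power_mult_distrib power_divide)
  assume \<sigma>: "\<sigma> \<in> G"
  have p1: "int (p - 1) + 1 = int p" and I: "{0..int (p - 1)} = {0..<int p}" using p_pos by auto
  have norm: "(\<Prod>l\<in>{0..int (p - 1)}. F \<xi> (i + u * l) (j + v * l)) = B \<xi>" if \<xi>: "\<xi> \<in> mu" for \<xi> i j
  proof -
    define n where "n = u * i + v * j"
    have n: "u * (i + u * l) + v * (j + v * l) = n + l" for l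
    proof -
      have "u * (i + u * l) + v * (j + v * l) = n + (u * u + v * v) * l" by (simp add: n_def algebra_simps)
      then show ?thesis by (simp add: uv)
    qed
    have "(\<Prod>l\<in>{0..int (p - 1)}. pth_root (z \<xi> (n + l + 1)) / pth_root (z \<xi> (n + l))) =
        pth_root (z \<xi> (n + (int (p - 1) + 1))) / pth_root (z \<xi> (n + 0))"
      using prod_telescope_int[of "\<lambda>l. pth_root (z \<xi> (n + l))" "p - 1"] roots \<xi> by (simp add: add.assoc)
    also have "z \<xi> (n + (int (p - 1) + 1)) = z \<xi> (n + 0)"
      unfolding p1 by (rule z_per) (simp add: cong_def)
    finally show ?thesis
      using \<xi> p_pos roots by (simp only: F_def norm_element_def n prod.distrib) (simp add: of_nat_diff)
  qed
  have "[kummer (\<lambda>\<xi> i j. \<Prod>l\<in>{0..int (p - 1)}. F \<xi> (i + u * l) (j + v * l)) \<sigma> 0 0 =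
      (\<Sum>l\<in>{0..int (p - 1)}. kummer F \<sigma> (0 + u * l) (0 + v * l))] (mod int p)"
    using kummer_prod_shift[OF F \<sigma>] by blast
  moreover have "kummer (\<lambda>\<xi> i j. \<Prod>l\<in>{0..int (p - 1)}. F \<xi> (i + u * l) (j + v * l)) \<sigma> 0 0 = kummer (\<lambda>\<xi> i j. B \<xi>) \<sigma> 0 0"
    by (rule kummer_cong[OF norm \<sigma>])
  moreover have "[kummer (\<lambda>\<xi> i j. B \<xi>) \<sigma> 0 0 = b \<sigma>] (mod int p)"
    by (rule kummer_constant[OF BL B_act[OF \<sigma>] \<sigma>])
  ultimately show "[(\<Sum>l\<in>{0..<int p}. kummer F \<sigma> (u * l) (v * l)) = b \<sigma>] (mod int p)"
    unfolding I by (simp add: cong_def)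
qed

text \<open>
  The given cochains \<open>D12\<close> and \<open>D23\<close> serve only to find the functions \<open>z\<close>; the defining system \<open>r\<close>, \<open>t\<close> with
  vanishing value is read off from the moments of the Kummer cocycles.
\<close>

theorem massey_vanishes_kummer:
  fixes b D12 D23 :: "('k \<Rightarrow> 'k) \<Rightarrow> int"
  assumes b: "character p b"
    and D12: "primitive_of p D12 (\<lambda>\<sigma> \<tau>. a \<sigma> * b \<tau>)" and D23: "primitive_of p D23 (\<lambda>\<sigma> \<tau>. b \<sigma> * c \<tau>)"
  obtains r t K where "primitive_of p r (\<lambda>\<sigma> \<tau>. a \<sigma> * b \<tau>)" "primitive_of p t (\<lambda>\<sigma> \<tau>. b \<sigma> * c \<tau>)"
    "primitive_of p K (\<lambda>\<sigma> \<tau>. a \<sigma> * t \<tau> + r \<sigma> * c \<tau>)"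
proof -
  note b_lc = characterD(1)[OF b] and b_hom = characterD(2)[OF b]
  \<comment> \<open>A primitive of \<open>c \<union> b\<close>, since \<open>- b c\<close> is one of \<open>b \<union> c + c \<union> b\<close>.\<close>
  define D32 where "D32 \<sigma> = - (b \<sigma> * c \<sigma>) - D23 \<sigma>" for \<sigma>
  have D32: "primitive_of p D32 (\<lambda>\<sigma> \<tau>. c \<sigma> * b \<tau>)"
    unfolding primitive_of_def
  proof (intro conjI ballI)
    show "locally_constant D32"
      unfolding D32_def by (rule locally_constant_comp2[where h = "\<lambda>u v. - u - v", 
          OF locally_constant_comp2[where h = "(*)", OF b_lc c_lc] primitive_ofD(1)[OF D23]])
    fix \<sigma> \<tau> assume st: "\<sigma> \<in> G" "\<tau> \<in> G"
    have "[D32 (compose L \<sigma> \<tau>) = - ((b \<sigma> + b \<tau>) * (c \<sigma> + c \<tau>)) - (D23 \<sigma> + D23 \<tau> - b \<sigma> * c \<tau>)] (mod int p)"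
      unfolding D32_def using st
      by (intro cong_diff cong_mult primitive_ofD(2)[OF D23] cong_minus_minus_iff[THEN iffD2] b_hom c_hom)
    also have "- ((b \<sigma> + b \<tau>) * (c \<sigma> + c \<tau>)) - (D23 \<sigma> + D23 \<tau> - b \<sigma> * c \<tau>) = D32 \<sigma> + D32 \<tau> - c \<sigma> * b \<tau>"
      by (simp add: D32_def algebra_simps)
    finally show "[D32 (compose L \<sigma> \<tau>) = D32 \<sigma> + D32 \<tau> - c \<sigma> * b \<tau>] (mod int p)" .
  qed
  \<comment> \<open>The difference of the primitives for \<open>a \<union> b\<close> and \<open>c \<union> b\<close> splits \<open>(a - c) \<union> b\<close>.\<close>
  define m where "m \<sigma> = a \<sigma> - c \<sigma>" for \<sigma>
  define D where "D \<sigma> = D12 \<sigma> - D32 \<sigma>" for \<sigma>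
  have m: "character p m"
    unfolding character_def
  proof (intro conjI ballI)
    show "locally_constant m" unfolding m_def by (rule locally_constant_comp2[OF a_lc c_lc])
    show "[m (compose L \<sigma> \<tau>) = m \<sigma> + m \<tau>] (mod int p)" if "\<sigma> \<in> G" "\<tau> \<in> G" for \<sigma> \<tau>
      using cong_diff[OF a_hom[OF that] c_hom[OF that]] by (simp add: m_def algebra_simps)
  qed
  have D: "primitive_of p D (\<lambda>\<sigma> \<tau>. m \<sigma> * b \<tau>)"
    unfolding primitive_of_def
  proof (intro conjI ballI)
    show "locally_constant D"
      unfolding D_def by (rule locally_constant_comp2[OF primitive_ofD(1)[OF D12] primitive_ofD(1)[OF D32]])
    show "[D (compose L \<sigma> \<tau>) = D \<sigma> + D \<tau> - m \<sigma> * b \<tau>] (mod int p)" if "\<sigma> \<in> G" "\<tau> \<in> G" for \<sigma> \<tau>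
      using cong_diff[OF primitive_ofD(2)[OF D12 that] primitive_ofD(2)[OF D32 that]] by (simp add: m_def D_def algebra_simps)
  qed
  obtain B where B: "kummer_generator b B" using kummer_generator_exists[OF b] by blast
  obtain za where za: "cup_splitting a b D12 za" using cup_splitting_exists[OF a_char b D12] by blast
  obtain zc where zc: "cup_splitting c b D32 zc" using cup_splitting_exists[OF c_char b D32] by blast
  obtain zm where zm: "cup_splitting m b D zm" using cup_splitting_exists[OF m b D] by blast
  \<comment> \<open>The \<open>p\<close>-th powers of these families are \<open>\<alpha>\<close>, \<open>\<gamma>\<close> and \<open>e\<close>. All are built from the same roots of the functions
     \<open>z\<close>, so that the relation between \<open>\<alpha>\<close>, \<open>\<gamma>\<close> and \<open>e\<close> also holds for the roots.\<close>
  define Fa where "Fa \<xi> i j = norm_element B za \<xi> (1 * i + 0 * j)" for \<xi> i j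
  define Fc where "Fc \<xi> i j = norm_element B zc \<xi> (0 * i + 1 * j)" for \<xi> i j
  define Fe where "Fe \<xi> i j = pth_root (zc \<xi> j) * pth_root (zm \<xi> (i - j)) / pth_root (za \<xi> i)" for \<xi> i j
  have Fa: "kummer_family Fa" "\<sigma> \<in> G \<Longrightarrow> [(\<Sum>l\<in>{0..<int p}. kummer Fa \<sigma> l 0) = b \<sigma>] (mod int p)" for \<sigma>
    using norm_element_family[OF B za, where u = 1 and v = 0] by (simp_all add: Fa_def[abs_def])
  have Fc: "kummer_family Fc" "\<sigma> \<in> G \<Longrightarrow> [(\<Sum>l\<in>{0..<int p}. kummer Fc \<sigma> 0 l) = b \<sigma>] (mod int p)" for \<sigma>
    using norm_element_family[OF B zc, where u = 0 and v = 1] by (simp_all add: Fc_def[abs_def])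
  have z_mem: "z \<xi> i \<in> L" "z \<xi> i \<noteq> 0" "pth_root (z \<xi> i) \<in> L" "pth_root (z \<xi> i) ^ p = z \<xi> i" "pth_root (z \<xi> i) \<noteq> 0"
    if "\<xi> \<in> mu" "cup_splitting \<psi> b D z" for \<xi> i \<psi> D z
    using that pth_root[of "z \<xi> i"] pth_root_nonzero[of "z \<xi> i"] unfolding cup_splitting_def by blast+
  note roots = z_mem[OF _ za] z_mem[OF _ zc] z_mem[OF _ zm]
  have z_per: "z \<xi> i = z \<xi> j" if "[i = j] (mod int p)" "cup_splitting \<psi> b D z" for \<xi> i j \<psi> D z
    using that unfolding cup_splitting_def by blast
  have z_act: "\<sigma> (z \<xi> (i - \<psi> \<sigma>)) = z (\<sigma> \<xi>) i / \<sigma> \<xi> powi (i * b \<sigma> + D \<sigma>)"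
    if "cup_splitting \<psi> b D z" "\<sigma> \<in> G" "\<xi> \<in> mu" for \<sigma> \<xi> i \<psi> D z
    using that unfolding cup_splitting_def by blast
  have Fe: "kummer_family Fe"
  proof (rule kummer_familyI[where \<Psi> = "\<lambda>\<xi> i j. zc \<xi> j * zm \<xi> (i - j) / za \<xi> i"])
    show "Fe \<xi> i j = Fe \<xi> i' j'" if "[i = i'] (mod int p)" "[j = j'] (mod int p)" for \<xi> i j i' j'
      using z_per[OF that(1) za] z_per[OF that(2) zc] z_per[OF cong_diff[OF that] zm] by (simp add: Fe_def)
    show "\<sigma> (zc \<xi> (j - c \<sigma>) * zm \<xi> (i - a \<sigma> - (j - c \<sigma>)) / za \<xi> (i - a \<sigma>)) = 
       zc (\<sigma> \<xi>) j * zm (\<sigma> \<xi>) (i - j) / za (\<sigma> \<xi>) i"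
      if "\<sigma> \<in> G" "\<xi> \<in> mu" for \<sigma> \<xi> i j
    proof -
      have nz: "\<sigma> \<xi> \<noteq> 0" by (rule mu_nonzero[OF mu_act[OF that]])
      have e: "i - a \<sigma> - (j - c \<sigma>) = (i - j) - m \<sigma>" by (simp add: m_def)
      have "(i * b \<sigma> + D12 \<sigma>) = (j * b \<sigma> + D32 \<sigma>) + ((i - j) * b \<sigma> + D \<sigma>)"
        by (simp add: D_def algebra_simps)
      then have pw: "\<sigma> \<xi> powi (i * b \<sigma> + D12 \<sigma>) = \<sigma> \<xi> powi (j * b \<sigma> + D32 \<sigma>) * \<sigma> \<xi> powi ((i - j) * b \<sigma> + D \<sigma>)"
        using nz by (simp only: power_int_add simp_thms)
      have "\<sigma> (zc \<xi> (j - c \<sigma>) * zm \<xi> ((i - j) - m \<sigma>) / za \<xi> (i - a \<sigma>)) = 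
        \<sigma> (zc \<xi> (j - c \<sigma>)) * \<sigma> (zm \<xi> ((i - j) - m \<sigma>)) / \<sigma> (za \<xi> (i - a \<sigma>))"
        using that roots by (simp add: G_mult G_divide L_mult)
      also have "\<dots> = zc (\<sigma> \<xi>) j * zm (\<sigma> \<xi>) (i - j) / za (\<sigma> \<xi>) i"
        unfolding z_act[OF za that] z_act[OF zc that] z_act[OF zm that] pw using nz by simp
      finally show ?thesis unfolding e .
    qed
  qed (simp_all add: Fe_def roots L_mult L_divide power_mult_distrib power_divide)
  define f where "f \<sigma> i = kummer Fa \<sigma> i 0" for \<sigma> i
  define h where "h \<sigma> j = kummer Fc \<sigma> 0 j" for \<sigma> j
  define k where "k \<sigma> i j = kummer Fe \<sigma> i j" for \<sigma> i j
  have f_eq: "kummer Fa \<sigma> i j = f \<sigma> i" for \<sigma> i j by (simp add: f_def kummer_def ratio_def Fa_def)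
  have h_eq: "kummer Fc \<sigma> i j = h \<sigma> j" for \<sigma> i j by (simp add: h_def kummer_def ratio_def Fc_def)
  have data: "massey_data (int p) (b \<sigma>) (f \<sigma>) (h \<sigma>) (k \<sigma>)" if \<sigma>: "\<sigma> \<in> G" for \<sigma>
  proof
    show "Factorial_Ring.prime (int p)" using p by simp
    show "periodic (int p) (f \<sigma>)"
    proof (rule periodicI)
      fix i j assume ij: "[i = j] (mod int p)"
      show "[f \<sigma> i = f \<sigma> j] (mod int p)"
        unfolding f_def kummer_periodic[OF Fa(1) \<sigma> ij cong_refl] by (rule cong_refl)
    qed
    show "periodic (int p) (h \<sigma>)"
    proof (rule periodicI)
      fix i j assume ij: "[i = j] (mod int p)"
      show "[h \<sigma> i = h \<sigma> j] (mod int p)"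
        unfolding h_def kummer_periodic[OF Fc(1) \<sigma> cong_refl ij] by (rule cong_refl)
    qed
    show "[k \<sigma> i j = k \<sigma> i' j'] (mod int p)" if "[i = i'] (mod int p)" "[j = j'] (mod int p)" for i i' j j'
      unfolding k_def kummer_periodic[OF Fe \<sigma> that] by (rule cong_refl)
    show "[(\<Sum>i\<in>{0..<int p}. f \<sigma> i) = b \<sigma>] (mod int p)" "[(\<Sum>i\<in>{0..<int p}. h \<sigma> i) = b \<sigma>] (mod int p)"
      unfolding f_def h_def by (rule Fa(2)[OF \<sigma>] Fc(2)[OF \<sigma>])+
    show "[k \<sigma> i j - k \<sigma> (i + 1) (j + 1) = f \<sigma> i - h \<sigma> j] (mod int p)" for i j
    proof -
      have sh: "kummer_family (\<lambda>\<xi> i j. Fe \<xi> (i + 1) (j + 1))" by (rule kummer_family_shift[OF Fe])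
      have "kummer (\<lambda>\<xi> i j. Fe \<xi> i j * Fc \<xi> i j) \<sigma> i j = kummer (\<lambda>\<xi> i j. Fe \<xi> (i + 1) (j + 1) * Fa \<xi> i j) \<sigma> i j"
        by (rule kummer_cong[OF _ \<sigma>]) (simp add: Fe_def Fa_def Fc_def norm_element_def roots field_simps)
      with kummer_mult[OF Fe Fc(1) \<sigma>, of i j] kummer_mult[OF sh Fa(1) \<sigma>, of i j]
      have "[k \<sigma> i j + h \<sigma> j = k \<sigma> (i + 1) (j + 1) + f \<sigma> i] (mod int p)"
        by (simp add: f_eq h_eq kummer_shift k_def cong_def)
      then have "[k \<sigma> i j + h \<sigma> j - (h \<sigma> j + k \<sigma> (i + 1) (j + 1)) = k \<sigma> (i + 1) (j + 1) + f \<sigma> i - (h \<sigma> j + k \<sigma> (i + 1) (j + 1))] (mod int p)"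
        by (intro cong_diff cong_refl)
      then show ?thesis by (simp add: algebra_simps)
    qed
  qed
  define r where "r \<sigma> = (\<Sum>j\<in>{0..<int p}. k \<sigma> 0 j)" for \<sigma>
  define moment_total where "moment_total \<sigma> = r \<sigma> + (\<Sum>i\<in>{0..<int p}. i * f \<sigma> i) + (\<Sum>i\<in>{0..<int p}. i * h \<sigma> i)" for \<sigma>
  define half where "half = (int p + 1) div 2"
  define Z where "Z \<sigma> = (\<Sum>j\<in>{0..<int p}. j * k \<sigma> 0 j) 
      - (if int p = 2 then 0 else \<Sum>i\<in>{0..<int p}. half * (i * (i - 1)) * f \<sigma> i)" for \<sigma>
  have f_lc: "locally_constant (\<lambda>\<sigma>. f \<sigma> i)" and h_lc: "locally_constant (\<lambda>\<sigma>. h \<sigma> i)"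
    and k_lc: "locally_constant (\<lambda>\<sigma>. k \<sigma> i j)" for i j
    unfolding f_def h_def k_def by (rule kummer_locally_constant[OF Fa(1)] kummer_locally_constant[OF Fc(1)] kummer_locally_constant[OF Fe])+
  have r_lc: "locally_constant r" unfolding r_def by (rule locally_constant_sum[OF k_lc])
  have moment_total_lc: "locally_constant moment_total" 
    unfolding moment_total_def
    by (intro locally_constant_comp2[where h = "(+)"] r_lc locally_constant_sum 
         locally_constant_comp[where h = "(*) i" for i, OF f_lc] locally_constant_comp[where h = "(*) i" for i, OF h_lc])
  have Z_lc: "locally_constant Z"
  proof -
    have "locally_constant (\<lambda>\<sigma>. \<Sum>j\<in>{0..<int p}. j * k \<sigma> 0 j)"
      by (rule locally_constant_sum[OF locally_constant_comp[where h = "(*) i" for i, OF k_lc]])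
    moreover have "locally_constant (\<lambda>\<sigma>. \<Sum>i\<in>{0..<int p}. half * (i * (i - 1)) * f \<sigma> i)"
      by (rule locally_constant_sum[OF locally_constant_comp[where h = "(*) i" for i, OF f_lc]])
    ultimately show ?thesis
      unfolding Z_def by (rule locally_constant_comp2[where h = "\<lambda>u v. u - (if int p = 2 then 0 else v)"])
  qed
  have main: "[r (compose L \<sigma> \<tau>) = r \<sigma> + (r \<tau> - a \<sigma> * b \<tau>)] (mod int p)"
      "[moment_total (compose L \<sigma> \<tau>) = moment_total \<sigma> + (moment_total \<tau> + c \<sigma> * b \<tau>)] (mod int p)"
      "[Z (compose L \<sigma> \<tau>) = Z \<sigma> + (Z \<tau> - a \<sigma> * moment_total \<tau> + c \<sigma> * r \<tau> - a \<sigma> * c \<sigma> * b \<tau>)] (mod int p)"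
    if \<sigma>: "\<sigma> \<in> G" and \<tau>: "\<tau> \<in> G" for \<sigma> \<tau>
  proof -
    define f' where "f' i = f \<tau> (i - a \<sigma>)" for i
    define h' where "h' i = h \<tau> (i - c \<sigma>)" for i
    define k' where "k' i j = k \<tau> (i - a \<sigma>) (j - c \<sigma>)" for i j
    interpret \<tau>: massey_data "int p" "b \<tau>" "f \<tau>" "h \<tau>" "k \<tau>" by (rule data[OF \<tau>])
    interpret T: massey_translate "int p" "b \<tau>" "f \<tau>" "h \<tau>" "k \<tau>" "a \<sigma>" "c \<sigma>" f' h' k'
      by unfold_locales (simp_all add: f'_def h'_def k'_def)
    have rows: "r \<tau> = \<tau>.row 0" "moment_total \<tau> = \<tau>.moment_total" "Z \<tau> = \<tau>.massey_primitive"
      unfolding r_def moment_total_def Z_def \<tau>.row_def \<tau>.moment_total_def \<tau>.massey_primitive_def \<tau>.f_moment_def \<tau>.h_moment_def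
        \<tau>.row_moment_def \<tau>.f_moment2_def \<tau>.half_def half_def by simp_all
    have f_comp: "[f (compose L \<sigma> \<tau>) i = f \<sigma> i + f' i] (mod int p)" for i
      using kummer_compose[OF Fa(1) \<sigma> \<tau>, of i 0] by (simp add: f_eq f'_def)
    have h_comp: "[h (compose L \<sigma> \<tau>) i = h \<sigma> i + h' i] (mod int p)" for i
      using kummer_compose[OF Fc(1) \<sigma> \<tau>, of 0 i] by (simp add: h_eq h'_def)
    have k_comp: "[k (compose L \<sigma> \<tau>) i j = k \<sigma> i j + k' i j] (mod int p)" for i j
      using kummer_compose[OF Fe \<sigma> \<tau>, of i j] by (simp add: k_def k'_def)
    have r': "[r (compose L \<sigma> \<tau>) = r \<sigma> + (\<Sum>j\<in>{0..<int p}. k' 0 j)] (mod int p)"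
      unfolding r_def sum.distrib[symmetric] by (rule cong_sum[OF k_comp])
    have f1: "[(\<Sum>i\<in>{0..<int p}. g i * f (compose L \<sigma> \<tau>) i) = (\<Sum>i\<in>{0..<int p}. g i * f \<sigma> i) + (\<Sum>i\<in>{0..<int p}. g i * f' i)] (mod int p)" for g
      unfolding sum.distrib[symmetric] distrib_left[symmetric] by (intro cong_sum cong_mult cong_refl f_comp)
    have h1: "[(\<Sum>i\<in>{0..<int p}. i * h (compose L \<sigma> \<tau>) i) = (\<Sum>i\<in>{0..<int p}. i * h \<sigma> i) + (\<Sum>i\<in>{0..<int p}. i * h' i)] (mod int p)"
      unfolding sum.distrib[symmetric] distrib_left[symmetric] by (intro cong_sum cong_mult cong_refl h_comp)
    have k1: "[(\<Sum>i\<in>{0..<int p}. i * k (compose L \<sigma> \<tau>) 0 i) = (\<Sum>i\<in>{0..<int p}. i * k \<sigma> 0 i) + (\<Sum>i\<in>{0..<int p}. i * k' 0 i)] (mod int p)"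
      unfolding sum.distrib[symmetric] distrib_left[symmetric] by (intro cong_sum cong_mult cong_refl k_comp)
    show r'': "[r (compose L \<sigma> \<tau>) = r \<sigma> + (r \<tau> - a \<sigma> * b \<tau>)] (mod int p)"
      unfolding rows by (rule cong_trans[OF r' cong_add[OF cong_refl T.row_translate]])
    have "[moment_total (compose L \<sigma> \<tau>) = (r \<sigma> + (r \<tau> - a \<sigma> * b \<tau>)) + ((\<Sum>i\<in>{0..<int p}. i * f \<sigma> i) + (\<tau>.f_moment + a \<sigma> * b \<tau>))
        + ((\<Sum>i\<in>{0..<int p}. i * h \<sigma> i) + (\<tau>.h_moment + c \<sigma> * b \<tau>))] (mod int p)"
      unfolding moment_total_def
      by (intro cong_add r'' cong_trans[OF f1 cong_add[OF cong_refl T.f_moment_translate]] 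
           cong_trans[OF h1 cong_add[OF cong_refl T.h_moment_translate]])
    then show "[moment_total (compose L \<sigma> \<tau>) = moment_total \<sigma> + (moment_total \<tau> + c \<sigma> * b \<tau>)] (mod int p)"
      by (simp add: moment_total_def \<tau>.f_moment_def \<tau>.h_moment_def algebra_simps)
    have "[Z (compose L \<sigma> \<tau>) = Z \<sigma> + ((\<Sum>j\<in>{0..<int p}. j * k' 0 j) - (if int p = 2 then 0 else \<Sum>i\<in>{0..<int p}. half * (i * (i - 1)) * f' i))] (mod int p)"
      using cong_diff[OF k1 f1[of "\<lambda>i. half * (i * (i - 1))"]] k1
      by (cases "int p = 2") (simp_all add: Z_def algebra_simps)
    also have "[Z \<sigma> + ((\<Sum>j\<in>{0..<int p}. j * k' 0 j) - (if int p = 2 then 0 else \<Sum>i\<in>{0..<int p}. half * (i * (i - 1)) * f' i)) =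
        Z \<sigma> + (\<tau>.massey_primitive - a \<sigma> * \<tau>.moment_total + c \<sigma> * \<tau>.row 0 - a \<sigma> * c \<sigma> * b \<tau>)] (mod int p)"
      using T.massey_primitive_translate unfolding \<tau>.half_def half_def by (intro cong_add cong_refl)
    finally show "[Z (compose L \<sigma> \<tau>) = Z \<sigma> + (Z \<tau> - a \<sigma> * moment_total \<tau> + c \<sigma> * r \<tau> - a \<sigma> * c \<sigma> * b \<tau>)] (mod int p)"
      unfolding rows .
  qed
  define t where "t \<sigma> = moment_total \<sigma> - b \<sigma> * c \<sigma>" for \<sigma>
  define K where "K \<sigma> = Z \<sigma> - r \<sigma> * c \<sigma>" for \<sigma>
  have "locally_constant t" unfolding t_def
    by (rule locally_constant_comp2[OF moment_total_lc locally_constant_comp2[where h = "(*)", OF b_lc c_lc]])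
  have "locally_constant K" unfolding K_def
    by (rule locally_constant_comp2[OF Z_lc locally_constant_comp2[where h = "(*)", OF r_lc c_lc]])
  have "[r (compose L \<sigma> \<tau>) = r \<sigma> + r \<tau> - a \<sigma> * b \<tau>] (mod int p) \<and>
      [t (compose L \<sigma> \<tau>) = t \<sigma> + t \<tau> - b \<sigma> * c \<tau>] (mod int p) \<and>
      [K (compose L \<sigma> \<tau>) = K \<sigma> + K \<tau> - (a \<sigma> * t \<tau> + r \<sigma> * c \<tau>)] (mod int p)"
    if \<sigma>: "\<sigma> \<in> G" and \<tau>: "\<tau> \<in> G" for \<sigma> \<tau>
  proof -
    note main = main[OF \<sigma> \<tau>] b_hom[OF \<sigma> \<tau>] c_hom[OF \<sigma> \<tau>]
    have "[t (compose L \<sigma> \<tau>) = moment_total \<sigma> + (moment_total \<tau> + c \<sigma> * b \<tau>) - (b \<sigma> + b \<tau>) * (c \<sigma> + c \<tau>)] (mod int p)"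
      unfolding t_def by (intro cong_diff cong_mult main)
    moreover have "[K (compose L \<sigma> \<tau>) = Z \<sigma> + (Z \<tau> - a \<sigma> * moment_total \<tau> + c \<sigma> * r \<tau> - a \<sigma> * c \<sigma> * b \<tau>)
        - (r \<sigma> + (r \<tau> - a \<sigma> * b \<tau>)) * (c \<sigma> + c \<tau>)] (mod int p)"
      unfolding K_def by (intro cong_diff cong_mult main)
    ultimately show ?thesis using main(1) by (simp add: t_def K_def algebra_simps)
  qed
  with r_lc \<open>locally_constant t\<close> \<open>locally_constant K\<close> show ?thesis
    by (intro that[of r t K]) (simp_all add: primitive_of_def)
qed

end

section \<open>The absolute Galois group\<close>

abbreviation "Gal (F :: 'a::field itself) \<equiv> carrier (absolute_galois_group F)"

lemma mem_separable_closure [simp]: "x \<in> separable_closure F \<longleftrightarrow> separable_element x"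
  by (simp add: separable_closure_def)

lemma mem_Gal:
  "\<sigma> \<in> Gal F \<longleftrightarrow> \<sigma> \<in> extensional (separable_closure F) \<and>
     bij_betw \<sigma> (separable_closure F) (separable_closure F) \<and>
     (\<forall>x\<in>separable_closure F. \<forall>y\<in>separable_closure F. \<sigma> (x + y) = \<sigma> x + \<sigma> y \<and> \<sigma> (x * y) = \<sigma> x * \<sigma> y) \<and>
     (\<forall>a. \<sigma> (to_ac a) = to_ac a)"
  by (simp add: absolute_galois_group_def Let_def)

lemma mult_Gal [simp]: "\<sigma> \<otimes>\<^bsub>absolute_galois_group F\<^esub> \<tau> = compose (separable_closure F) \<sigma> \<tau>"
  by (simp add: absolute_galois_group_def Let_def)

lemma Gal_ac_eval:
  fixes F :: "'a::field itself"
  assumes \<sigma>: "\<sigma> \<in> Gal F" and x: "separable_element x"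
  shows "separable_element (ac_eval f x)" "\<sigma> (ac_eval f x) = ac_eval f (\<sigma> x)"
proof -
  have "separable_element (ac_eval f x) \<and> \<sigma> (ac_eval f x) = ac_eval f (\<sigma> x)"
  proof (induction f)
    case 0
    have "separable_element (0 :: 'a alg_closure)" "\<sigma> 0 = 0"
      using separable_to_ac[of 0] \<sigma> by (auto simp: mem_Gal dest: spec[of _ 0])
    then show ?case by simp
  next
    case (pCons a f)
    then show ?case
      using \<sigma> x separable_to_ac[of a] separable_mult[OF x, of "ac_eval f x"] separable_add
      by (simp add: mem_Gal)
  qed
  then show "separable_element (ac_eval f x)" "\<sigma> (ac_eval f x) = ac_eval f (\<sigma> x)" by auto
qed

text \<open>
  The orbit of \<open>x\<close> consists of roots of any polynomial over the base field that vanishes at \<open>x\<close>, hence is finite.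
\<close>

lemma galois_action_Gal:
  fixes F :: "'a::field itself"
  shows "galois_action (separable_closure F) (Gal F)"
proof
  let ?L = "separable_closure F"
  let ?G = "Gal F"
  show "1 \<in> ?L" using separable_to_ac[of 1] by simp
  show "x + y \<in> ?L" "x * y \<in> ?L" if "x \<in> ?L" "y \<in> ?L" for x y
    using that separable_add separable_mult by auto
  show "- x \<in> ?L" "inverse x \<in> ?L" if "x \<in> ?L" for x
    using that separable_minus separable_inverse by auto
  have in_L: "\<sigma> x \<in> ?L" if "\<sigma> \<in> ?G" "x \<in> ?L" for \<sigma> x
    using that bij_betw_apply[of \<sigma> ?L ?L x] unfolding mem_Gal by blast
  then show "\<sigma> x \<in> ?L" if "\<sigma> \<in> ?G" "x \<in> ?L" for \<sigma> x using that .
  show "\<sigma> (x + y) = \<sigma> x + \<sigma> y" "\<sigma> (x * y) = \<sigma> x * \<sigma> y" if "\<sigma> \<in> ?G" "x \<in> ?L" "y \<in> ?L" for \<sigma> x y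
    using that by (auto simp: mem_Gal)
  show "\<sigma> 1 = 1" if "\<sigma> \<in> ?G" for \<sigma>
  proof -
    have "\<sigma> (to_ac 1) = to_ac 1" using that unfolding mem_Gal by blast
    then show ?thesis by simp
  qed
  show "compose ?L \<sigma> \<tau> \<in> ?G" if "\<sigma> \<in> ?G" "\<tau> \<in> ?G" for \<sigma> \<tau>
  proof -
    note * = compose_eq[where A = ?L and g = \<sigma> and f = \<tau>]
    show ?thesis
      unfolding mem_Gal
    proof (intro conjI ballI allI)
      show "compose ?L \<sigma> \<tau> \<in> extensional ?L" by (rule compose_extensional)
      show "bij_betw (compose ?L \<sigma> \<tau>) ?L ?L"
        by (rule bij_betw_compose[of _ _ ?L]) (use that in \<open>simp_all add: mem_Gal\<close>)
    next
      fix x y assume xy: "x \<in> ?L" "y \<in> ?L"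
      have "x + y \<in> ?L" "x * y \<in> ?L" "\<tau> x \<in> ?L" "\<tau> y \<in> ?L"
        using xy separable_add separable_mult in_L[OF that(2)] by auto
      then show "compose ?L \<sigma> \<tau> (x + y) = compose ?L \<sigma> \<tau> x + compose ?L \<sigma> \<tau> y"
        "compose ?L \<sigma> \<tau> (x * y) = compose ?L \<sigma> \<tau> x * compose ?L \<sigma> \<tau> y"
        using that xy unfolding mem_Gal by (simp_all add: * del: mem_separable_closure)
    next
      fix a show "compose ?L \<sigma> \<tau> (to_ac a) = to_ac a"
        using that separable_to_ac[of a] by (simp add: * mem_Gal)
    qed
  qed
  show "(\<lambda>x\<in>?L. x) \<in> ?G"
  proof -
    have "bij_betw (\<lambda>x\<in>?L. x) ?L ?L" by (auto simp: bij_betw_def inj_on_def)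
    then show ?thesis by (simp add: mem_Gal separable_add separable_mult separable_to_ac)
  qed
  show "\<sigma> \<in> extensional ?L" if "\<sigma> \<in> ?G" for \<sigma> using that by (simp add: mem_Gal)
  show "\<exists>\<tau>\<in>?G. (\<forall>x\<in>?L. \<sigma> (\<tau> x) = x) \<and> (\<forall>x\<in>?L. \<tau> (\<sigma> x) = x)" if \<sigma>: "\<sigma> \<in> ?G" for \<sigma>
  proof -
    define \<tau> where "\<tau> = restrict (inv_into ?L \<sigma>) ?L"
    have bij: "bij_betw \<sigma> ?L ?L" using \<sigma> by (simp add: mem_Gal)
    have \<tau>L: "\<tau> x \<in> ?L" and \<sigma>\<tau>: "\<sigma> (\<tau> x) = x" if "x \<in> ?L" for x
      using that bij by (simp_all add: \<tau>_def bij_betw_def inv_into_into f_inv_into_f del: mem_separable_closure)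
    have \<tau>\<sigma>: "\<tau> (\<sigma> x) = x" if "x \<in> ?L" for x
      using that bij in_L[OF \<sigma> that] by (simp add: \<tau>_def bij_betw_def del: mem_separable_closure)
    have eqI: "\<tau> y = x" if "x \<in> ?L" "\<sigma> x = y" for x y
      using \<tau>\<sigma> that by blast
    have "\<tau> \<in> ?G"
      unfolding mem_Gal
    proof (intro conjI ballI allI)
      show "\<tau> \<in> extensional ?L" by (simp add: \<tau>_def)
      show "bij_betw \<tau> ?L ?L"
        by (rule bij_betw_byWitness[where f' = \<sigma>]) (use \<tau>\<sigma> \<sigma>\<tau> \<tau>L in_L[OF \<sigma>] in blast)+
      fix x y assume xy: "x \<in> ?L" "y \<in> ?L"
      show "\<tau> (x + y) = \<tau> x + \<tau> y" "\<tau> (x * y) = \<tau> x * \<tau> y"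
        using \<tau>L[OF xy(1)] \<tau>L[OF xy(2)] \<sigma>\<tau>[OF xy(1)] \<sigma>\<tau>[OF xy(2)] \<sigma>
        by (auto intro!: eqI separable_add separable_mult simp: mem_Gal)
    next
      fix a show "\<tau> (to_ac a) = to_ac a"
        using \<sigma> separable_to_ac by (intro eqI) (auto simp: mem_Gal)
    qed
    then show ?thesis using \<sigma>\<tau> \<tau>\<sigma> by blast
  qed
  show "finite ((\<lambda>\<sigma>. \<sigma> x) ` ?G)" if x: "x \<in> ?L" for x
  proof -
    obtain h where h: "ac_eval h x = 0" "ac_eval (pderiv h) x \<noteq> 0"
      using x by (auto simp: separable_element_iff)
    then have "map_poly to_ac h \<noteq> 0" by auto
    moreover have "(\<lambda>\<sigma>. \<sigma> x) ` ?G \<subseteq> {y. Polynomial.poly (map_poly to_ac h) y = 0}"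
    proof
      fix y assume "y \<in> (\<lambda>\<sigma>. \<sigma> x) ` ?G"
      then obtain \<sigma> where \<sigma>: "\<sigma> \<in> ?G" "y = \<sigma> x" by blast
      then have "ac_eval h y = \<sigma> 0"
        using Gal_ac_eval(2)[OF \<sigma>(1), of x h] x h(1) by simp
      moreover have "\<sigma> 0 = 0"
        using Gal_ac_eval(2)[OF \<sigma>(1), of x 0] x by simp
      ultimately have "ac_eval h y = 0" by simp
      then show "y \<in> {y. Polynomial.poly (map_poly to_ac h) y = 0}" by (simp add: ac_eval_def)
    qed
    ultimately show ?thesis using poly_roots_finite finite_subset by blast
  qed
qed

lemma separable_closure_nth_root:
  fixes w :: "'a::field alg_closure"
  assumes "separable_element w" "n > 0" "of_nat n \<noteq> (0::'a)"
  shows "\<exists>v. separable_element v \<and> v ^ n = w"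
proof -
  obtain v where v: "v ^ n = w" using nth_root_exists[OF assms(2)] by blast
  moreover have "separable_element v"
    using assms separable_nth_root[of v n] separable_to_ac[of "0 :: 'a"] v by (cases "v = 0") auto
  ultimately show ?thesis by blast
qed

lemma separable_closure_artin_schreier:
  fixes w :: "'a::field alg_closure"
  assumes "separable_element w" "n > 1" "of_nat n = (0::'a)"
  shows "\<exists>y. separable_element y \<and> y ^ n - y = w"
proof -
  define P where "P = Polynomial.monom (1 :: 'a alg_closure) n + [:- w, -1:]"
  have "Polynomial.degree P = n"
    unfolding P_def using assms(2) by (subst degree_add_eq_left) (simp_all add: degree_monom_eq)
  then obtain y where "Polynomial.poly P y = 0"
    using alg_closed_imp_poly_has_root[of P] assms(2) by auto
  then have "y ^ n - y = w" by (simp add: P_def poly_monom algebra_simps)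
  then show ?thesis using assms separable_artin_schreier_root[of y n] by auto
qed

text \<open>
  Any root of \<open>1 + X + ... + X^(n-1)\<close> will do, since its value at 1 is \<open>n\<close>.
\<close>

lemma separable_closure_root_of_unity:
  assumes "n > 1" "of_nat n \<noteq> (0::'a::field)"
  shows "\<exists>\<xi> :: 'a alg_closure. separable_element \<xi> \<and> \<xi> ^ n = 1 \<and> \<xi> \<noteq> 1"
proof -
  define P where "P = (\<Sum>k<n. Polynomial.monom (1 :: 'a alg_closure) k)"
  have P: "Polynomial.poly P y = (\<Sum>k<n. y ^ k)" for y by (simp add: P_def poly_sum poly_monom)
  have "Polynomial.coeff P (n - 1) = 1" using assms(1) by (simp add: P_def coeff_sum)
  then have "Polynomial.degree P \<ge> n - 1" by (intro le_degree) simp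
  then have "Polynomial.degree P > 0" using assms(1) by linarith
  then obtain \<xi> where \<xi>: "Polynomial.poly P \<xi> = 0"
    using alg_closed_imp_poly_has_root[of P] by blast
  have "\<xi> ^ n = 1" using \<xi> P power_diff_1_eq[of \<xi> n] by simp
  moreover have "\<xi> \<noteq> 1"
  proof
    assume "\<xi> = 1"
    then have "to_ac (of_nat n :: 'a) = 0" using \<xi> P by simp
    then show False using assms(2) by (simp only: to_ac_eq_0_iff)
  qed
  moreover have "\<xi> \<noteq> 0" using \<open>\<xi> ^ n = 1\<close> assms(1) by (auto simp: zero_power)
  ultimately show ?thesis
    using separable_nth_root[of \<xi> n] separable_to_ac[of "1 :: 'a"] assms(2) by auto
qed

section \<open>Vanishing of triple Massey products\<close>

context
  fixes F :: "'a::field itself" and p :: nat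
  assumes p: "Factorial_Ring.prime p"
begin

private abbreviation "R \<equiv> residue_ring (int p)"
private abbreviation "Fs \<equiv> separable_closure F"
private abbreviation "GF \<equiv> absolute_galois_group F"
private abbreviation "KT \<equiv> krull_topology F"

lemma p_gt_1: "int p > 1" using p prime_gt_1_nat by auto

lemma residues_p: "residues (int p)" using p_gt_1 by unfold_locales

lemma residue_ring_simps:
  "carrier R = {0..<int p}" "x \<oplus>\<^bsub>R\<^esub> y = (x + y) mod int p" "x \<otimes>\<^bsub>R\<^esub> y = (x * y) mod int p"
  "\<zero>\<^bsub>R\<^esub> = 0"
  by (auto simp: residue_ring_def)

lemma residue_ring_minus: "x \<ominus>\<^bsub>R\<^esub> y = (x - y) mod int p"
proof -
  interpret residues "int p" R by (rule residues_p)
  have "\<ominus>\<^bsub>R\<^esub> y = (- y) mod int p" by (rule res_neg_eq)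
  then show ?thesis by (simp add: a_minus_def residue_ring_simps mod_simps)
qed

lemma coboundary1_apply:
  assumes "\<sigma> \<in> carrier GF" "\<tau> \<in> carrier GF"
  shows "coboundary1 GF R f (\<sigma>, \<tau>) =
    (f \<sigma> + f \<tau> - f (compose Fs \<sigma> \<tau>)) mod int p"
  using assms by (simp add: coboundary1_def residue_ring_minus residue_ring_simps mod_simps)

lemma cup_apply:
  assumes "\<sigma> \<in> carrier GF" "\<tau> \<in> carrier GF"
  shows "cup GF R f g (\<sigma>, \<tau>) = (f \<sigma> * g \<tau>) mod int p"
  using assms by (simp add: cup_def residue_ring_simps)

lemma add_cochain2_apply:
  assumes "\<sigma> \<in> carrier GF" "\<tau> \<in> carrier GF"
  shows "add_cochain2 GF R f g (\<sigma>, \<tau>) = (f (\<sigma>, \<tau>) + g (\<sigma>, \<tau>)) mod int p"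
  using assms by (simp add: add_cochain2_def residue_ring_simps)

lemma cochain2_eqI:
  assumes "f \<in> extensional (carrier GF \<times> carrier GF)" "g \<in> extensional (carrier GF \<times> carrier GF)"
    "\<And>\<sigma> \<tau>. \<sigma> \<in> carrier GF \<Longrightarrow> \<tau> \<in> carrier GF \<Longrightarrow> f (\<sigma>, \<tau>) = g (\<sigma>, \<tau>)"
  shows "f = g"
  by (rule extensionalityI[OF assms(1,2)]) (use assms(3) in auto)

lemma extensional_cochains2 [simp]:
  "coboundary1 GF R f \<in> extensional (carrier GF \<times> carrier GF)"
  "cup GF R f g \<in> extensional (carrier GF \<times> carrier GF)"
  "add_cochain2 GF R u v \<in> extensional (carrier GF \<times> carrier GF)"
  by (simp_all add: coboundary1_def cup_def add_cochain2_def)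

text \<open>
  Continuity for the Krull topology, expressed by finite sets as in \<open>openin_krull_topology\<close>.
\<close>

lemma cochains1_iff:
  "f \<in> cochains1 GF KT R \<longleftrightarrow>
     f \<in> carrier GF \<rightarrow>\<^sub>E {0..<int p} \<and>
     (\<forall>\<sigma>\<in>carrier GF. \<exists>S. finite S \<and> S \<subseteq> Fs \<and>
        (\<forall>\<tau>\<in>carrier GF. (\<forall>x\<in>S. \<tau> x = \<sigma> x) \<longrightarrow> f \<tau> = f \<sigma>))"
  (is "?L \<longleftrightarrow> ?E \<and> ?C")
proof
  assume f: ?L
  then have E: ?E and cont: "continuous_map KT (discrete_topology {0..<int p}) f"
    by (simp_all add: cochains1_def residue_ring_simps)
  have ?C
  proof
    fix \<sigma> assume \<sigma>: "\<sigma> \<in> carrier GF"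
    have "f \<sigma> \<in> {0..<int p}" using E \<sigma> by (auto simp: PiE_iff)
    then have "openin KT {x \<in> carrier GF. f x \<in> {f \<sigma>}}"
      using cont unfolding continuous_map_def topspace_krull_topology
      by (elim conjE allE[of _ "{f \<sigma>}"]) simp
    then have nbhd: "\<forall>\<rho>\<in>{x \<in> carrier GF. f x \<in> {f \<sigma>}}. \<exists>S. finite S \<and> S \<subseteq> Fs \<and>
        {\<tau> \<in> carrier GF. \<forall>x\<in>S. \<tau> x = \<rho> x} \<subseteq> {x \<in> carrier GF. f x \<in> {f \<sigma>}}"
      unfolding openin_krull_topology by (rule conjunct2)
    have "\<sigma> \<in> {x \<in> carrier GF. f x \<in> {f \<sigma>}}" using \<sigma> by simp
    from bspec[OF nbhd this] obtain S where "finite S" "S \<subseteq> Fs"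
        "{\<tau> \<in> carrier GF. \<forall>x\<in>S. \<tau> x = \<sigma> x} \<subseteq> {x \<in> carrier GF. f x \<in> {f \<sigma>}}"
      by (elim exE conjE)
    then show "\<exists>S. finite S \<and> S \<subseteq> Fs \<and> (\<forall>\<tau>\<in>carrier GF. (\<forall>x\<in>S. \<tau> x = \<sigma> x) \<longrightarrow> f \<tau> = f \<sigma>)"
      by (intro exI[of _ S]) blast
  qed
  with E show "?E \<and> ?C" by blast
next
  assume f: "?E \<and> ?C"
  have "openin KT {x \<in> carrier GF. f x \<in> U}" for U
    unfolding openin_krull_topology
  proof (intro conjI ballI)
    fix \<sigma> assume "\<sigma> \<in> {x \<in> carrier GF. f x \<in> U}"
    with f obtain S where "finite S" "S \<subseteq> Fs" "\<forall>\<tau>\<in>carrier GF. (\<forall>x\<in>S. \<tau> x = \<sigma> x) \<longrightarrow> f \<tau> = f \<sigma>" "f \<sigma> \<in> U"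
      by blast
    then show "\<exists>S. finite S \<and> S \<subseteq> Fs \<and> {\<tau> \<in> carrier GF. \<forall>x\<in>S. \<tau> x = \<sigma> x} \<subseteq> {x \<in> carrier GF. f x \<in> U}"
      by (intro exI[of _ S]) auto
  qed blast
  with f show ?L
    by (auto simp: cochains1_def residue_ring_simps continuous_map_def PiE_iff)
qed

lemma cochains1_combine:
  assumes "f \<in> cochains1 GF KT R"
    "g \<in> cochains1 GF KT R"
  shows "(\<lambda>\<sigma>\<in>carrier GF. h (f \<sigma>) (g \<sigma>) mod int p) \<in> cochains1 GF KT R"
  unfolding cochains1_iff
proof (intro conjI ballI)
  show "(\<lambda>\<sigma>\<in>carrier GF. h (f \<sigma>) (g \<sigma>) mod int p) \<in> carrier GF \<rightarrow>\<^sub>E {0..<int p}" using p_gt_1 by auto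
  fix \<sigma> assume \<sigma>: "\<sigma> \<in> carrier GF"
  obtain S where S: "finite S" "S \<subseteq> Fs" "\<forall>\<tau>\<in>carrier GF. (\<forall>x\<in>S. \<tau> x = \<sigma> x) \<longrightarrow> f \<tau> = f \<sigma>"
    using assms(1) \<sigma> unfolding cochains1_iff by blast
  obtain S' where S': "finite S'" "S' \<subseteq> Fs" "\<forall>\<tau>\<in>carrier GF. (\<forall>x\<in>S'. \<tau> x = \<sigma> x) \<longrightarrow> g \<tau> = g \<sigma>"
    using assms(2) \<sigma> unfolding cochains1_iff by blast
  show "\<exists>S. finite S \<and> S \<subseteq> Fs \<and> (\<forall>\<tau>\<in>carrier GF. (\<forall>x\<in>S. \<tau> x = \<sigma> x) \<longrightarrow>
      (\<lambda>\<sigma>\<in>carrier GF. h (f \<sigma>) (g \<sigma>) mod int p) \<tau> = (\<lambda>\<sigma>\<in>carrier GF. h (f \<sigma>) (g \<sigma>) mod int p) \<sigma>)"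
  proof (intro exI[of _ "S \<union> S'"] conjI ballI impI)
    fix \<tau> assume \<tau>: "\<tau> \<in> carrier GF" "\<forall>x\<in>S \<union> S'. \<tau> x = \<sigma> x"
    then have "f \<tau> = f \<sigma>" "g \<tau> = g \<sigma>" using S(3) S'(3) by blast+
    then show "(\<lambda>\<sigma>\<in>carrier GF. h (f \<sigma>) (g \<sigma>) mod int p) \<tau> = (\<lambda>\<sigma>\<in>carrier GF. h (f \<sigma>) (g \<sigma>) mod int p) \<sigma>"
      using \<tau>(1) \<sigma> by simp
  qed (use S S' in auto)
qed

lemma one_H2: "\<one>\<^bsub>H2 G T R\<^esub> = coboundaries2 G T R"
  by (simp add: H2_def FactGroup_def)

lemma class2_eq: "class2 G T R u = (\<lambda>v. add_cochain2 G R v u) ` coboundaries2 G T R"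
  by (auto simp: class2_def r_coset_def cocycles2_def)

lemma coboundary_of_trivial_class:
  assumes "class2 GF KT R u = \<one>\<^bsub>H2 GF KT R\<^esub>"
    and u: "u \<in> extensional (carrier GF \<times> carrier GF)" "\<And>\<sigma> \<tau>. \<sigma> \<in> carrier GF \<Longrightarrow> \<tau> \<in> carrier GF \<Longrightarrow> u (\<sigma>, \<tau>) \<in> {0..<int p}"
  obtains D where "D \<in> cochains1 GF KT R"
    "coboundary1 GF R D = u"
proof -
  \<comment> \<open>The coset of \<open>u\<close> contains \<open>0 + u\<close>.\<close>
  define z where "z = (\<lambda>\<sigma>\<in>carrier GF. 0 :: int)"
  have "z \<in> cochains1 GF KT R"
    unfolding cochains1_iff z_def using p_gt_1 by (auto intro!: exI[of _ "{}"])
  then have "add_cochain2 GF R (coboundary1 GF R z) u \<in> coboundaries2 GF KT R"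
    using assms(1) unfolding one_H2 class2_eq by (auto simp: coboundaries2_def)
  moreover have "add_cochain2 GF R (coboundary1 GF R z) u = u"
  proof (rule cochain2_eqI[OF _ u(1)])
    fix \<sigma> \<tau> assume st: "\<sigma> \<in> carrier GF" "\<tau> \<in> carrier GF"
    then have "compose Fs \<sigma> \<tau> \<in> carrier GF" by (rule galois_action.G_comp[OF galois_action_Gal])
    then show "add_cochain2 GF R (coboundary1 GF R z) u (\<sigma>, \<tau>) = u (\<sigma>, \<tau>)"
      using st u(2)[OF st] by (simp add: add_cochain2_apply coboundary1_apply z_def)
  qed simp
  ultimately show ?thesis using that by (auto simp: coboundaries2_def)
qed

lemma trivial_class_of_coboundary:
  assumes K: "K \<in> cochains1 GF KT R"
  shows "class2 GF KT R (coboundary1 GF R K) = \<one>\<^bsub>H2 GF KT R\<^esub>"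
proof -
  have sum: "add_cochain2 GF R (coboundary1 GF R f) (coboundary1 GF R K) = 
      coboundary1 GF R (\<lambda>\<sigma>\<in>carrier GF. (f \<sigma> + K \<sigma>) mod int p)" for f
  proof (rule cochain2_eqI)
    fix \<sigma> \<tau> assume st: "\<sigma> \<in> carrier GF" "\<tau> \<in> carrier GF"
    then have comp: "compose Fs \<sigma> \<tau> \<in> carrier GF" by (rule galois_action.G_comp[OF galois_action_Gal])
    define g where "g = (\<lambda>\<sigma>\<in>carrier GF. (f \<sigma> + K \<sigma>) mod int p)"
    have "[g \<sigma> + g \<tau> - g (compose Fs \<sigma> \<tau>) =
        (f \<sigma> + K \<sigma>) + (f \<tau> + K \<tau>) - (f (compose Fs \<sigma> \<tau>) + K (compose Fs \<sigma> \<tau>))] (mod int p)"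
      using st comp by (intro cong_diff cong_add) (simp_all add: g_def cong_def)
    then have "coboundary1 GF R g (\<sigma>, \<tau>) =
       ((f \<sigma> + f \<tau> - f (compose Fs \<sigma> \<tau>)) + (K \<sigma> + K \<tau> - K (compose Fs \<sigma> \<tau>))) mod int p"
      using st by (simp add: coboundary1_apply cong_def algebra_simps)
    then show "add_cochain2 GF R (coboundary1 GF R f) (coboundary1 GF R K) (\<sigma>, \<tau>) = 
      coboundary1 GF R (\<lambda>\<sigma>\<in>carrier GF. (f \<sigma> + K \<sigma>) mod int p) (\<sigma>, \<tau>)"
      unfolding g_def using st by (simp only: add_cochain2_apply coboundary1_apply mod_add_eq)
  qed simp_all
  have diff: "(\<lambda>\<sigma>\<in>carrier GF. ((\<lambda>\<sigma>\<in>carrier GF. (f \<sigma> - K \<sigma>) mod int p) \<sigma> + K \<sigma>) mod int p) = f" 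
    if "f \<in> cochains1 GF KT R" for f
  proof
    fix \<sigma>
    have "f \<in> carrier GF \<rightarrow>\<^sub>E {0..<int p}" using that unfolding cochains1_iff by blast
    then show "(\<lambda>\<sigma>\<in>carrier GF. ((\<lambda>\<sigma>\<in>carrier GF. (f \<sigma> - K \<sigma>) mod int p) \<sigma> + K \<sigma>) mod int p) \<sigma> = f \<sigma>"
      by (cases "\<sigma> \<in> carrier GF") (auto simp: mod_simps PiE_iff extensional_def)
  qed
  have "(\<lambda>v. add_cochain2 GF R v (coboundary1 GF R K)) ` coboundaries2 GF KT R = coboundaries2 GF KT R"
  proof (intro equalityI subsetI)
    fix v assume "v \<in> (\<lambda>v. add_cochain2 GF R v (coboundary1 GF R K)) ` coboundaries2 GF KT R"
    then obtain f where f: "f \<in> cochains1 GF KT R" "v = coboundary1 GF R (\<lambda>\<sigma>\<in>carrier GF. (f \<sigma> + K \<sigma>) mod int p)"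
      unfolding coboundaries2_def by (auto simp: sum)
    then show "v \<in> coboundaries2 GF KT R"
      unfolding coboundaries2_def using cochains1_combine[OF f(1) K, of "(+)"] by blast
  next
    fix v assume "v \<in> coboundaries2 GF KT R"
    then obtain f where f: "f \<in> cochains1 GF KT R" "v = coboundary1 GF R f" unfolding coboundaries2_def by blast
    have "v = add_cochain2 GF R (coboundary1 GF R (\<lambda>\<sigma>\<in>carrier GF. (f \<sigma> - K \<sigma>) mod int p)) (coboundary1 GF R K)"
      unfolding sum diff[OF f(1)] f(2) ..
    then show "v \<in> (\<lambda>v. add_cochain2 GF R v (coboundary1 GF R K)) ` coboundaries2 GF KT R"
      unfolding coboundaries2_def using cochains1_combine[OF f(1) K, of "(-)"] by blast
  qed
  then show ?thesis by (simp add: one_H2 class2_eq)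
qed

interpretation galois_action Fs "carrier GF"
  by (rule galois_action_Gal)

text \<open>
  Continuity at the identity suffices if \<open>f\<close> is additive in a neighbourhood of the identity on the right: elements \<open>\<sigma>\<close>,
  \<open>\<tau>\<close> that agree on a large finite set differ by an element of that neighbourhood. Homomorphisms
  qualify, and so do cochains whose coboundary is the cup product of two homomorphisms.
\<close>

lemma locally_constant_of_cochain:
  fixes f :: "('a alg_closure \<Rightarrow> 'a alg_closure) \<Rightarrow> int"
  assumes f: "f \<in> cochains1 GF KT R" and S0: "finite S0" "S0 \<subseteq> Fs"
    and add: "\<And>\<sigma> \<nu>. \<sigma> \<in> carrier GF \<Longrightarrow> \<nu> \<in> carrier GF \<Longrightarrow> (\<forall>x\<in>S0. \<nu> x = x) \<Longrightarrow>
       [f (compose Fs \<sigma> \<nu>) = f \<sigma> + f \<nu>] (mod int p)"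
  shows "locally_constant f"
proof -
  have range: "f \<sigma> \<in> {0..<int p}" if "\<sigma> \<in> carrier GF" for \<sigma>
    using f that unfolding cochains1_iff by (auto simp: PiE_iff)
  define e where "e = (\<lambda>x\<in>Fs. x :: 'a alg_closure)"
  have e: "e \<in> carrier GF" unfolding e_def by (rule G_id)
  have "compose Fs e e = e" by (simp add: compose_def e_def fun_eq_iff)
  moreover have "\<forall>x\<in>S0. e x = x" using S0(2) by (auto simp: e_def)
  ultimately have "[f e = f e + f e] (mod int p)" using add[OF e e] by simp
  then have fe: "[f e = 0] (mod int p)" by (simp add: cong_iff_dvd_diff)
  obtain S1 where S1: "finite S1" "S1 \<subseteq> Fs" "\<forall>\<tau>\<in>carrier GF. (\<forall>x\<in>S1. \<tau> x = e x) \<longrightarrow> f \<tau> = f e"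
    using f e unfolding cochains1_iff by blast
  have "determined_by (S0 \<union> S1) f"
    unfolding determined_by_def
  proof (intro ballI impI)
    fix \<sigma> \<tau> assume \<sigma>: "\<sigma> \<in> carrier GF" and \<tau>: "\<tau> \<in> carrier GF" and eq: "\<forall>x\<in>S0 \<union> S1. \<sigma> x = \<tau> x"
    obtain \<rho> where \<rho>: "\<rho> \<in> carrier GF" "\<forall>x\<in>Fs. \<sigma> (\<rho> x) = x" "\<forall>x\<in>Fs. \<rho> (\<sigma> x) = x"
      using G_inv[OF \<sigma>] by blast
    define \<nu> where "\<nu> = compose Fs \<rho> \<tau>"
    have \<nu>: "\<nu> \<in> carrier GF" unfolding \<nu>_def by (rule G_comp[OF \<rho>(1) \<tau>])
    have fixes_S: "\<nu> x = x" if x: "x \<in> S0 \<union> S1" for x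
    proof -
      have "x \<in> Fs" using x S0(2) S1(2) by blast
      then have "\<nu> x = \<rho> (\<tau> x)" unfolding \<nu>_def by (rule compose_apply)
      also have "\<tau> x = \<sigma> x" using eq x by simp
      finally show ?thesis using \<rho>(3) \<open>x \<in> Fs\<close> by simp
    qed
    have "\<tau> = compose Fs \<sigma> \<nu>"
    proof (rule G_eqI[OF \<tau> G_comp[OF \<sigma> \<nu>]])
      fix x assume x: "x \<in> Fs"
      then show "\<tau> x = compose Fs \<sigma> \<nu> x"
        using \<rho>(2) G_in[OF \<tau> x] by (simp add: \<nu>_def compose_apply)
    qed
    then have "[f \<tau> = f \<sigma> + f \<nu>] (mod int p)" using add[OF \<sigma> \<nu>] fixes_S by blast
    moreover have "f \<nu> = f e"
    proof -
      have "\<forall>x\<in>S1. \<nu> x = e x" using fixes_S S1(2) by (auto simp: e_def)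
      then show ?thesis using S1(3) \<nu> by blast
    qed
    ultimately have "[f \<tau> = f \<sigma> + 0] (mod int p)" using fe cong_add cong_refl cong_trans by metis
    then show "f \<sigma> = f \<tau>" using range[OF \<sigma>] range[OF \<tau>] by (simp add: cong_def)
  qed
  then show ?thesis unfolding locally_constant_def using S0 S1(1,2) by blast
qed

lemma cochain_of_locally_constant:
  fixes K :: "('a alg_closure \<Rightarrow> 'a alg_closure) \<Rightarrow> int"
  assumes "locally_constant K"
  shows "(\<lambda>\<sigma>\<in>carrier GF. K \<sigma> mod int p) \<in> cochains1 GF KT R"
proof -
  obtain S where S: "finite S" "S \<subseteq> Fs" "determined_by S K"
    using assms unfolding locally_constant_def by blast
  show ?thesis
    unfolding cochains1_iff
  proof (intro conjI ballI)
    show "(\<lambda>\<sigma>\<in>carrier GF. K \<sigma> mod int p) \<in> carrier GF \<rightarrow>\<^sub>E {0..<int p}" using p_gt_1 by auto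
    fix \<sigma> :: "'a alg_closure \<Rightarrow> 'a alg_closure" assume \<sigma>: "\<sigma> \<in> carrier GF"
    show "\<exists>S. finite S \<and> S \<subseteq> Fs \<and> (\<forall>\<tau>\<in>carrier GF. (\<forall>x\<in>S. \<tau> x = \<sigma> x) \<longrightarrow>
        (\<lambda>\<sigma>\<in>carrier GF. K \<sigma> mod int p) \<tau> = (\<lambda>\<sigma>\<in>carrier GF. K \<sigma> mod int p) \<sigma>)"
    proof (intro exI[of _ S] conjI ballI impI S(1,2))
      fix \<tau> assume \<tau>: "\<tau> \<in> carrier GF" "\<forall>x\<in>S. \<tau> x = \<sigma> x"
      then have "K \<tau> = K \<sigma>" using S(3) \<sigma> unfolding determined_by_def by blast
      then show "(\<lambda>\<sigma>\<in>carrier GF. K \<sigma> mod int p) \<tau> = (\<lambda>\<sigma>\<in>carrier GF. K \<sigma> mod int p) \<sigma>"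
        using \<tau>(1) \<sigma> by simp
    qed
  qed
qed

text \<open>
  Locally constant integer-valued functions are reduced mod \<open>p\<close> to obtain continuous cochains.
\<close>

lemma vanishing_from_integer_cochains:
  fixes a b c r t K :: "('a alg_closure \<Rightarrow> 'a alg_closure) \<Rightarrow> int"
  assumes r: "primitive_of p r (\<lambda>\<sigma> \<tau>. a \<sigma> * b \<tau>)" and t: "primitive_of p t (\<lambda>\<sigma> \<tau>. b \<sigma> * c \<tau>)"
    and K: "primitive_of p K (\<lambda>\<sigma> \<tau>. a \<sigma> * t \<tau> + r \<sigma> * c \<tau>)"
  shows "\<one>\<^bsub>H2 GF KT R\<^esub> \<in> triple_massey GF KT R a b c"
proof -
  define red where "red f = (\<lambda>\<sigma>\<in>carrier GF. f \<sigma> mod int p)" for f :: "('a alg_closure \<Rightarrow> 'a alg_closure) \<Rightarrow> int"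
  have red_apply: "red f \<sigma> = f \<sigma> mod int p" if "\<sigma> \<in> carrier GF" for f \<sigma>
    using that by (simp add: red_def)
  have cob: "coboundary1 GF R (red f) (\<sigma>, \<tau>) = V \<sigma> \<tau> mod int p"
    if "primitive_of p f V" "\<sigma> \<in> carrier GF" "\<tau> \<in> carrier GF" for f V \<sigma> \<tau>
  proof -
    have "[red f \<sigma> + red f \<tau> - red f (compose Fs \<sigma> \<tau>) = f \<sigma> + f \<tau> - (f \<sigma> + f \<tau> - V \<sigma> \<tau>)] (mod int p)"
      using that(2,3) G_comp[OF that(2,3)] primitive_ofD(2)[OF that]
      by (intro cong_diff cong_add) (simp_all add: red_apply cong_def)
    then show ?thesis using that by (simp add: coboundary1_apply cong_def)
  qed
  have red: "red r \<in> cochains1 GF KT R" "red t \<in> cochains1 GF KT R" "red K \<in> cochains1 GF KT R"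
    unfolding red_def by (rule cochain_of_locally_constant[OF primitive_ofD(1)[OF r]]
      cochain_of_locally_constant[OF primitive_ofD(1)[OF t]] cochain_of_locally_constant[OF primitive_ofD(1)[OF K]])+
  have r': "coboundary1 GF R (red r) = cup GF R a b"
    by (rule cochain2_eqI) (simp_all add: cob[OF r] cup_apply)
  have t': "coboundary1 GF R (red t) = cup GF R b c"
    by (rule cochain2_eqI) (simp_all add: cob[OF t] cup_apply)
  have K': "coboundary1 GF R (red K) = add_cochain2 GF R (cup GF R a (red t)) (cup GF R (red r) c)"
    by (rule cochain2_eqI) (simp_all add: cob[OF K] cup_apply add_cochain2_apply red_apply mod_simps)
  have "defining_system GF KT R a b c (red r, red t)"
    using red(1,2) r' t' by (simp add: defining_system_def)
  moreover have "massey_value GF KT R a c (red r, red t) = \<one>\<^bsub>H2 GF KT R\<^esub>"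
    using trivial_class_of_coboundary[OF red(3)] by (simp add: massey_value_def K')
  ultimately show ?thesis unfolding triple_massey_def by (metis (mono_tags, lifting) mem_Collect_eq)
qed

theorem vanishing_triple_massey_property_GF:
  "vanishing_triple_massey_property p GF KT"
  unfolding vanishing_triple_massey_property_def Let_def
proof (intro ballI impI)
  fix a b c :: "('a alg_closure \<Rightarrow> 'a alg_closure) \<Rightarrow> int"
  assume abc: "a \<in> H1 GF KT R" "b \<in> H1 GF KT R" "c \<in> H1 GF KT R"
    and defined: "triple_massey_defined GF KT R a b c"
  have H1: "f \<in> cochains1 GF KT R" "\<And>\<sigma>. \<sigma> \<in> carrier GF \<Longrightarrow> f \<sigma> \<in> {0..<int p}" "character p f"
    if f: "f \<in> H1 GF KT R" for f :: "('a alg_closure \<Rightarrow> 'a alg_closure) \<Rightarrow> int"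
  proof -
    show 1: "f \<in> cochains1 GF KT R" using f by (simp add: H1_def)
    then show "f \<sigma> \<in> {0..<int p}" if "\<sigma> \<in> carrier GF" for \<sigma>
      using that unfolding cochains1_iff by (auto simp: PiE_iff)
    have 2: "[f (compose Fs \<sigma> \<tau>) = f \<sigma> + f \<tau>] (mod int p)" if "\<sigma> \<in> carrier GF" "\<tau> \<in> carrier GF" for \<sigma> \<tau>
    proof -
      have "f (\<sigma> \<otimes>\<^bsub>GF\<^esub> \<tau>) = f \<sigma> \<otimes>\<^bsub>add_monoid R\<^esub> f \<tau>" using f that unfolding H1_def hom_def by blast
      then show ?thesis by (simp add: residue_ring_simps cong_def)
    qed
    then have "locally_constant f" by (intro locally_constant_of_cochain[OF 1, of "{}"]) auto
    with 2 show "character p f" by (simp add: character_def)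
  qed
  have cup_trivial: "\<exists>D. primitive_of p D (\<lambda>\<sigma> \<tau>. f \<sigma> * g \<tau>)"
    if f: "f \<in> H1 GF KT R" and g: "g \<in> H1 GF KT R"
      and triv: "class2 GF KT R (cup GF R f g) = \<one>\<^bsub>H2 GF KT R\<^esub>" for f g :: "('a alg_closure \<Rightarrow> 'a alg_closure) \<Rightarrow> int"
  proof -
    obtain D where D: "D \<in> cochains1 GF KT R" "coboundary1 GF R D = cup GF R f g"
      by (rule coboundary_of_trivial_class[OF triv]) (use p_gt_1 in \<open>simp_all add: cup_apply\<close>)
    have D': "[D (compose Fs \<sigma> \<tau>) = D \<sigma> + D \<tau> - f \<sigma> * g \<tau>] (mod int p)" if "\<sigma> \<in> carrier GF" "\<tau> \<in> carrier GF" for \<sigma> \<tau>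
    proof -
      have "[D \<sigma> + D \<tau> - D (compose Fs \<sigma> \<tau>) = f \<sigma> * g \<tau>] (mod int p)"
        using fun_cong[OF D(2), of "(\<sigma>, \<tau>)"] that by (simp add: coboundary1_apply cup_apply cong_def)
      from cong_diff[OF cong_refl[of "D \<sigma> + D \<tau>"] this] show ?thesis by simp
    qed
    obtain S where S: "finite S" "S \<subseteq> Fs" "determined_by S g"
      using characterD(1)[OF H1(3)[OF g]] unfolding locally_constant_def by blast
    have "locally_constant D"
    proof (rule locally_constant_of_cochain[OF D(1) S(1,2)])
      fix \<sigma> \<nu> :: "'a alg_closure \<Rightarrow> 'a alg_closure"
      assume \<sigma>: "\<sigma> \<in> carrier GF" and \<nu>: "\<nu> \<in> carrier GF" and fixes_S: "\<forall>x\<in>S. \<nu> x = x"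
      have "\<forall>x\<in>S. \<nu> x = (\<lambda>x\<in>Fs. x) x" using fixes_S S(2) by auto
      then have "g \<nu> = g (\<lambda>x\<in>Fs. x)" using S(3) \<nu> G_id unfolding determined_by_def by blast
      then have "[D \<sigma> + D \<nu> - f \<sigma> * g \<nu> = D \<sigma> + D \<nu> - f \<sigma> * 0] (mod int p)"
        using character_identity[OF H1(3)[OF g]] by (intro cong_diff cong_mult cong_refl) simp
      then show "[D (compose Fs \<sigma> \<nu>) = D \<sigma> + D \<nu>] (mod int p)"
        using cong_trans[OF D'[OF \<sigma> \<nu>]] by simp
    qed
    with D' show ?thesis unfolding primitive_of_def by blast
  qed
  obtain D12 where D12: "primitive_of p D12 (\<lambda>\<sigma> \<tau>. a \<sigma> * b \<tau>)"
    using cup_trivial[OF abc(1,2)] defined unfolding triple_massey_defined_def by blast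
  obtain D23 where D23: "primitive_of p D23 (\<lambda>\<sigma> \<tau>. b \<sigma> * c \<tau>)"
    using cup_trivial[OF abc(2,3)] defined unfolding triple_massey_defined_def by blast
  show "\<one>\<^bsub>H2 GF KT R\<^esub> \<in> triple_massey GF KT R a b c"
  proof (cases "of_nat p = (0 :: 'a)")
    case True
    have char: "of_nat p = (0 :: 'a alg_closure)" using True by (metis to_ac_of_nat to_ac_0)
    have roots: "\<exists>y\<in>Fs. y ^ p - y = w" if "w \<in> Fs" for w :: "'a alg_closure"
      using separable_closure_artin_schreier[of w p] that True p_gt_1 by auto
    obtain K where "primitive_of p K (\<lambda>\<sigma> \<tau>. a \<sigma> * D23 \<tau> + D12 \<sigma> * c \<tau>)"
      using massey_vanishes_char_p[OF p char roots H1(3)[OF abc(1)] H1(3)[OF abc(2)] H1(3)[OF abc(3)] D12 D23] by blast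
    then show ?thesis by (rule vanishing_from_integer_cochains[OF D12 D23])
  next
    case False
    interpret kummer_massey Fs "carrier GF" p a c
    proof
      show "Factorial_Ring.prime p" by (rule p)
      show "\<exists>v\<in>Fs. v ^ p = w" if "w \<in> Fs" for w :: "'a alg_closure"
        using separable_closure_nth_root[of w p] that False p_gt_1 by auto
      show "\<exists>\<xi>\<in>Fs. \<xi> ^ p = 1 \<and> \<xi> \<noteq> (1 :: 'a alg_closure)"
        using separable_closure_root_of_unity[where ?'a = 'a and n = p] False p_gt_1 by auto
    qed (use H1 abc in blast)+
    obtain r t K where "primitive_of p r (\<lambda>\<sigma> \<tau>. a \<sigma> * b \<tau>)" "primitive_of p t (\<lambda>\<sigma> \<tau>. b \<sigma> * c \<tau>)"
      "primitive_of p K (\<lambda>\<sigma> \<tau>. a \<sigma> * t \<tau> + r \<sigma> * c \<tau>)"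
      using massey_vanishes_kummer[OF H1(3)[OF abc(2)] D12 D23] by blast
    then show ?thesis by (rule vanishing_from_integer_cochains)
  qed
qed

end

theorem theorem1p2:
  fixes p :: nat
  assumes "Factorial_Ring.prime p"
  shows "vanishing_triple_massey_property p
           (absolute_galois_group TYPE('a::field)) (krull_topology TYPE('a))"
  using vanishing_triple_massey_property_GF[OF assms] .

end
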